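(* Let $n\geq 2$, let $\Omega\subset\mathbb{C}^n$ be a $C^2$-smooth bounded pseudoconvex domain, and let $\varphi\in\mathcal{O}(\Omega)\cap C^2(\overline{\Omega})$. Then the Hankel operator $H_{\overline{\varphi}}$ is Hilbert-Schmidt on the Bergman space $A^2(\Omega)$ if and only if $\varphi$ is a constant function.
   Context: $\mathcal{O}(\Omega)$ is the space of holomorphic functions on $\Omega$, and $C^2(\overline{\Omega})$ is the space of functions that are $C^2$-smooth on the closure $\overline{\Omega}$. $L^2(\Omega)$ is taken with respect to Lebesgue measure, and $A^2(\Omega)$ is the Bergman space, i.e. the closed subspace of $L^2(\Omega)$ consisting of square integrable holomorphic functions on $\Omega$. $P:L^2(\Omega)\to A^2(\Omega)$ is the Bergman projection (the orthogonal projection). For $\psi\in L^\infty(\Omega)$ the Hankel operator $H_\psi:A^2(\Omega)\to L^2(\Omega)$ with symbol $\psi$ is $H_\psi f=(I-P)(\psi f)$, where $I$ is the identity map; $H_{\overline{\varphi}}$ is the Hankel operator whose symbol is the complex conjugate $\overline{\varphi}$. *)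

theory Defs
  imports "HOL-Analysis.Analysis"
begin

definition C2_on :: "'a::real_normed_vector set \<Rightarrow> ('a \<Rightarrow> 'b::real_normed_vector) \<Rightarrow> bool" where
  "C2_on U f \<longleftrightarrow>
     (\<exists>(f' :: 'a \<Rightarrow> 'a \<Rightarrow>\<^sub>L 'b) (f'' :: 'a \<Rightarrow> 'a \<Rightarrow>\<^sub>L ('a \<Rightarrow>\<^sub>L 'b)).
        (\<forall>x\<in>U. (f has_derivative blinfun_apply (f' x)) (at x)) \<and>
        (\<forall>x\<in>U. (f' has_derivative blinfun_apply (f'' x)) (at x)) \<and>
        continuous_on U f'')"

definition C2_on_closure :: "'a::real_normed_vector set \<Rightarrow> ('a \<Rightarrow> 'b::real_normed_vector) \<Rightarrow> bool" where
  "C2_on_closure \<Omega> f \<longleftrightarrow>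
     (\<exists>U g. open U \<and> closure \<Omega> \<subseteq> U \<and> C2_on U g \<and> (\<forall>z\<in>closure \<Omega>. g z = f z))"

text \<open>In the next definition the derivative condition says that the gradient of the local
  defining function does not vanish at \<open>p\<close>; that \<open>\<rho> p = 0\<close> follows from
  \<open>p \<in> frontier \<Omega>\<close> by continuity.\<close>

definition C2_boundary :: "'a::real_normed_vector set \<Rightarrow> bool" where
  "C2_boundary \<Omega> \<longleftrightarrow>
     (\<forall>p\<in>frontier \<Omega>. \<exists>U (\<rho> :: 'a \<Rightarrow> real).
        open U \<and> p \<in> U \<and> C2_on U \<rho> \<and> \<Omega> \<inter> U = {z \<in> U. \<rho> z < 0} \<and>
        \<not> (\<rho> has_derivative (\<lambda>_. 0)) (at p))"

text \<open>Holomorphy in several variables, meant for open \<open>\<Omega>\<close>: the real Frechet derivative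
  exists at every point and is complex linear, with the complex partial derivatives \<open>a $ i\<close>.\<close>

definition holomorphic_Cn_on :: "(complex ^ 'n \<Rightarrow> complex) \<Rightarrow> (complex ^ 'n) set \<Rightarrow> bool" where
  "holomorphic_Cn_on f \<Omega> \<longleftrightarrow>
     (\<forall>z\<in>\<Omega>. \<exists>a :: complex ^ 'n. (f has_derivative (\<lambda>v. \<Sum>i\<in>UNIV. a $ i * v $ i)) (at z))"

definition continuous_plurisubharmonic_on ::
    "(complex ^ 'n \<Rightarrow> real) \<Rightarrow> (complex ^ 'n) set \<Rightarrow> bool" where
  "continuous_plurisubharmonic_on u \<Omega> \<longleftrightarrow>
     continuous_on \<Omega> u \<and>
     (\<forall>z v. (\<forall>\<zeta>\<in>cball 0 1. z + \<zeta> *s v \<in> \<Omega>) \<longrightarrow>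
        u z \<le> integral {0..2 * pi} (\<lambda>t. u (z + cis t *s v)) / (2 * pi))"

text \<open>Pseudoconvexity: existence of a continuous plurisubharmonic exhaustion function. For
  bounded domains with \<open>C\<^sup>2\<close> boundary this agrees with Levi pseudoconvexity.\<close>

definition pseudoconvex :: "(complex ^ 'n) set \<Rightarrow> bool" where
  "pseudoconvex \<Omega> \<longleftrightarrow>
     (\<exists>u. continuous_plurisubharmonic_on u \<Omega> \<and> (\<forall>c. compact {z \<in> \<Omega>. u z \<le> c}))"

text \<open>Elements of \<open>L\<^sup>2(\<Omega>)\<close> are represented by total functions; two functions represent the
  same element iff they agree almost everywhere on \<open>\<Omega>\<close>, and values outside \<open>\<Omega>\<close> are
  irrelevant.\<close>

definition L2 :: "(complex ^ 'n) set \<Rightarrow> (complex ^ 'n \<Rightarrow> complex) set" where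
  "L2 \<Omega> = {f \<in> borel_measurable (lebesgue_on \<Omega>).
             integrable (lebesgue_on \<Omega>) (\<lambda>z. (norm (f z))\<^sup>2)}"

definition L2_inner ::
    "(complex ^ 'n) set \<Rightarrow> (complex ^ 'n \<Rightarrow> complex) \<Rightarrow> (complex ^ 'n \<Rightarrow> complex) \<Rightarrow> complex" where
  "L2_inner \<Omega> f g = (LINT z|lebesgue_on \<Omega>. f z * cnj (g z))"

definition L2_norm :: "(complex ^ 'n) set \<Rightarrow> (complex ^ 'n \<Rightarrow> complex) \<Rightarrow> real" where
  "L2_norm \<Omega> f = sqrt (LINT z|lebesgue_on \<Omega>. (norm (f z))\<^sup>2)"

definition A2 :: "(complex ^ 'n) set \<Rightarrow> (complex ^ 'n \<Rightarrow> complex) set" where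
  "A2 \<Omega> = {f \<in> L2 \<Omega>. holomorphic_Cn_on f \<Omega>}"

text \<open>The orthogonal projection onto the Bergman space. On an open set \<open>\<Omega>\<close> the values of the
  chosen function on \<open>\<Omega>\<close> are uniquely determined; only its values outside \<open>\<Omega>\<close> are
  arbitrary.\<close>

definition bergman_proj ::
    "(complex ^ 'n) set \<Rightarrow> (complex ^ 'n \<Rightarrow> complex) \<Rightarrow> (complex ^ 'n \<Rightarrow> complex)" where
  "bergman_proj \<Omega> f =
     (SOME g. g \<in> A2 \<Omega> \<and> (\<forall>h\<in>A2 \<Omega>. L2_inner \<Omega> (\<lambda>z. f z - g z) h = 0))"

definition hankel ::
    "(complex ^ 'n) set \<Rightarrow> (complex ^ 'n \<Rightarrow> complex) \<Rightarrow>
     (complex ^ 'n \<Rightarrow> complex) \<Rightarrow> (complex ^ 'n \<Rightarrow> complex)" where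
  "hankel \<Omega> \<psi> f = (\<lambda>z. \<psi> z * f z - bergman_proj \<Omega> (\<lambda>w. \<psi> w * f w) z)"

definition bounded_operator_A2_L2 ::
    "(complex ^ 'n) set \<Rightarrow> ((complex ^ 'n \<Rightarrow> complex) \<Rightarrow> (complex ^ 'n \<Rightarrow> complex)) \<Rightarrow> bool" where
  "bounded_operator_A2_L2 \<Omega> T \<longleftrightarrow>
     (\<forall>f\<in>A2 \<Omega>. T f \<in> L2 \<Omega>) \<and>
     (\<forall>f\<in>A2 \<Omega>. \<forall>g\<in>A2 \<Omega>. \<forall>a b.
        AE z in lebesgue_on \<Omega>. T (\<lambda>w. a * f w + b * g w) z = a * T f z + b * T g z) \<and>
     (\<exists>C. \<forall>f\<in>A2 \<Omega>. L2_norm \<Omega> (T f) \<le> C * L2_norm \<Omega> f)"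

text \<open>An orthonormal basis of the Hilbert space \<open>A2 \<Omega>\<close>, i.e. a maximal orthonormal set.\<close>

definition orthonormal_basis_A2 ::
    "(complex ^ 'n) set \<Rightarrow> (complex ^ 'n \<Rightarrow> complex) set \<Rightarrow> bool" where
  "orthonormal_basis_A2 \<Omega> E \<longleftrightarrow>
     E \<subseteq> A2 \<Omega> \<and>
     (\<forall>e\<in>E. \<forall>e'\<in>E. L2_inner \<Omega> e e' = (if e = e' then 1 else 0)) \<and>
     (\<forall>f\<in>A2 \<Omega>. (\<forall>e\<in>E. L2_inner \<Omega> f e = 0) \<longrightarrow> L2_norm \<Omega> f = 0)"

text \<open>For a bounded operator the sum does not depend on the orthonormal basis.\<close>

definition hilbert_schmidt_A2 ::
    "(complex ^ 'n) set \<Rightarrow> ((complex ^ 'n \<Rightarrow> complex) \<Rightarrow> (complex ^ 'n \<Rightarrow> complex)) \<Rightarrow> bool" where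
  "hilbert_schmidt_A2 \<Omega> T \<longleftrightarrow>
     bounded_operator_A2_L2 \<Omega> T \<and>
     (\<exists>E. orthonormal_basis_A2 \<Omega> E \<and> (\<lambda>e. (L2_norm \<Omega> (T e))\<^sup>2) summable_on E)"

end

theory Submission
  imports Defs "HOL-Complex_Analysis.Complex_Analysis"
begin

text \<open>
  Let \<open>T\<close> be multiplication by \<open>\<phi>\<close> on the Bergman space and \<open>H\<close> the Hankel operator with symbol
  \<open>cnj \<phi>\<close>. Then \<open>\<parallel>H f\<parallel>\<^sup>2 = \<parallel>T f\<parallel>\<^sup>2 - \<parallel>T\<^sup>* f\<parallel>\<^sup>2\<close>, so \<open>H\<close> is Hilbert-Schmidt iff the self-commutator of
  \<open>T\<close> has finite trace. If \<open>\<phi>\<close> is not constant, some \<open>\<partial>\<^sub>i \<phi>\<close> is nonzero at a point \<open>p\<close>, and since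
  the dimension is at least two the level set of \<open>\<phi>\<close> through \<open>p\<close> contains arbitrarily many points
  \<open>q\<^sub>0, \<dots>, q\<^sub>m\<^sub>-\<^sub>1\<close> near \<open>p\<close>. Order the Taylor coefficients of order \<open>r\<close> at \<open>q\<^sub>b\<close> in direction \<open>i\<close> by
  \<open>k = r m + b\<close>, and let \<open>e\<^sub>k\<close> be the orthonormal basis adapted to the flag of common kernels of the
  first \<open>k\<close> coefficients. As \<open>T - \<phi>(p)\<close> raises \<open>k\<close> by \<open>m\<close>, the trace is at least
  \<open>\<Sum>\<^sub>b \<bar>\<langle>T e\<^sub>k, e\<^sub>k\<^sub>+\<^sub>m\<rangle>\<bar>\<^sup>2\<close> for every \<open>r\<close>. These entries are \<open>\<partial>\<^sub>i \<phi>(q\<^sub>b) c\<^sub>k / c\<^sub>k\<^sub>+\<^sub>m\<close>, where \<open>c\<^sub>k\<close> is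
  the leading coefficient of \<open>e\<^sub>k\<close>, and the Cauchy estimate \<open>c\<^sub>k \<le> C / \<rho>\<^sup>r\<close> with the arithmetic-geometric
  mean inequality bounds the trace below by a constant times \<open>m\<close>. Hence the trace is infinite.
\<close>

section \<open>The semi-inner product space of square integrable functions\<close>

text \<open>The number \<open>m\<close> of points is where the dimension enters. In one variable
  level sets are discrete, \<open>m\<close> cannot grow, and for the coordinate function on the unit
  disc the Hankel operator really is Hilbert-Schmidt; a fixed positive lower bound is all that a
  single point can give. Everything hinges on choosing \<open>\<rho>\<close> and the lower bound for
  the derivative near \<open>p\<close> before \<open>m\<close>. The vectors of the flag are
  orthonormal but not complete: a polynomial in \<open>z $ j\<close> that vanishes at all the points
  is annihilated by every functional. So only finite sections are used. Multiplication by
  \<open>\<phi>\<close> preserves each member of the flag, hence its adjoint preserves the span of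
  the first vectors, and adjoint norms there are exact finite sums; the norms that are not
  subtracted need only Bessel's inequality. A single ratio of leading coefficients may be small.
  Long products of ratios cannot, because they telescope and the last leading coefficient is
  controlled by the Cauchy estimate; hence a mean inequality over many orders instead of an estimate
  for one.\<close>

lemma L2_measurable: "f \<in> L2 \<Omega> \<Longrightarrow> f \<in> borel_measurable (lebesgue_on \<Omega>)"
  and L2_integrable: "f \<in> L2 \<Omega> \<Longrightarrow> integrable (lebesgue_on \<Omega>) (\<lambda>z. (norm (f z))\<^sup>2)"
  by (auto simp: L2_def)

lemma mult_cnj_eq_of_real: "z * cnj z = of_real ((cmod z)\<^sup>2)"
  by (simp add: complex_norm_square del: of_real_power)

lemma borel_measurable_cnj:
  "f \<in> borel_measurable M \<Longrightarrow> (\<lambda>z. cnj (f z)) \<in> borel_measurable M"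
  by (rule measurable_compose[OF _ borel_measurable_continuous_onI]) (auto intro: continuous_intros)

lemma L2_add:
  assumes "f \<in> L2 \<Omega>" "g \<in> L2 \<Omega>"
  shows "(\<lambda>z. f z + g z) \<in> L2 \<Omega>"
proof -
  have "integrable (lebesgue_on \<Omega>) (\<lambda>z. 2 * (norm (f z))\<^sup>2 + 2 * (norm (g z))\<^sup>2)"
    using assms by (intro Bochner_Integration.integrable_add Bochner_Integration.integrable_mult_right L2_integrable)
  moreover have "(norm (f z + g z))\<^sup>2 \<le> 2 * (norm (f z))\<^sup>2 + 2 * (norm (g z))\<^sup>2" for z
  proof -
    have "(norm (f z + g z))\<^sup>2 \<le> (norm (f z) + norm (g z))\<^sup>2"
      by (simp add: norm_triangle_ineq power_mono)
    also have "\<dots> \<le> 2 * (norm (f z))\<^sup>2 + 2 * (norm (g z))\<^sup>2"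
      using sum_squares_bound[of "norm (f z)" "norm (g z)"] by (simp add: power2_sum)
    finally show ?thesis .
  qed
  ultimately have "integrable (lebesgue_on \<Omega>) (\<lambda>z. (norm (f z + g z))\<^sup>2)"
    using L2_measurable[OF assms(1)] L2_measurable[OF assms(2)]
    by (rule_tac Bochner_Integration.integrable_bound[of _ "\<lambda>z. 2 * (norm (f z))\<^sup>2 + 2 * (norm (g z))\<^sup>2"]) auto
  then show ?thesis
    using assms unfolding L2_def by (simp add: borel_measurable_add)
qed

lemma L2_mult_bounded:
  assumes "f \<in> L2 \<Omega>" "\<psi> \<in> borel_measurable (lebesgue_on \<Omega>)" "\<And>z. z \<in> \<Omega> \<Longrightarrow> norm (\<psi> z) \<le> B"
  shows "(\<lambda>z. \<psi> z * f z) \<in> L2 \<Omega>"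
proof -
  have "integrable (lebesgue_on \<Omega>) (\<lambda>z. (norm (\<psi> z * f z))\<^sup>2)"
  proof (rule Bochner_Integration.integrable_bound[of _ "\<lambda>z. B\<^sup>2 * (norm (f z))\<^sup>2"])
    show "integrable (lebesgue_on \<Omega>) (\<lambda>z. B\<^sup>2 * (norm (f z))\<^sup>2)"
      by (intro Bochner_Integration.integrable_mult_right L2_integrable assms)
    show "AE z in lebesgue_on \<Omega>. norm ((norm (\<psi> z * f z))\<^sup>2) \<le> norm (B\<^sup>2 * (norm (f z))\<^sup>2)"
    proof (rule AE_I2)
      fix z assume "z \<in> space (lebesgue_on \<Omega>)"
      then have "norm (\<psi> z) \<le> B"
        using assms(3) by (simp add: space_restrict_space)
      then have "(norm (\<psi> z * f z))\<^sup>2 \<le> (B * norm (f z))\<^sup>2"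
        by (intro power_mono) (auto simp: norm_mult mult_right_mono)
      then show "norm ((norm (\<psi> z * f z))\<^sup>2) \<le> norm (B\<^sup>2 * (norm (f z))\<^sup>2)"
        by (simp add: power_mult_distrib)
    qed
  qed (use assms(2) L2_measurable[OF assms(1)] in simp)
  then show ?thesis
    using assms unfolding L2_def by (simp add: borel_measurable_times)
qed

lemma L2_scale: "f \<in> L2 \<Omega> \<Longrightarrow> (\<lambda>z. c * f z) \<in> L2 \<Omega>"
  by (rule L2_mult_bounded[where B="norm c"]) auto

lemma L2_diff: "f \<in> L2 \<Omega> \<Longrightarrow> g \<in> L2 \<Omega> \<Longrightarrow> (\<lambda>z. f z - g z) \<in> L2 \<Omega>"
  using L2_add[of f \<Omega> "\<lambda>z. (- 1) * g z"] L2_scale[of g \<Omega> "-1"] by simp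

lemma L2_zero: "(\<lambda>z. 0) \<in> L2 \<Omega>"
  by (simp add: L2_def)

lemma L2_sum: "(\<And>i. i \<in> I \<Longrightarrow> e i \<in> L2 \<Omega>) \<Longrightarrow> (\<lambda>z. \<Sum>i\<in>I. c i * e i z) \<in> L2 \<Omega>"
  by (induction I rule: infinite_finite_induct) (auto intro!: L2_zero L2_add L2_scale)

lemma integrable_L2_inner:
  assumes "f \<in> L2 \<Omega>" "g \<in> L2 \<Omega>"
  shows "integrable (lebesgue_on \<Omega>) (\<lambda>z. f z * cnj (g z))"
proof (rule Bochner_Integration.integrable_bound[of _ "\<lambda>z. (norm (f z))\<^sup>2 + (norm (g z))\<^sup>2"])
  show "integrable (lebesgue_on \<Omega>) (\<lambda>z. (norm (f z))\<^sup>2 + (norm (g z))\<^sup>2)"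
    by (intro Bochner_Integration.integrable_add L2_integrable assms)
  show "(\<lambda>z. f z * cnj (g z)) \<in> borel_measurable (lebesgue_on \<Omega>)"
    using assms by (intro borel_measurable_times borel_measurable_cnj L2_measurable)
  have "norm (f z) * norm (g z) \<le> (norm (f z))\<^sup>2 + (norm (g z))\<^sup>2" for z
  proof -
    have "0 \<le> norm (f z) * norm (g z)"
      by simp
    then show ?thesis
      using sum_squares_bound[of "norm (f z)" "norm (g z)"] by linarith
  qed
  then show "AE z in lebesgue_on \<Omega>. norm (f z * cnj (g z)) \<le> norm ((norm (f z))\<^sup>2 + (norm (g z))\<^sup>2)"
    by (simp add: norm_mult)
qed

lemma L2_inner_add_left:
  "f \<in> L2 \<Omega> \<Longrightarrow> g \<in> L2 \<Omega> \<Longrightarrow> h \<in> L2 \<Omega> \<Longrightarrow>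
    L2_inner \<Omega> (\<lambda>z. f z + g z) h = L2_inner \<Omega> f h + L2_inner \<Omega> g h"
  unfolding L2_inner_def
  by (subst Bochner_Integration.integral_add[symmetric]) (auto intro: integrable_L2_inner simp: algebra_simps)

lemma L2_inner_diff_left:
  "f \<in> L2 \<Omega> \<Longrightarrow> g \<in> L2 \<Omega> \<Longrightarrow> h \<in> L2 \<Omega> \<Longrightarrow>
    L2_inner \<Omega> (\<lambda>z. f z - g z) h = L2_inner \<Omega> f h - L2_inner \<Omega> g h"
  unfolding L2_inner_def
  by (subst Bochner_Integration.integral_diff[symmetric]) (auto intro: integrable_L2_inner simp: algebra_simps)

lemma L2_inner_scale_left: "L2_inner \<Omega> (\<lambda>z. c * f z) h = c * L2_inner \<Omega> f h"
  unfolding L2_inner_def by (simp add: mult.assoc)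

lemma L2_inner_zero_left [simp]: "L2_inner \<Omega> (\<lambda>z. 0) h = 0"
  by (simp add: L2_inner_def)

lemma L2_inner_commute: "L2_inner \<Omega> f g = cnj (L2_inner \<Omega> g f)"
  unfolding L2_inner_def
  by (subst Bochner_Integration.integral_cnj[symmetric]) (simp add: mult.commute)

lemma L2_inner_sum_left:
  assumes "\<And>i. i \<in> I \<Longrightarrow> e i \<in> L2 \<Omega>" "h \<in> L2 \<Omega>"
  shows "L2_inner \<Omega> (\<lambda>z. \<Sum>i\<in>I. c i * e i z) h = (\<Sum>i\<in>I. c i * L2_inner \<Omega> (e i) h)"
  using assms(1)
proof (induction I rule: infinite_finite_induct)
  case (insert x F)
  then show ?case
    using assms(2) by (simp add: L2_inner_add_left L2_scale L2_sum L2_inner_scale_left)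
qed auto

lemma L2_inner_diff_sum_left:
  assumes "f \<in> L2 \<Omega>" "\<And>i. i \<in> I \<Longrightarrow> e i \<in> L2 \<Omega>" "h \<in> L2 \<Omega>"
  shows "L2_inner \<Omega> (\<lambda>z. f z - (\<Sum>i\<in>I. c i * e i z)) h = L2_inner \<Omega> f h - (\<Sum>i\<in>I. c i * L2_inner \<Omega> (e i) h)"
proof -
  have "L2_inner \<Omega> (\<lambda>z. f z - (\<Sum>i\<in>I. c i * e i z)) h =
      L2_inner \<Omega> f h - L2_inner \<Omega> (\<lambda>z. \<Sum>i\<in>I. c i * e i z) h"
    using assms by (intro L2_inner_diff_left L2_sum)
  also have "L2_inner \<Omega> (\<lambda>z. \<Sum>i\<in>I. c i * e i z) h = (\<Sum>i\<in>I. c i * L2_inner \<Omega> (e i) h)"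
    using assms(2,3) by (rule L2_inner_sum_left)
  finally show ?thesis .
qed

lemma L2_inner_diff_right:
  "f \<in> L2 \<Omega> \<Longrightarrow> g \<in> L2 \<Omega> \<Longrightarrow> h \<in> L2 \<Omega> \<Longrightarrow>
    L2_inner \<Omega> h (\<lambda>z. f z - g z) = L2_inner \<Omega> h f - L2_inner \<Omega> h g"
  unfolding L2_inner_commute[of \<Omega> h] by (simp only: L2_inner_diff_left complex_cnj_diff)

lemma L2_inner_scale_right: "L2_inner \<Omega> h (\<lambda>z. c * f z) = cnj c * L2_inner \<Omega> h f"
  unfolding L2_inner_commute[of \<Omega> h] by (simp only: L2_inner_scale_left complex_cnj_mult)

lemma L2_inner_sum_right:
  assumes "\<And>i. i \<in> I \<Longrightarrow> e i \<in> L2 \<Omega>" "h \<in> L2 \<Omega>"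
  shows "L2_inner \<Omega> h (\<lambda>z. \<Sum>i\<in>I. c i * e i z) = (\<Sum>i\<in>I. cnj (c i) * L2_inner \<Omega> h (e i))"
proof -
  have "L2_inner \<Omega> h (\<lambda>z. \<Sum>i\<in>I. c i * e i z) = cnj (\<Sum>i\<in>I. c i * L2_inner \<Omega> (e i) h)"
    by (subst L2_inner_commute) (simp only: L2_inner_sum_left[OF assms])
  also have "\<dots> = (\<Sum>i\<in>I. cnj (c i) * L2_inner \<Omega> h (e i))"
    unfolding cnj_sum complex_cnj_mult L2_inner_commute[of \<Omega> h] ..
  finally show ?thesis .
qed

lemma L2_norm_nonneg [simp]: "0 \<le> L2_norm \<Omega> f"
  by (simp add: L2_norm_def)

lemma L2_norm_power2: "(L2_norm \<Omega> f)\<^sup>2 = (LINT z|lebesgue_on \<Omega>. (norm (f z))\<^sup>2)"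
  by (simp add: L2_norm_def)

lemma L2_inner_self: "L2_inner \<Omega> f f = of_real ((L2_norm \<Omega> f)\<^sup>2)"
  unfolding L2_norm_power2 L2_inner_def
  by (subst Bochner_Integration.integral_complex_of_real[symmetric]) (simp add: mult_cnj_eq_of_real)

lemma L2_norm_cong: "(\<And>z. norm (f z) = norm (g z)) \<Longrightarrow> L2_norm \<Omega> f = L2_norm \<Omega> g"
  by (simp add: L2_norm_def)

lemma L2_norm_eq_0_AE:
  assumes "f \<in> L2 \<Omega>" "L2_norm \<Omega> f = 0"
  shows "AE z in lebesgue_on \<Omega>. f z = 0"
proof -
  have "(LINT z|lebesgue_on \<Omega>. (norm (f z))\<^sup>2) = 0"
    using assms(2) L2_norm_power2[of \<Omega> f] by simp
  then show ?thesis
    using integral_nonneg_eq_0_iff_AE[OF L2_integrable[OF assms(1)]] by auto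
qed

lemma L2_norm_diff_power2:
  assumes "f \<in> L2 \<Omega>" "g \<in> L2 \<Omega>"
  shows "(L2_norm \<Omega> (\<lambda>z. f z - g z))\<^sup>2 = (L2_norm \<Omega> f)\<^sup>2 - 2 * Re (L2_inner \<Omega> f g) + (L2_norm \<Omega> g)\<^sup>2"
proof -
  have "complex_of_real ((L2_norm \<Omega> (\<lambda>z. f z - g z))\<^sup>2) =
     L2_inner \<Omega> f f - L2_inner \<Omega> f g - L2_inner \<Omega> g f + L2_inner \<Omega> g g"
    unfolding L2_inner_self[symmetric] using assms
    by (simp add: L2_inner_diff_left L2_inner_diff_right L2_diff)
  from arg_cong[OF this, of Re] show ?thesis
    by (subst (asm) L2_inner_commute[of _ g f]) (simp add: L2_inner_self)
qed

lemma L2_norm_scale: "L2_norm \<Omega> (\<lambda>z. c * f z) = norm c * L2_norm \<Omega> f"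
proof -
  have "(L2_norm \<Omega> (\<lambda>z. c * f z))\<^sup>2 = (norm c * L2_norm \<Omega> f)\<^sup>2"
    by (simp add: L2_norm_power2 power_mult_distrib norm_mult)
  then show ?thesis
    by simp
qed

text \<open>The squared norm of \<open>f - c g\<close> is nonnegative for every \<open>c\<close>.
  Since the form is only semidefinite, the optimal \<open>c\<close> does not exist when
  \<open>g\<close> has norm zero; there a large multiple of \<open>p\<close> forces
  \<open>p = 0\<close>.\<close>

lemma L2_Cauchy_Schwarz:
  assumes "f \<in> L2 \<Omega>" "g \<in> L2 \<Omega>"
  shows "norm (L2_inner \<Omega> f g) \<le> L2_norm \<Omega> f * L2_norm \<Omega> g"
proof -
  define p where "p = L2_inner \<Omega> f g"
  have *: "0 \<le> (L2_norm \<Omega> f)\<^sup>2 - 2 * Re (cnj c * p) + (norm c)\<^sup>2 * (L2_norm \<Omega> g)\<^sup>2" for c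
    using L2_norm_diff_power2[OF assms(1) L2_scale[OF assms(2)], of c]
      zero_le_power2[of "L2_norm \<Omega> (\<lambda>z. f z - c * g z)"]
    unfolding L2_inner_scale_right L2_norm_scale power_mult_distrib p_def by linarith
  show ?thesis
  proof (cases "L2_norm \<Omega> g = 0")
    case True
    have "p = 0"
    proof (rule ccontr)
      assume "p \<noteq> 0"
      \<comment> \<open>With this \<open>s\<close> the linear term is
        \<open>(L2_norm \<Omega> f)\<^sup>2 + 1\<close>, and the quadratic term vanishes.\<close>
      define s where "s = ((L2_norm \<Omega> f)\<^sup>2 + 1) / (2 * (norm p)\<^sup>2)"
      have "cnj (of_real s * p) * p = of_real (s * (norm p)\<^sup>2)"
        using mult_cnj_eq_of_real[of p] by (simp add: mult.commute)
      then have "Re (cnj (of_real s * p) * p) = s * (norm p)\<^sup>2"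
        by (metis Re_complex_of_real)
      with *[of "of_real s * p"] True have "2 * (s * (norm p)\<^sup>2) \<le> (L2_norm \<Omega> f)\<^sup>2"
        by (simp only:) simp
      moreover have "2 * (s * (norm p)\<^sup>2) = (L2_norm \<Omega> f)\<^sup>2 + 1"
        using \<open>p \<noteq> 0\<close> by (simp add: s_def)
      ultimately show False by linarith
    qed
    then show ?thesis by (simp add: p_def[symmetric])
  next
    case False
    define b where "b = (L2_norm \<Omega> g)\<^sup>2"
    have b: "b > 0" using False by (simp add: b_def)
    have "cnj (p / of_real b) * p = of_real ((norm p)\<^sup>2 / b)"
      using mult_cnj_eq_of_real[of p] by (simp add: mult.commute)
    then have "Re (cnj (p / of_real b) * p) = (norm p)\<^sup>2 / b"
      by (metis Re_complex_of_real)
    moreover have "(norm (p / of_real b))\<^sup>2 * b = (norm p)\<^sup>2 / b"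
      using b by (simp add: norm_divide power_divide) (simp add: power2_eq_square)
    ultimately have "0 \<le> (L2_norm \<Omega> f)\<^sup>2 - (norm p)\<^sup>2 / b"
      using *[of "p / of_real b"] unfolding b_def[symmetric] by linarith
    then have "(norm p)\<^sup>2 \<le> (L2_norm \<Omega> f * L2_norm \<Omega> g)\<^sup>2"
      using b by (simp add: field_simps b_def power_mult_distrib)
    then show ?thesis
      by (simp add: p_def power2_le_iff_abs_le)
  qed
qed

lemma L2_norm_triangle:
  assumes "f \<in> L2 \<Omega>" "g \<in> L2 \<Omega>"
  shows "L2_norm \<Omega> (\<lambda>z. f z - g z) \<le> L2_norm \<Omega> f + L2_norm \<Omega> g"
proof -
  have "(L2_norm \<Omega> (\<lambda>z. f z - g z))\<^sup>2 \<le> (L2_norm \<Omega> f + L2_norm \<Omega> g)\<^sup>2"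
    using L2_norm_diff_power2[OF assms] L2_Cauchy_Schwarz[OF assms]
      abs_Re_le_cmod[of "L2_inner \<Omega> f g"]
    by (simp add: power2_sum)
  then show ?thesis
    by (rule power2_le_imp_le) simp
qed

lemma L2_norm_minus_commute: "L2_norm \<Omega> (\<lambda>z. f z - g z) = L2_norm \<Omega> (\<lambda>z. g z - f z)"
  by (rule L2_norm_cong) (rule norm_minus_commute)

lemma L2_dist_triangle:
  assumes "f \<in> L2 \<Omega>" "g \<in> L2 \<Omega>" "h \<in> L2 \<Omega>"
  shows "L2_norm \<Omega> (\<lambda>z. f z - h z) \<le> L2_norm \<Omega> (\<lambda>z. f z - g z) + L2_norm \<Omega> (\<lambda>z. g z - h z)"
  using L2_norm_triangle[OF L2_diff[OF assms(1,2)] L2_diff[OF assms(3,2)]]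
  unfolding L2_norm_minus_commute[of \<Omega> h g] by simp

section \<open>Orthonormal families, Bessel's inequality and Gram-Schmidt\<close>

definition orthonormal_on :: "(complex ^ 'n) set \<Rightarrow> 'i set \<Rightarrow> ('i \<Rightarrow> complex ^ 'n \<Rightarrow> complex) \<Rightarrow> bool" where
  "orthonormal_on \<Omega> I e \<longleftrightarrow> (\<forall>i\<in>I. e i \<in> L2 \<Omega>) \<and>
     (\<forall>i\<in>I. \<forall>j\<in>I. L2_inner \<Omega> (e i) (e j) = (if i = j then 1 else 0))"

text \<open>Completing the square separates \<open>c\<close> from the Fourier coefficients. Equal to
  them, \<open>c\<close> yields Bessel's inequality; any other \<open>c\<close> bounds the defect in
  that inequality by the distance to a linear combination.\<close>

lemma orthonormal_distance_power2:
  assumes e: "orthonormal_on \<Omega> I e" and "finite I" and f: "f \<in> L2 \<Omega>"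
  shows "(L2_norm \<Omega> (\<lambda>z. f z - (\<Sum>i\<in>I. c i * e i z)))\<^sup>2 =
    (L2_norm \<Omega> f)\<^sup>2 - (\<Sum>i\<in>I. (norm (L2_inner \<Omega> f (e i)))\<^sup>2) + (\<Sum>i\<in>I. (norm (c i - L2_inner \<Omega> f (e i)))\<^sup>2)"
proof -
  define s where "s = (\<lambda>z. \<Sum>i\<in>I. c i * e i z)"
  have eL: "\<And>i. i \<in> I \<Longrightarrow> e i \<in> L2 \<Omega>" using e by (auto simp: orthonormal_on_def)
  have s: "s \<in> L2 \<Omega>" unfolding s_def using eL by (rule L2_sum)
  have fs: "L2_inner \<Omega> f s = (\<Sum>i\<in>I. cnj (c i) * L2_inner \<Omega> f (e i))"
    unfolding s_def using eL f by (rule L2_inner_sum_right)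
  have es: "L2_inner \<Omega> (e i) s = cnj (c i)" if "i \<in> I" for i
  proof -
    have "L2_inner \<Omega> (e i) s = (\<Sum>j\<in>I. cnj (c j) * L2_inner \<Omega> (e i) (e j))"
      unfolding s_def using eL that by (intro L2_inner_sum_right) auto
    also have "\<dots> = (\<Sum>j\<in>I. cnj (c j) * (if i = j then 1 else 0))"
      using e that by (intro sum.cong) (auto simp: orthonormal_on_def)
    finally show ?thesis using that \<open>finite I\<close> by (simp add: if_distrib[of "(*) _"] cong: if_cong)
  qed
  have "L2_inner \<Omega> s s = (\<Sum>i\<in>I. c i * L2_inner \<Omega> (e i) s)"
    by (subst s_def) (rule L2_inner_sum_left[OF eL s])
  also have "\<dots> = of_real (\<Sum>i\<in>I. (norm (c i))\<^sup>2)"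
    by (simp add: es mult_cnj_eq_of_real cong: sum.cong)
  finally have ss: "(L2_norm \<Omega> s)\<^sup>2 = (\<Sum>i\<in>I. (norm (c i))\<^sup>2)"
    unfolding L2_inner_self of_real_eq_iff .
  have eq: "(norm (a - b))\<^sup>2 = (norm b)\<^sup>2 + (norm a)\<^sup>2 - 2 * Re (cnj a * b)" for a b :: complex
    by (simp only: cmod_power2) (simp add: power2_eq_square algebra_simps)
  have "(L2_norm \<Omega> (\<lambda>z. f z - s z))\<^sup>2 = (L2_norm \<Omega> f)\<^sup>2 - 2 * Re (L2_inner \<Omega> f s) + (\<Sum>i\<in>I. (norm (c i))\<^sup>2)"
    using L2_norm_diff_power2[OF f s] ss by simp
  then show ?thesis
    unfolding s_def[symmetric] fs eq Re_sum sum.distrib sum_subtractf sum_distrib_left[symmetric]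
    by (simp add: s_def)
qed

lemma Bessel_inequality:
  assumes "orthonormal_on \<Omega> I e" "finite I" "f \<in> L2 \<Omega>"
  shows "(\<Sum>i\<in>I. (norm (L2_inner \<Omega> f (e i)))\<^sup>2) \<le> (L2_norm \<Omega> f)\<^sup>2"
  using orthonormal_distance_power2[OF assms, of "\<lambda>i. L2_inner \<Omega> f (e i)"]
    zero_le_power2[of "L2_norm \<Omega> (\<lambda>z. f z - (\<Sum>i\<in>I. L2_inner \<Omega> f (e i) * e i z))"]
  by simp

text \<open>Equality in Bessel's inequality replaces the usual statement about spans, as it stays
  meaningful modulo null functions. A vector whose residual has norm zero adds no new
  \<open>u i\<close>, so \<open>N\<close> may be smaller than \<open>K\<close>.\<close>

lemma Gram_Schmidt:
  fixes x :: "nat \<Rightarrow> complex ^ 'n \<Rightarrow> complex"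
  assumes x: "\<And>k. k < K \<Longrightarrow> x k \<in> L2 \<Omega>"
  obtains N :: nat and u where "orthonormal_on \<Omega> {..<N} u"
    "\<And>k. k < K \<Longrightarrow> (L2_norm \<Omega> (x k))\<^sup>2 = (\<Sum>i<N. (norm (L2_inner \<Omega> (x k) (u i)))\<^sup>2)"
proof -
  have "\<exists>N u. orthonormal_on \<Omega> {..<N::nat} u \<and>
    (\<forall>k<K. (L2_norm \<Omega> (x k))\<^sup>2 = (\<Sum>i<N. (norm (L2_inner \<Omega> (x k) (u i)))\<^sup>2))"
    using x
  proof (induction K)
    case 0
    then show ?case by (intro exI[of _ 0]) (auto simp: orthonormal_on_def)
  next
    case (Suc K)
    then obtain N u where u: "orthonormal_on \<Omega> {..<N::nat} u"
      and eq: "\<And>k. k < K \<Longrightarrow> (L2_norm \<Omega> (x k))\<^sup>2 = (\<Sum>i<N. (norm (L2_inner \<Omega> (x k) (u i)))\<^sup>2)"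
      by auto
    have uL: "u i \<in> L2 \<Omega>" if "i < N" for i using u that by (auto simp: orthonormal_on_def)
    have xK: "x K \<in> L2 \<Omega>" using Suc by auto
    define r where "r = (\<lambda>z. x K z - (\<Sum>i<N. L2_inner \<Omega> (x K) (u i) * u i z))"
    have rL: "r \<in> L2 \<Omega>" unfolding r_def using xK uL by (intro L2_diff L2_sum) auto
    have rn: "(L2_norm \<Omega> r)\<^sup>2 = (L2_norm \<Omega> (x K))\<^sup>2 - (\<Sum>i<N. (norm (L2_inner \<Omega> (x K) (u i)))\<^sup>2)"
      unfolding r_def by (subst orthonormal_distance_power2[OF u _ xK]) auto
    show ?case
    proof (cases "L2_norm \<Omega> r = 0")
      case True
      with rn eq u show ?thesis
        by (intro exI[of _ N] exI[of _ u]) (auto simp: less_Suc_eq)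
    next
      case False
      define n where "n = L2_norm \<Omega> r"
      have n: "n > 0" using False L2_norm_nonneg[of \<Omega> r] unfolding n_def by linarith
      define v where "v = u(N := \<lambda>z. of_real (1 / n) * r z)"
      have vN: "v N = (\<lambda>z. of_real (1 / n) * r z)" and vi: "\<And>i. i < N \<Longrightarrow> v i = u i"
        by (auto simp: v_def)
      have vNL: "v N \<in> L2 \<Omega>"
        unfolding vN by (rule L2_scale[OF rL])
      have ru: "L2_inner \<Omega> r (u j) = 0" if "j < N" for j
      proof -
        have "L2_inner \<Omega> r (u j) = L2_inner \<Omega> (x K) (u j) - (\<Sum>i<N. L2_inner \<Omega> (x K) (u i) * L2_inner \<Omega> (u i) (u j))"
          unfolding r_def by (rule L2_inner_diff_sum_left) (use xK uL that in auto)
        also have "(\<Sum>i<N. L2_inner \<Omega> (x K) (u i) * L2_inner \<Omega> (u i) (u j)) =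
            (\<Sum>i<N. L2_inner \<Omega> (x K) (u i) * (if i = j then 1 else 0))"
          using u that by (intro sum.cong) (auto simp: orthonormal_on_def)
        finally show ?thesis using that by (simp add: if_distrib[of "(*) _"] cong: if_cong)
      qed
      have "L2_inner \<Omega> (v N) (v N) = 1"
        using n by (simp add: vN L2_inner_scale_left L2_inner_scale_right L2_inner_self n_def[symmetric] power2_eq_square del: of_real_divide)
          (simp flip: of_real_mult)
      moreover have "L2_inner \<Omega> (v N) (v j) = 0" "L2_inner \<Omega> (v j) (v N) = 0" if "j < N" for j
      proof -
        show 1: "L2_inner \<Omega> (v N) (v j) = 0"
          unfolding vN vi[OF that] L2_inner_scale_left ru[OF that] by simp
        show "L2_inner \<Omega> (v j) (v N) = 0"
          by (subst L2_inner_commute) (simp add: 1)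
      qed
      ultimately have v: "orthonormal_on \<Omega> {..<Suc N} v"
        using u vNL by (auto simp: orthonormal_on_def less_Suc_eq vi)
      have eq': "(L2_norm \<Omega> (x k))\<^sup>2 = (\<Sum>i<Suc N. (norm (L2_inner \<Omega> (x k) (v i)))\<^sup>2)" if "k < Suc K" for k
      proof (rule antisym)
        show "(\<Sum>i<Suc N. (norm (L2_inner \<Omega> (x k) (v i)))\<^sup>2) \<le> (L2_norm \<Omega> (x k))\<^sup>2"
          by (rule Bessel_inequality[OF v]) (use Suc that in auto)
        show "(L2_norm \<Omega> (x k))\<^sup>2 \<le> (\<Sum>i<Suc N. (norm (L2_inner \<Omega> (x k) (v i)))\<^sup>2)"
        proof (cases "k = K")
          case False
          then show ?thesis using that eq[of k] by (simp add: vi)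
        next
          case True
          \<comment> \<open>\<open>r\<close> is orthogonal to every \<open>u i\<close>, so
            \<open>x K\<close> and \<open>r\<close> have the same inner product with
            \<open>r\<close>; the component of \<open>x K\<close> along \<open>v N\<close> is
            exactly the norm of the residual.\<close>
          have "L2_inner \<Omega> r r = L2_inner \<Omega> (x K) r - (\<Sum>i<N. L2_inner \<Omega> (x K) (u i) * L2_inner \<Omega> (u i) r)"
            by (subst r_def) (rule L2_inner_diff_sum_left, use xK uL rL in auto)
          also have "(\<Sum>i<N. L2_inner \<Omega> (x K) (u i) * L2_inner \<Omega> (u i) r) = 0"
            using ru by (intro sum.neutral ballI) (simp add: L2_inner_commute[of _ _ r])
          finally have "L2_inner \<Omega> (x K) r = of_real (n\<^sup>2)"
            by (simp add: L2_inner_self n_def)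
          then have "L2_inner \<Omega> (x K) (v N) = of_real n"
            using n unfolding vN L2_inner_scale_right by (simp add: power2_eq_square)
          with n show ?thesis
            using rn by (simp add: True vi n_def)
        qed
      qed
      show ?thesis using v eq' by blast
    qed
  qed
  then show ?thesis using that by blast
qed

section \<open>Pointwise bounds in the Bergman space\<close>

text \<open>The change of variables theorems of the library are stated for \<^typ>\<open>real ^ 'm\<close> with a
  well-ordered index type; \<^typ>\<open>'n bit0\<close> is such a type with \<open>2 * CARD('n)\<close> elements.\<close>

lemma lborel_distr_orthogonal:
  fixes R :: "complex ^ 'n \<Rightarrow> complex ^ 'n"
  assumes R: "orthogonal_transformation R"
  shows "distr lborel borel R = lborel"
proof -
  have "card (UNIV :: 'n bit0 set) = card (Basis :: (complex ^ 'n) set)"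
    by simp
  then obtain b :: "'n bit0 \<Rightarrow> complex ^ 'n" where b: "bij_betw b UNIV Basis"
    using finite_same_card_bij[OF finite_class.finite_UNIV finite_Basis] by blast
  then have bB [simp]: "b k \<in> Basis" for k
    by (auto simp: bij_betw_def)
  have inj: "b i = b j \<longleftrightarrow> i = j" for i j
    using b by (auto simp: bij_betw_def inj_on_def)
  have B: "Basis = range b"
    using b by (simp add: bij_betw_def)
  define h :: "complex ^ 'n \<Rightarrow> real ^ 'n bit0" where "h = (\<lambda>x. \<chi> k. x \<bullet> b k)"
  define g :: "real ^ 'n bit0 \<Rightarrow> complex ^ 'n" where "g = (\<lambda>y. \<Sum>k\<in>UNIV. y $ k *\<^sub>R b k)"
  have gh: "g (h x) = x" for x
  proof -
    have "g (h x) = (\<Sum>c\<in>Basis. (x \<bullet> c) *\<^sub>R c)"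
      unfolding g_def h_def by (simp add: sum.reindex_bij_betw[OF b, of "\<lambda>c. (x \<bullet> c) *\<^sub>R c"])
    then show ?thesis by (simp add: euclidean_representation)
  qed
  have gb: "g y \<bullet> b k = y $ k" for y k
    unfolding g_def by (simp add: inner_sum_left inner_Basis inj if_distrib[of "(*) _"] cong: if_cong)
  have hg: "h (g y) = y" for y
    by (simp add: h_def gb vec_eq_iff)
  have lin: "linear h" "linear g"
    unfolding h_def g_def
    by (auto intro!: linearI simp: vec_eq_iff inner_simps algebra_simps sum.distrib scaleR_sum_right)
  have inn: "g x \<bullet> g y = x \<bullet> y" for x y
  proof -
    have "g x \<bullet> g y = (\<Sum>k\<in>UNIV. y $ k * (g x \<bullet> b k))"
      by (subst (2) g_def) (simp add: inner_sum_right)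
    then show ?thesis
      unfolding gb by (simp add: inner_vec_def mult.commute)
  qed
  have hinn: "h x \<bullet> h y = x \<bullet> y" for x y
    using inn[of "h x" "h y"] by (simp add: gh)
  have gm [measurable]: "g \<in> borel_measurable borel"
    using lin(2) by (intro borel_measurable_continuous_onI linear_continuous_on) (simp add: linear_linear)
  have Rm [measurable]: "R \<in> borel_measurable borel"
    using orthogonal_transformation_linear[OF R]
    by (intro borel_measurable_continuous_onI linear_continuous_on) (simp add: linear_linear)
  have gbox: "g -` box l u = box (h l) (h u)" for l u
  proof -
    have "g y \<in> box l u \<longleftrightarrow> y \<in> box (h l) (h u)" for y
    proof -
      have "g y \<in> box l u \<longleftrightarrow> (\<forall>k. l \<bullet> b k < g y \<bullet> b k \<and> g y \<bullet> b k < u \<bullet> b k)"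
        unfolding mem_box B by simp
      then show ?thesis
        by (simp add: gb mem_box_cart h_def)
    qed
    then show ?thesis by blast
  qed
  \<comment> \<open>Lebesgue measure is determined by the volume of boxes, and \<open>g\<close>
    pulls a box back to a box with the same side lengths.\<close>
  have dg: "lborel = distr lborel borel g"
  proof (rule lborel_eqI)
    fix l u :: "complex ^ 'n" assume le: "\<And>c. c \<in> Basis \<Longrightarrow> l \<bullet> c \<le> u \<bullet> c"
    have le': "h l \<bullet> c \<le> h u \<bullet> c" if c: "c \<in> Basis" for c
    proof -
      obtain k where "c = axis k 1"
        using c unfolding Basis_vec_def by auto
      then show ?thesis
        using le[OF bB[of k]] by (simp add: inner_axis h_def)
    qed
    have "emeasure (distr lborel borel g) (box l u) = emeasure lborel (box (h l) (h u))"
      by (subst emeasure_distr) (auto simp: gbox)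
    also have "\<dots> = (\<Prod>c\<in>Basis. (h u - h l) \<bullet> c)"
      using le' by (rule emeasure_lborel_box)
    also have "(\<Prod>c\<in>Basis. (h u - h l) \<bullet> c) = (\<Prod>k\<in>UNIV. (u - l) \<bullet> b k)"
    proof -
      have "bij_betw (\<lambda>k. axis k 1) UNIV (Basis :: (real ^ 'n bit0) set)"
        by (auto simp: bij_betw_def inj_on_def axis_eq_axis Basis_vec_def)
      from prod.reindex_bij_betw[OF this, of "\<lambda>c. (h u - h l) \<bullet> c"] show ?thesis
        by (simp add: inner_axis h_def inner_diff_left)
    qed
    also have "\<dots> = (\<Prod>c\<in>Basis. (u - l) \<bullet> c)"
      by (rule prod.reindex_bij_betw[OF b])
    finally show "emeasure (distr lborel borel g) (box l u) = (\<Prod>c\<in>Basis. (u - l) \<bullet> c)" .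
  qed simp
  define S where "S = (\<lambda>y. h (inv R (g y)))"
  have bijR: "bij R" using orthogonal_transformation_bij[OF R] .
  have S: "orthogonal_transformation S"
    unfolding orthogonal_transformation_def
  proof
    show "linear S"
      unfolding S_def
      using linear_compose[OF linear_compose[OF lin(2) orthogonal_transformation_linear[OF orthogonal_transformation_inv[OF R]]] lin(1)]
      by (simp add: o_def)
    show "\<forall>v w. S v \<bullet> S w = v \<bullet> w"
      using orthogonal_transformation_inv[OF R] by (simp add: S_def hinn orthogonal_transformation_def inn)
  qed
  have "lborel = distr lborel borel R"
  proof (rule lborel_eqI)
    fix l u :: "complex ^ 'n" assume le: "\<And>c. c \<in> Basis \<Longrightarrow> l \<bullet> c \<le> u \<bullet> c"
    \<comment> \<open>In coordinates the preimage under \<open>R\<close> is the image under the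
      orthogonal map \<open>S\<close>, conjugate to the inverse of \<open>R\<close>; so invariance
      of volume under orthogonal images applies.\<close>
    have eq: "g -` (R -` box l u) = S ` (g -` box l u)"
    proof (intro set_eqI iffI)
      fix y assume "y \<in> g -` (R -` box l u)"
      then have "R (g y) \<in> box l u" by simp
      moreover have "y = S (h (R (g y)))"
        using bijR by (simp add: S_def gh hg bij_def)
      ultimately show "y \<in> S ` (g -` box l u)"
        by (metis gh image_eqI vimage_eq)
    next
      fix y assume "y \<in> S ` (g -` box l u)"
      then obtain x where "y = S x" "g x \<in> box l u" by auto
      then show "y \<in> g -` (R -` box l u)"
        using bijR by (simp add: S_def gh bij_def surj_f_inv_f)
    qed
    have lm: "g -` box l u \<in> lmeasurable" by (simp add: gbox)
    have "R -` box l u \<in> sets borel"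
      using measurable_sets[OF Rm, of "box l u"] by simp
    moreover then have "g -` (R -` box l u) \<in> sets borel"
      using measurable_sets[OF gm, of "R -` box l u"] by simp
    ultimately have "emeasure (distr lborel borel R) (box l u) = emeasure lborel (S ` (g -` box l u))"
      by (subst emeasure_distr) (simp, simp, subst dg, subst emeasure_distr, auto simp: eq)
    also have "\<dots> = emeasure lebesgue (S ` (g -` box l u))"
      using \<open>g -` (R -` box l u) \<in> sets borel\<close> by (simp add: eq)
    also have "\<dots> = emeasure lebesgue (g -` box l u)"
      using measure_orthogonal_image[OF S lm] measurable_orthogonal_image[OF S lm] lm
      by (simp add: emeasure_eq_measure2 fmeasurableD2)
    also have "\<dots> = emeasure lborel (g -` box l u)"
      by (simp add: gbox)
    also have "\<dots> = emeasure (distr lborel borel g) (box l u)"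
      by (subst emeasure_distr) auto
    also have "\<dots> = (\<Prod>c\<in>Basis. (u - l) \<bullet> c)"
      using le by (simp add: dg[symmetric])
    finally show "emeasure (distr lborel borel R) (box l u) = (\<Prod>c\<in>Basis. (u - l) \<bullet> c)" .
  qed simp
  then show ?thesis ..
qed

section \<open>Complex lines and the sub-mean value property\<close>

lemma norm_vector_scalar_mult: "norm (c *s v) = norm c * norm (v :: complex ^ 'n)"
  unfolding norm_vec_def vector_smult_component norm_mult L2_set_right_distrib[OF norm_ge_zero] ..

lemma orthogonal_transformation_rotation:
  assumes "cmod c = 1"
  shows "orthogonal_transformation (\<lambda>z :: complex ^ 'n. c *s z)"
  unfolding orthogonal_transformation
  by (auto intro!: linearI simp: norm_vector_scalar_mult assms vec_eq_iff algebra_simps)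

text \<open>Along a complex line the derivative is multiplication by one number, which opens the way
  to Cauchy theory in one variable.\<close>

lemma holomorphic_Cn_slice_derivative:
  fixes f :: "complex ^ 'n \<Rightarrow> complex"
  assumes "(f has_derivative (\<lambda>v. \<Sum>i\<in>UNIV. a $ i * v $ i)) (at (z + s *s v))"
  shows "((\<lambda>s. f (z + s *s v)) has_field_derivative (\<Sum>i\<in>UNIV. a $ i * v $ i)) (at s)"
proof -
  have "((\<lambda>s. z + s *s v) has_derivative (\<lambda>h. h *s v)) (at s)"
  proof -
    have "bounded_linear (\<lambda>h. h *s v)"
      by (rule bounded_linear_intro[where K="norm v"])
        (auto simp: vec_eq_iff algebra_simps norm_vector_scalar_mult)
    from bounded_linear_imp_has_derivative[OF this] show ?thesis
      by (auto intro!: derivative_eq_intros)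
  qed
  from has_derivative_compose[OF this assms]
  have "((\<lambda>s. f (z + s *s v)) has_derivative (\<lambda>h. \<Sum>i\<in>UNIV. a $ i * (h *s v) $ i)) (at s)" .
  also have "(\<lambda>h. \<Sum>i\<in>UNIV. a $ i * (h *s v) $ i) = (*) (\<Sum>i\<in>UNIV. a $ i * v $ i)"
    by (auto simp: fun_eq_iff sum_distrib_left mult_ac)
  finally show ?thesis
    by (simp only: has_field_derivative_def)
qed

lemma holomorphic_Cn_slice:
  assumes "holomorphic_Cn_on f \<Omega>" "\<And>s. s \<in> A \<Longrightarrow> z + s *s v \<in> \<Omega>"
  shows "(\<lambda>s. f (z + s *s v)) holomorphic_on A"
  unfolding holomorphic_on_def
proof
  fix s assume "s \<in> A"
  then obtain a where "(f has_derivative (\<lambda>v. \<Sum>i\<in>UNIV. a $ i * v $ i)) (at (z + s *s v))"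
    using assms unfolding holomorphic_Cn_on_def by blast
  from holomorphic_Cn_slice_derivative[OF this] show "(\<lambda>s. f (z + s *s v)) field_differentiable at s within A"
    using field_differentiable_at_within field_differentiable_def by blast
qed

lemma holomorphic_Cn_continuous_on: "holomorphic_Cn_on f \<Omega> \<Longrightarrow> continuous_on \<Omega> f"
  unfolding holomorphic_Cn_on_def
  by (meson continuous_at_imp_continuous_on has_derivative_continuous)

text \<open>Cauchy's formula is applied to the square of \<open>F\<close>, whose modulus is the
  wanted integrand. The form with a nonnegative integral allows a later exchange of integrals
  without proving integrability.\<close>

lemma circle_submean_power2:
  assumes F: "F holomorphic_on cball 0 1"
  shows "ennreal (2 * pi * (cmod (F 0))\<^sup>2) \<le>
    (\<integral>\<^sup>+t. ennreal ((cmod (F (cis t)))\<^sup>2) * indicator {0..2 * pi} t \<partial>lborel)"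
proof -
  have "((\<lambda>u. (F u)\<^sup>2 / (u - 0)) has_contour_integral (2 * of_real pi * \<i> * (F 0)\<^sup>2)) (circlepath 0 1)"
    using F by (intro Cauchy_integral_circlepath_simple holomorphic_intros) auto
  then have "((\<lambda>t. (F (cis t))\<^sup>2 / cis t * \<i> * cis t) has_integral (2 * of_real pi * \<i> * (F 0)\<^sup>2)) {0..2 * pi}"
    unfolding circlepath_def by (subst (asm) has_contour_integral_part_circlepath_iff) auto
  then have *: "((\<lambda>t. - \<i> * ((F (cis t))\<^sup>2 / cis t * \<i> * cis t)) has_integral - \<i> * (2 * of_real pi * \<i> * (F 0)\<^sup>2)) {0..2 * pi}"
    by (rule has_integral_mult_right)
  have eq: "- \<i> * (x / c * \<i> * c) = x" if "c \<noteq> 0" for x c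
    using that by (simp add: field_simps)
  from * have I: "((\<lambda>t. (F (cis t))\<^sup>2) has_integral (2 * of_real pi * (F 0)\<^sup>2)) {0..2 * pi}"
    unfolding eq[OF cis_neq_zero] by (simp add: algebra_simps)
  have "continuous_on {0..2 * pi} (\<lambda>t. (cmod (F (cis t)))\<^sup>2)"
    by (intro continuous_intros continuous_on_compose2[OF holomorphic_on_imp_continuous_on[OF F]]) auto
  then have J: "((\<lambda>t. (cmod (F (cis t)))\<^sup>2) has_integral integral {0..2 * pi} (\<lambda>t. (cmod (F (cis t)))\<^sup>2)) {0..2 * pi}"
    by (intro integrable_integral integrable_continuous_real)
  have "norm (2 * of_real pi * (F 0)\<^sup>2) \<le> integral {0..2 * pi} (\<lambda>t. (cmod (F (cis t)))\<^sup>2)"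
    unfolding integral_unique[OF I, symmetric]
    using I J by (intro integral_norm_bound_integral) (auto simp: norm_power integrable_on_def)
  then have "2 * pi * (cmod (F 0))\<^sup>2 \<le> integral {0..2 * pi} (\<lambda>t. (cmod (F (cis t)))\<^sup>2)"
    by (simp add: norm_mult norm_power)
  moreover have "(\<integral>\<^sup>+t. ennreal ((cmod (F (cis t)))\<^sup>2) * indicator {0..2 * pi} t \<partial>lborel) =
      ennreal (integral {0..2 * pi} (\<lambda>t. (cmod (F (cis t)))\<^sup>2))"
    by (rule nn_integral_has_integral_lebesgue'[OF _ J]) simp
  ultimately show ?thesis
    by (simp add: ennreal_leI)
qed

text \<open>Apply the circle inequality on each disc \<open>z + s *s \<zeta>\<close>, integrate over
  \<open>\<zeta>\<close> and exchange the integrals. For fixed \<open>t\<close> multiplication by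
  \<open>cis t\<close> is a real orthogonal map, so every inner integral equals the same
  \<open>I\<close>, and the factor \<open>2 * pi\<close> cancels.\<close>

lemma ball_submean_power2:
  fixes f :: "complex ^ 'n \<Rightarrow> complex"
  assumes f: "holomorphic_Cn_on f \<Omega>" and sub: "ball z r \<subseteq> \<Omega>"
  shows "ennreal ((cmod (f z))\<^sup>2) * emeasure lborel (ball (0 :: complex ^ 'n) r) \<le>
    (\<integral>\<^sup>+w. ennreal ((cmod (f w))\<^sup>2) * indicator (ball z r) w \<partial>lborel)"
proof -
  \<comment> \<open>Extension by zero gives a measurable function on the whole space, and the
    cut-off survives rotation because the ball about 0 is invariant under
    \<open>cis t\<close>.\<close>
  define \<Phi> where "\<Phi> = (\<lambda>w. ennreal (indicator (ball 0 r) w *\<^sub>R (cmod (f (z + w)))\<^sup>2))"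
  have "continuous_on (ball 0 r) (\<lambda>w. (cmod (f (z + w)))\<^sup>2)"
    using sub by (intro continuous_intros continuous_on_compose2[OF holomorphic_Cn_continuous_on[OF f]])
      (auto simp: dist_norm)
  then have [measurable]: "\<Phi> \<in> borel_measurable borel"
    unfolding \<Phi>_def by (intro measurable_compose[OF _ measurable_ennreal] borel_measurable_continuous_on_indicator) auto
  have cont: "continuous_on UNIV (\<lambda>p :: (complex ^ 'n) \<times> real. cis (snd p) *s fst p)"
    unfolding vector_scalar_mult_def
    by (intro continuous_on_vec_lambda continuous_intros)
  have H [measurable]: "(\<lambda>p :: (complex ^ 'n) \<times> real. cis (snd p) *s fst p) \<in> borel_measurable (lborel \<Otimes>\<^sub>M lborel)"
    using borel_measurable_continuous_onI[OF cont] by (simp add: borel_prod measurable_cong_sets[OF sets_pair_measure_cong[OF sets_lborel sets_lborel] refl])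
  define I where "I = (\<integral>\<^sup>+w. \<Phi> w \<partial>lborel)"
  have rot: "(\<integral>\<^sup>+\<zeta>. \<Phi> (cis t *s \<zeta>) \<partial>lborel) = I" for t
  proof -
    have o: "orthogonal_transformation (\<lambda>z :: complex ^ 'n. cis t *s z)"
      by (rule orthogonal_transformation_rotation) simp
    then have m: "(\<lambda>z :: complex ^ 'n. cis t *s z) \<in> borel_measurable borel"
      by (intro borel_measurable_continuous_onI linear_continuous_on)
        (simp add: linear_linear orthogonal_transformation_linear)
    have "I = (\<integral>\<^sup>+w. \<Phi> w \<partial>distr lborel borel (\<lambda>z. cis t *s z))"
      by (simp add: I_def lborel_distr_orthogonal[OF o])
    also have "\<dots> = (\<integral>\<^sup>+\<zeta>. \<Phi> (cis t *s \<zeta>) \<partial>lborel)"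
      using m by (intro nn_integral_distr) auto
    finally show ?thesis ..
  qed
  have "ennreal (2 * pi * (cmod (f z))\<^sup>2) * emeasure lborel (ball (0 :: complex ^ 'n) r) =
      (\<integral>\<^sup>+\<zeta>. ennreal (2 * pi * (cmod (f z))\<^sup>2) * indicator (ball (0 :: complex ^ 'n) r) \<zeta> \<partial>lborel)"
    by (subst nn_integral_cmult_indicator) auto
  also have "\<dots> \<le> (\<integral>\<^sup>+\<zeta>. (\<integral>\<^sup>+t. \<Phi> (cis t *s \<zeta>) * indicator {0..2 * pi} t \<partial>lborel) \<partial>lborel)"
  proof (rule nn_integral_mono)
    fix \<zeta> :: "complex ^ 'n"
    show "ennreal (2 * pi * (cmod (f z))\<^sup>2) * indicator (ball (0 :: complex ^ 'n) r) \<zeta> \<le>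
      (\<integral>\<^sup>+t. \<Phi> (cis t *s \<zeta>) * indicator {0..2 * pi} t \<partial>lborel)"
    proof (cases "\<zeta> \<in> ball 0 r")
      case True
      have inb: "norm (s *s \<zeta>) < r" if "cmod s \<le> 1" for s
      proof -
        have "cmod s * norm \<zeta> \<le> 1 * norm \<zeta>" using that by (intro mult_right_mono) auto
        then show ?thesis using True by (simp add: norm_vector_scalar_mult)
      qed
      have "(\<lambda>s. f (z + s *s \<zeta>)) holomorphic_on cball 0 1"
        using sub inb by (intro holomorphic_Cn_slice[OF f]) (auto simp: dist_norm)
      from circle_submean_power2[OF this] show ?thesis
        using True inb[of "cis _"] by (simp add: \<Phi>_def)
    qed simp
  qed
  also have "\<dots> = (\<integral>\<^sup>+t. (\<integral>\<^sup>+\<zeta>. \<Phi> (cis t *s \<zeta>) * indicator {0..2 * pi} t \<partial>lborel) \<partial>lborel)"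
    by (rule lborel_pair.Fubini'[symmetric]) (use H in \<open>simp add: case_prod_beta'\<close>)
  also have "\<dots> = (\<integral>\<^sup>+t. I * indicator {0..2 * pi} t \<partial>lborel)"
  proof (rule nn_integral_cong)
    fix t :: real
    have m: "(\<lambda>\<zeta>. \<Phi> (cis t *s \<zeta>)) \<in> borel_measurable lborel"
    proof -
      have "(\<lambda>z :: complex ^ 'n. cis t *s z) \<in> borel_measurable borel"
        by (intro borel_measurable_continuous_onI linear_continuous_on)
          (simp add: linear_linear orthogonal_transformation_linear orthogonal_transformation_rotation)
      then show ?thesis by simp
    qed
    show "(\<integral>\<^sup>+\<zeta>. \<Phi> (cis t *s \<zeta>) * indicator {0..2 * pi} t \<partial>lborel) = I * indicator {0..2 * pi} t"
      using m by (subst nn_integral_multc) (auto simp: rot)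
  qed
  also have "\<dots> = ennreal (2 * pi) * I"
    by (subst nn_integral_cmult_indicator) (auto simp: mult.commute)
  finally have "ennreal (2 * pi) * (ennreal ((cmod (f z))\<^sup>2) * emeasure lborel (ball (0 :: complex ^ 'n) r)) \<le> ennreal (2 * pi) * I"
    by (simp add: ennreal_mult mult.assoc)
  then have "ennreal ((cmod (f z))\<^sup>2) * emeasure lborel (ball (0 :: complex ^ 'n) r) \<le> I"
    by (subst (asm) ennreal_mult_le_mult_iff) auto
  also have "I = (\<integral>\<^sup>+w. ennreal ((cmod (f w))\<^sup>2) * indicator (ball z r) w \<partial>lborel)"
  proof -
    have "continuous_on (ball z r) (\<lambda>w. (cmod (f w))\<^sup>2)"
      using sub by (intro continuous_intros continuous_on_subset[OF holomorphic_Cn_continuous_on[OF f]]) auto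
    then have "(\<lambda>w. ennreal (indicator (ball z r) w *\<^sub>R (cmod (f w))\<^sup>2)) \<in> borel_measurable borel"
      by (intro measurable_compose[OF _ measurable_ennreal] borel_measurable_continuous_on_indicator) auto
    then have "(\<integral>\<^sup>+w. ennreal (indicator (ball z r) w *\<^sub>R (cmod (f w))\<^sup>2) \<partial>distr lborel borel ((+) z)) =
      (\<integral>\<^sup>+w. ennreal (indicator (ball z r) (z + w) *\<^sub>R (cmod (f (z + w)))\<^sup>2) \<partial>lborel)"
      by (intro nn_integral_distr) auto
    also have "\<dots> = I"
      unfolding I_def \<Phi>_def by (intro nn_integral_cong) (auto simp: indicator_def dist_norm)
    finally have "I = (\<integral>\<^sup>+w. ennreal (indicator (ball z r) w *\<^sub>R (cmod (f w))\<^sup>2) \<partial>lborel)"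
      unfolding lborel_distr_plus ..
    also have "\<dots> = (\<integral>\<^sup>+w. ennreal ((cmod (f w))\<^sup>2) * indicator (ball z r) w \<partial>lborel)"
      by (intro nn_integral_cong) (simp add: indicator_def)
    finally show ?thesis .
  qed
  finally show ?thesis .
qed

lemma L2_nn_integral:
  "f \<in> L2 \<Omega> \<Longrightarrow> (\<integral>\<^sup>+z. ennreal ((cmod (f z))\<^sup>2) \<partial>lebesgue_on \<Omega>) = ennreal ((L2_norm \<Omega> f)\<^sup>2)"
  unfolding L2_norm_power2 by (intro nn_integral_eq_integral L2_integrable) auto

lemma A2_L2: "f \<in> A2 \<Omega> \<Longrightarrow> f \<in> L2 \<Omega>" and A2_holomorphic: "f \<in> A2 \<Omega> \<Longrightarrow> holomorphic_Cn_on f \<Omega>"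
  by (auto simp: A2_def)

text \<open>The sub-mean value inequality on \<open>ball z r\<close>; the constant is the inverse
  square root of the volume of that ball. It is obtained before the domain, the function and the
  point, and the Cauchy estimates below rely on this uniformity.\<close>

lemma A2_pointwise_bound:
  assumes "r > 0"
  obtains C where "C > 0" and
    "\<And>\<Omega> f z. open \<Omega> \<Longrightarrow> f \<in> A2 (\<Omega> :: (complex ^ 'n) set) \<Longrightarrow> ball z r \<subseteq> \<Omega> \<Longrightarrow> cmod (f z) \<le> C * L2_norm \<Omega> f"
proof -
  define v where "v = measure lborel (ball (0 :: complex ^ 'n) r)"
  have v: "v > 0" unfolding v_def using assms by (simp add: content_ball_pos)
  have ev: "emeasure lborel (ball (0 :: complex ^ 'n) r) = ennreal v"
    unfolding v_def using emeasure_lborel_ball_finite[of "0 :: complex ^ 'n" r] by (intro emeasure_eq_ennreal_measure) auto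
  show ?thesis
  proof
    show "1 / sqrt v > 0" using v by simp
    fix \<Omega> :: "(complex ^ 'n) set" and f z
    assume o: "open \<Omega>" and f: "f \<in> A2 \<Omega>" and sub: "ball z r \<subseteq> \<Omega>"
    have "ennreal ((cmod (f z))\<^sup>2 * v) = ennreal ((cmod (f z))\<^sup>2) * emeasure lborel (ball (0 :: complex ^ 'n) r)"
      using v by (simp add: ev ennreal_mult)
    also have "\<dots> \<le> (\<integral>\<^sup>+w. ennreal ((cmod (f w))\<^sup>2) * indicator (ball z r) w \<partial>lborel)"
      by (rule ball_submean_power2[OF A2_holomorphic[OF f] sub])
    also have "\<dots> = (\<integral>\<^sup>+w. ennreal ((cmod (f w))\<^sup>2) * indicator (ball z r) w \<partial>lebesgue)"
    proof -
      have "continuous_on (ball z r) (\<lambda>w. (cmod (f w))\<^sup>2)"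
        using sub by (intro continuous_intros continuous_on_subset[OF holomorphic_Cn_continuous_on[OF A2_holomorphic[OF f]]]) auto
      then have "(\<lambda>w. ennreal (indicator (ball z r) w *\<^sub>R (cmod (f w))\<^sup>2)) \<in> borel_measurable borel"
        by (intro measurable_compose[OF _ measurable_ennreal] borel_measurable_continuous_on_indicator) auto
      moreover have "(\<lambda>w. ennreal (indicator (ball z r) w *\<^sub>R (cmod (f w))\<^sup>2)) = (\<lambda>w. ennreal ((cmod (f w))\<^sup>2) * indicator (ball z r) w)"
        by (auto simp: indicator_def)
      ultimately show ?thesis
        by (subst nn_integral_completion) auto
    qed
    also have "\<dots> \<le> (\<integral>\<^sup>+w. ennreal ((cmod (f w))\<^sup>2) * indicator \<Omega> w \<partial>lebesgue)"
      using sub by (intro nn_integral_mono) (auto simp: indicator_def)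
    also have "\<dots> = (\<integral>\<^sup>+w. ennreal ((cmod (f w))\<^sup>2) \<partial>lebesgue_on \<Omega>)"
      using o by (subst nn_integral_restrict_space) auto
    also have "\<dots> = ennreal ((L2_norm \<Omega> f)\<^sup>2)"
      by (rule L2_nn_integral[OF A2_L2[OF f]])
    finally have "(cmod (f z))\<^sup>2 * v \<le> (L2_norm \<Omega> f)\<^sup>2"
      by (simp add: ennreal_le_iff)
    then have "(cmod (f z) * sqrt v)\<^sup>2 \<le> (L2_norm \<Omega> f)\<^sup>2"
      using v by (simp add: power_mult_distrib)
    then have "cmod (f z) * sqrt v \<le> L2_norm \<Omega> f"
      by (rule power2_le_imp_le) simp
    then show "cmod (f z) \<le> 1 / sqrt v * L2_norm \<Omega> f"
      using v by (simp add: field_simps)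
  qed
qed

section \<open>Closure properties of holomorphic functions and of the Bergman space\<close>

lemma holomorphic_Cn_const: "holomorphic_Cn_on (\<lambda>_. c) \<Omega>"
  unfolding holomorphic_Cn_on_def by (auto intro!: exI[of _ 0])

lemma holomorphic_Cn_component: "holomorphic_Cn_on (\<lambda>z :: complex ^ 'n. z $ j) \<Omega>"
  unfolding holomorphic_Cn_on_def
proof
  fix z :: "complex ^ 'n"
  have e: "(\<Sum>i\<in>UNIV. axis j 1 $ i * v $ i) = v $ j" for v :: "complex ^ 'n"
    by (simp add: axis_def if_distrib[of "\<lambda>x. x * _"] cong: if_cong)
  have "((\<lambda>z :: complex ^ 'n. z $ j) has_derivative (\<lambda>v. v $ j)) (at z)"
    by (rule bounded_linear_imp_has_derivative[OF bounded_linear_vec_nth])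
  then show "\<exists>a. ((\<lambda>z :: complex ^ 'n. z $ j) has_derivative (\<lambda>v. \<Sum>i\<in>UNIV. a $ i * v $ i)) (at z)"
    by (intro exI[of _ "axis j 1"]) (simp only: e)
qed

lemma holomorphic_Cn_diff:
  assumes "holomorphic_Cn_on f \<Omega>" "holomorphic_Cn_on g \<Omega>"
  shows "holomorphic_Cn_on (\<lambda>z. f z - g z) \<Omega>"
  unfolding holomorphic_Cn_on_def
proof
  fix z assume "z \<in> \<Omega>"
  then obtain a b where "(f has_derivative (\<lambda>v. \<Sum>i\<in>UNIV. a $ i * v $ i)) (at z)"
    "(g has_derivative (\<lambda>v. \<Sum>i\<in>UNIV. b $ i * v $ i)) (at z)"
    using assms unfolding holomorphic_Cn_on_def by blast
  from has_derivative_diff[OF this]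
  show "\<exists>a. ((\<lambda>z. f z - g z) has_derivative (\<lambda>v. \<Sum>i\<in>UNIV. a $ i * v $ i)) (at z)"
    by (intro exI[of _ "a - b"]) (simp add: sum_subtractf algebra_simps)
qed

lemma holomorphic_Cn_mult:
  assumes "holomorphic_Cn_on f \<Omega>" "holomorphic_Cn_on g \<Omega>"
  shows "holomorphic_Cn_on (\<lambda>z. f z * g z) \<Omega>"
  unfolding holomorphic_Cn_on_def
proof
  fix z assume "z \<in> \<Omega>"
  then obtain a b where "(f has_derivative (\<lambda>v. \<Sum>i\<in>UNIV. a $ i * v $ i)) (at z)"
    "(g has_derivative (\<lambda>v. \<Sum>i\<in>UNIV. b $ i * v $ i)) (at z)"
    using assms unfolding holomorphic_Cn_on_def by blast
  from has_derivative_mult[OF this]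
  show "\<exists>a. ((\<lambda>z. f z * g z) has_derivative (\<lambda>v. \<Sum>i\<in>UNIV. a $ i * v $ i)) (at z)"
    by (intro exI[of _ "f z *s b + g z *s a"])
      (simp add: sum.distrib sum_distrib_left sum_distrib_right algebra_simps)
qed

lemma
  shows holomorphic_Cn_power: "holomorphic_Cn_on f \<Omega> \<Longrightarrow> holomorphic_Cn_on (\<lambda>z. f z ^ k) \<Omega>"
    and holomorphic_Cn_prod: "(\<And>i. i \<in> I \<Longrightarrow> holomorphic_Cn_on (h i) \<Omega>) \<Longrightarrow> holomorphic_Cn_on (\<lambda>z. \<Prod>i\<in>I. h i z) \<Omega>"
proof -
  show "holomorphic_Cn_on f \<Omega> \<Longrightarrow> holomorphic_Cn_on (\<lambda>z. f z ^ k) \<Omega>"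
    by (induction k) (auto intro: holomorphic_Cn_const holomorphic_Cn_mult)
  show "(\<And>i. i \<in> I \<Longrightarrow> holomorphic_Cn_on (h i) \<Omega>) \<Longrightarrow> holomorphic_Cn_on (\<lambda>z. \<Prod>i\<in>I. h i z) \<Omega>"
    by (induction I rule: infinite_finite_induct) (auto intro: holomorphic_Cn_const holomorphic_Cn_mult)
qed

lemma A2_diff: "f \<in> A2 \<Omega> \<Longrightarrow> g \<in> A2 \<Omega> \<Longrightarrow> (\<lambda>z. f z - g z) \<in> A2 \<Omega>"
  by (simp add: A2_def L2_diff holomorphic_Cn_diff)

lemma A2_scale: "f \<in> A2 \<Omega> \<Longrightarrow> (\<lambda>z. c * f z) \<in> A2 \<Omega>"
  by (simp add: A2_def L2_scale holomorphic_Cn_mult holomorphic_Cn_const)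

lemma A2_zero: "(\<lambda>z. 0) \<in> A2 \<Omega>"
  by (simp add: A2_def L2_zero holomorphic_Cn_const)

lemma A2_add: "f \<in> A2 \<Omega> \<Longrightarrow> g \<in> A2 \<Omega> \<Longrightarrow> (\<lambda>z. f z + g z) \<in> A2 \<Omega>"
  using A2_diff[of f \<Omega> "\<lambda>z. (- 1) * g z"] A2_scale[of g \<Omega> "- 1"] by simp

lemma A2_sum: "(\<And>i. i \<in> I \<Longrightarrow> e i \<in> A2 \<Omega>) \<Longrightarrow> (\<lambda>z. \<Sum>i\<in>I. c i * e i z) \<in> A2 \<Omega>"
  by (induction I rule: infinite_finite_induct) (auto intro!: A2_zero A2_add A2_scale)

lemma A2_bounded_holomorphic:
  assumes "open \<Omega>" "bounded \<Omega>" "holomorphic_Cn_on f \<Omega>" "\<And>z. z \<in> \<Omega> \<Longrightarrow> cmod (f z) \<le> B"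
  shows "f \<in> A2 \<Omega>"
proof -
  have m: "f \<in> borel_measurable (lebesgue_on \<Omega>)"
    using assms by (intro continuous_imp_measurable_on_sets_lebesgue holomorphic_Cn_continuous_on) auto
  have "\<Omega> \<in> lmeasurable"
    using assms by (intro bounded_set_imp_lmeasurable) auto
  then have "finite_measure (lebesgue_on \<Omega>)"
    by (simp add: finite_measure_lebesgue_on)
  then have "integrable (lebesgue_on \<Omega>) (\<lambda>z. (cmod (f z))\<^sup>2)"
    using m assms(4)
    by (intro finite_measure.integrable_const_bound[where B="B\<^sup>2"])
      (auto intro!: AE_I2 power_mono simp: space_restrict_space)
  then show ?thesis
    using m assms by (simp add: A2_def L2_def)
qed

text \<open>Cauchy's estimate on the circle of radius \<open>r / 2\<close> about \<open>x\<close> in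
  direction \<open>i\<close>: a ball of radius \<open>r\<close> around any of its points still lies
  in \<open>ball x (2 * r)\<close>, so the pointwise bound controls \<open>f\<close> there.\<close>

lemma gradient_bound:
  assumes "r > 0"
  obtains C where "C > 0" and
    "\<And>\<Omega> f x a i. open \<Omega> \<Longrightarrow> f \<in> A2 (\<Omega> :: (complex ^ 'n) set) \<Longrightarrow> ball x (2 * r) \<subseteq> \<Omega> \<Longrightarrow>
      (f has_derivative (\<lambda>v. \<Sum>i\<in>UNIV. a $ i * v $ i)) (at x) \<Longrightarrow> cmod (a $ i) \<le> C * L2_norm \<Omega> f"
proof -
  obtain C where C: "C > 0" and
    bd: "\<And>\<Omega> f z. open \<Omega> \<Longrightarrow> f \<in> A2 (\<Omega> :: (complex ^ 'n) set) \<Longrightarrow> ball z r \<subseteq> \<Omega> \<Longrightarrow> cmod (f z) \<le> C * L2_norm \<Omega> f"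
    using A2_pointwise_bound[OF assms] by blast
  show ?thesis
  proof
    show "2 * C / r > 0" using C assms by simp
    fix \<Omega> :: "(complex ^ 'n) set" and f x a i
    assume o: "open \<Omega>" and f: "f \<in> A2 \<Omega>" and sub: "ball x (2 * r) \<subseteq> \<Omega>"
      and der: "(f has_derivative (\<lambda>v. \<Sum>i\<in>UNIV. a $ i * v $ i)) (at x)"
    define F where "F = (\<lambda>s. f (x + s *s axis i 1))"
    have dist: "dist x (x + s *s axis i 1) = cmod s" for s
      by (simp add: dist_norm norm_vector_scalar_mult)
    have hol: "F holomorphic_on cball 0 (r / 2)"
      unfolding F_def using sub assms
      by (intro holomorphic_Cn_slice[OF A2_holomorphic[OF f]]) (auto simp: dist subset_iff)
    have "(F has_field_derivative (\<Sum>k\<in>UNIV. a $ k * axis i 1 $ k)) (at 0)"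
      unfolding F_def by (rule holomorphic_Cn_slice_derivative) (use der in simp)
    then have "deriv F 0 = a $ i"
      by (simp add: DERIV_imp_deriv axis_def if_distrib[of "(*) _"] cong: if_cong)
    moreover have "cmod ((deriv ^^ 1) F 0) \<le> fact 1 * (C * L2_norm \<Omega> f) / (r / 2) ^ 1"
    proof (rule Cauchy_inequality)
      show "F holomorphic_on ball 0 (r / 2)" "continuous_on (cball 0 (r / 2)) F"
        using hol by (auto intro: holomorphic_on_subset holomorphic_on_imp_continuous_on)
      fix s assume s: "cmod (0 - s) = r / 2"
      have "ball (x + s *s axis i 1) r \<subseteq> ball x (2 * r)"
      proof
        fix y assume "y \<in> ball (x + s *s axis i 1) r"
        then show "y \<in> ball x (2 * r)"
          using dist[of s] s dist_triangle[of x y "x + s *s axis i 1"] assms by simp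
      qed
      then show "cmod (F s) \<le> C * L2_norm \<Omega> f"
        unfolding F_def using bd[OF o f] sub by blast
    qed (use assms in auto)
    ultimately show "cmod (a $ i) \<le> 2 * C / r * L2_norm \<Omega> f"
      by (simp add: mult.commute mult.left_commute)
  qed
qed

section \<open>Completeness and orthogonal projection\<close>

text \<open>The pointwise and gradient bounds turn the Cauchy property in norm into locally uniform
  convergence of the complex gradients, so the pointwise limit is holomorphic. Fatou's lemma then
  gives convergence in norm to that same limit.\<close>

lemma A2_complete:
  fixes f :: "nat \<Rightarrow> complex ^ 'n \<Rightarrow> complex"
  assumes o: "open \<Omega>" and f: "\<And>n. f n \<in> A2 \<Omega>"
    and cauchy: "\<And>e. e > 0 \<Longrightarrow> \<exists>N. \<forall>m\<ge>N. \<forall>n\<ge>N. L2_norm \<Omega> (\<lambda>z. f m z - f n z) < e"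
  obtains g where "g \<in> A2 \<Omega>" "(\<lambda>n. L2_norm \<Omega> (\<lambda>z. f n z - g z)) \<longlonglongrightarrow> 0"
proof -
  define a where "a = (\<lambda>n z. SOME a. (f n has_derivative (\<lambda>v. \<Sum>i\<in>UNIV. a $ i * v $ i)) (at z))"
  have a: "(f n has_derivative (\<lambda>v. \<Sum>i\<in>UNIV. a n z $ i * v $ i)) (at z)" if "z \<in> \<Omega>" for n z
    unfolding a_def using A2_holomorphic[OF f[of n]] that
    by (intro someI_ex[of "\<lambda>a. (f n has_derivative (\<lambda>v. \<Sum>i\<in>UNIV. a $ i * v $ i)) (at z)"])
      (simp add: holomorphic_Cn_on_def)
  have d: "((\<lambda>z. f m z - f n z) has_derivative (\<lambda>v. \<Sum>i\<in>UNIV. (a m z - a n z) $ i * v $ i)) (at z)"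
    if "z \<in> \<Omega>" for m n z
    using has_derivative_diff[OF a[OF that, of m] a[OF that, of n]]
    by (simp add: sum_subtractf[symmetric] left_diff_distrib)
  have ball: "\<exists>r>0. ball z (3 * r) \<subseteq> \<Omega>" if "z \<in> \<Omega>" for z
  proof -
    from o that obtain s where "s > 0" "ball z s \<subseteq> \<Omega>"
      by (meson openE)
    then show ?thesis by (intro exI[of _ "s / 3"]) auto
  qed
  have conv: "convergent (\<lambda>n. f n z)" if z: "z \<in> \<Omega>" for z
  proof -
    from ball[OF z] obtain r where r: "r > 0" "ball z (3 * r) \<subseteq> \<Omega>" by blast
    then have r3: "3 * r > 0" by simp
    obtain C where C: "C > 0" "\<And>\<Omega> f z. open \<Omega> \<Longrightarrow> f \<in> A2 (\<Omega> :: (complex ^ 'n) set) \<Longrightarrow> ball z (3 * r) \<subseteq> \<Omega> \<Longrightarrow> cmod (f z) \<le> C * L2_norm \<Omega> f"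
      using A2_pointwise_bound[OF r3] by blast
    have "Cauchy (\<lambda>n. f n z)"
    proof (rule metric_CauchyI)
      fix e :: real assume "e > 0"
      then obtain N where N: "\<And>m n. m \<ge> N \<Longrightarrow> n \<ge> N \<Longrightarrow> L2_norm \<Omega> (\<lambda>z. f m z - f n z) < e / C"
        using cauchy[of "e / C"] C(1) by auto
      show "\<exists>M. \<forall>m\<ge>M. \<forall>n\<ge>M. dist (f m z) (f n z) < e"
      proof (intro exI allI impI)
        fix m n assume "N \<le> m" "N \<le> n"
        have "dist (f m z) (f n z) \<le> C * L2_norm \<Omega> (\<lambda>z. f m z - f n z)"
          using C(2)[OF o A2_diff[OF f f] r(2)] by (simp add: dist_norm)
        also have "\<dots> < C * (e / C)"
          using N[OF \<open>N \<le> m\<close> \<open>N \<le> n\<close>] C(1) by (intro mult_strict_left_mono)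
        finally show "dist (f m z) (f n z) < e" using C(1) by simp
      qed
    qed
    then show ?thesis by (rule Cauchy_convergent)
  qed
  define g where "g = (\<lambda>z. lim (\<lambda>n. f n z))"
  have fg: "(\<lambda>n. f n z) \<longlonglongrightarrow> g z" if "z \<in> \<Omega>" for z
    unfolding g_def using conv[OF that] by (simp add: convergent_LIMSEQ_iff)
  have "\<exists>b. (g has_derivative (\<lambda>v. \<Sum>i\<in>UNIV. b $ i * v $ i)) (at z0)" if z0: "z0 \<in> \<Omega>" for z0
  proof -
    \<comment> \<open>The radius \<open>3 * r\<close> leaves room: each \<open>x\<close> in the ball
      \<open>S\<close> of radius \<open>r\<close> has \<open>ball x (2 * r)\<close> inside
      \<open>\<Omega>\<close>, as the gradient bound requires.\<close>
    from ball[OF z0] obtain r where r: "r > 0" "ball z0 (3 * r) \<subseteq> \<Omega>" by blast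
    obtain C where C: "C > 0" "\<And>\<Omega> f x a i. open \<Omega> \<Longrightarrow> f \<in> A2 (\<Omega> :: (complex ^ 'n) set) \<Longrightarrow> ball x (2 * r) \<subseteq> \<Omega> \<Longrightarrow>
      (f has_derivative (\<lambda>v. \<Sum>i\<in>UNIV. a $ i * v $ i)) (at x) \<Longrightarrow> cmod (a $ i) \<le> C * L2_norm \<Omega> f"
      using gradient_bound[OF r(1)] by blast
    define S where "S = ball z0 r"
    have S: "x \<in> \<Omega>" "ball x (2 * r) \<subseteq> \<Omega>" if "x \<in> S" for x
    proof -
      have "ball x (2 * r) \<subseteq> ball z0 (3 * r)"
      proof
        fix y assume "y \<in> ball x (2 * r)"
        then show "y \<in> ball z0 (3 * r)"
          using that dist_triangle[of z0 y x] by (simp add: S_def)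
      qed
      then show "ball x (2 * r) \<subseteq> \<Omega>" using r(2) by blast
      then show "x \<in> \<Omega>" using r(1) by auto
    qed
    have bd: "cmod (a m x $ i - a n x $ i) \<le> C * L2_norm \<Omega> (\<lambda>z. f m z - f n z)" if "x \<in> S" for m n x i
      using C(2)[OF o A2_diff[OF f f] S(2)[OF that] d[OF S(1)[OF that]], of m n i] by simp
    have unif: "\<exists>N. \<forall>m\<ge>N. \<forall>n\<ge>N. \<forall>x\<in>S. \<forall>i. cmod (a m x $ i - a n x $ i) < e" if e: "e > 0" for e
    proof -
      obtain N where N: "\<And>m n. m \<ge> N \<Longrightarrow> n \<ge> N \<Longrightarrow> L2_norm \<Omega> (\<lambda>z. f m z - f n z) < e / C"
        using cauchy[of "e / C"] C(1) e by auto
      show ?thesis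
      proof (intro exI allI impI ballI)
        fix m n x i assume "N \<le> m" "N \<le> n" "x \<in> S"
        have "C * L2_norm \<Omega> (\<lambda>z. f m z - f n z) < C * (e / C)"
          using N[OF \<open>N \<le> m\<close> \<open>N \<le> n\<close>] C(1) by (intro mult_strict_left_mono)
        then show "cmod (a m x $ i - a n x $ i) < e"
          using bd[OF \<open>x \<in> S\<close>, of m i n] C(1) by simp
      qed
    qed
    define b where "b = (\<lambda>x. \<chi> i. lim (\<lambda>n. a n x $ i))"
    have ab: "(\<lambda>n. a n x $ i) \<longlonglongrightarrow> b x $ i" if "x \<in> S" for x i
    proof -
      have "Cauchy (\<lambda>n. a n x $ i)"
        using unif that unfolding Cauchy_def dist_norm by meson
      then show ?thesis
        by (simp add: b_def Cauchy_convergent_iff convergent_LIMSEQ_iff)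
    qed
    have "\<exists>g'. \<forall>x\<in>S. (\<lambda>n. f n x) \<longlonglongrightarrow> g' x \<and> (g' has_derivative (\<lambda>v. \<Sum>i\<in>UNIV. b x $ i * v $ i)) (at x within S)"
    proof (rule has_derivative_sequence)
      show "convex S" by (simp add: S_def)
      show "(f n has_derivative (\<lambda>v. \<Sum>i\<in>UNIV. a n x $ i * v $ i)) (at x within S)" if "x \<in> S" for n x
        using a[OF S(1)[OF that]] by (rule has_derivative_at_withinI)
      show "z0 \<in> S" using r(1) by (simp add: S_def)
      show "(\<lambda>n. f n z0) \<longlonglongrightarrow> g z0" by (rule fg[OF z0])
      fix e :: real assume e: "e > 0"
      \<comment> \<open>The norm of a complex linear form is at most the sum of the moduli of its
        \<open>CARD('n)\<close> coefficients.\<close>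
      define e' where "e' = e / real CARD('n)"
      have e': "e' > 0" using e by (simp add: e'_def)
      from unif[OF e'] obtain N where N: "\<And>m n x i. m \<ge> N \<Longrightarrow> n \<ge> N \<Longrightarrow> x \<in> S \<Longrightarrow> cmod (a m x $ i - a n x $ i) < e'"
        by blast
      have le: "cmod (a n x $ i - b x $ i) \<le> e'" if "n \<ge> N" "x \<in> S" for n x i
      proof (rule tendsto_upperbound)
        show "(\<lambda>m. cmod (a n x $ i - a m x $ i)) \<longlonglongrightarrow> cmod (a n x $ i - b x $ i)"
          by (intro tendsto_intros ab that)
        show "\<forall>\<^sub>F m in sequentially. cmod (a n x $ i - a m x $ i) \<le> e'"
          unfolding eventually_sequentially using N[OF that(1) _ that(2)] less_imp_le by blast
      qed simp
      show "\<forall>\<^sub>F n in sequentially. \<forall>x\<in>S. \<forall>h. norm ((\<Sum>i\<in>UNIV. a n x $ i * h $ i) - (\<Sum>i\<in>UNIV. b x $ i * h $ i)) \<le> e * norm h"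
        unfolding eventually_sequentially
      proof (intro exI allI impI ballI)
        fix n x and h :: "complex ^ 'n" assume n: "N \<le> n" "x \<in> S"
        have "norm ((\<Sum>i\<in>UNIV. a n x $ i * h $ i) - (\<Sum>i\<in>UNIV. b x $ i * h $ i)) = norm (\<Sum>i\<in>UNIV. (a n x $ i - b x $ i) * h $ i)"
          by (simp add: sum_subtractf left_diff_distrib)
        also have "\<dots> \<le> (\<Sum>i\<in>(UNIV :: 'n set). e' * norm h)"
        proof (rule sum_norm_le)
          show "norm ((a n x $ i - b x $ i) * h $ i) \<le> e' * norm h" for i
            unfolding norm_mult using le[OF n] e'
            by (intro mult_mono Finite_Cartesian_Product.norm_nth_le) auto
        qed
        also have "\<dots> = e * norm h" by (simp add: e'_def)
        finally show "norm ((\<Sum>i\<in>UNIV. a n x $ i * h $ i) - (\<Sum>i\<in>UNIV. b x $ i * h $ i)) \<le> e * norm h" .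
      qed
    qed
    then obtain g' where g': "\<And>x. x \<in> S \<Longrightarrow> (\<lambda>n. f n x) \<longlonglongrightarrow> g' x"
      "\<And>x. x \<in> S \<Longrightarrow> (g' has_derivative (\<lambda>v. \<Sum>i\<in>UNIV. b x $ i * v $ i)) (at x within S)"
      by blast
    have z0S: "z0 \<in> S" and oS: "open S" using r(1) by (auto simp: S_def)
    have "(g' has_derivative (\<lambda>v. \<Sum>i\<in>UNIV. b z0 $ i * v $ i)) (at z0)"
      using g'(2)[OF z0S] at_within_open[OF z0S oS] by simp
    then have "(g has_derivative (\<lambda>v. \<Sum>i\<in>UNIV. b z0 $ i * v $ i)) (at z0)"
      by (rule has_derivative_transform_within_open[OF _ oS z0S])
        (metis LIMSEQ_unique S(1) fg g'(1))
    then show ?thesis by blast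
  qed
  then have hol: "holomorphic_Cn_on g \<Omega>" by (auto simp: holomorphic_Cn_on_def)
  have gm: "g \<in> borel_measurable (lebesgue_on \<Omega>)"
    using o by (intro continuous_imp_measurable_on_sets_lebesgue holomorphic_Cn_continuous_on[OF hol]) auto
  have fm: "f n \<in> borel_measurable (lebesgue_on \<Omega>)" for n
    by (rule L2_measurable[OF A2_L2[OF f]])
  have Fatou: "(\<integral>\<^sup>+z. ennreal ((cmod (f n z - g z))\<^sup>2) \<partial>lebesgue_on \<Omega>) \<le> ennreal (e\<^sup>2)"
    if e: "e > 0" and N: "\<And>m. m \<ge> N \<Longrightarrow> L2_norm \<Omega> (\<lambda>z. f n z - f m z) < e" for e N n
  proof -
    have "(\<integral>\<^sup>+z. ennreal ((cmod (f n z - g z))\<^sup>2) \<partial>lebesgue_on \<Omega>) =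
      (\<integral>\<^sup>+z. liminf (\<lambda>m. ennreal ((cmod (f n z - f m z))\<^sup>2)) \<partial>lebesgue_on \<Omega>)"
    proof (rule nn_integral_cong)
      fix z assume "z \<in> space (lebesgue_on \<Omega>)"
      then have "z \<in> \<Omega>" by (simp add: space_restrict_space)
      then have "(\<lambda>m. ennreal ((cmod (f n z - f m z))\<^sup>2)) \<longlonglongrightarrow> ennreal ((cmod (f n z - g z))\<^sup>2)"
        by (intro tendsto_intros fg tendsto_ennrealI)
      then show "ennreal ((cmod (f n z - g z))\<^sup>2) = liminf (\<lambda>m. ennreal ((cmod (f n z - f m z))\<^sup>2))"
        by (intro lim_imp_Liminf[symmetric]) auto
    qed
    also have "\<dots> \<le> liminf (\<lambda>m. \<integral>\<^sup>+z. ennreal ((cmod (f n z - f m z))\<^sup>2) \<partial>lebesgue_on \<Omega>)"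
      using fm by (intro nn_integral_liminf) simp
    also have "\<dots> = liminf (\<lambda>m. ennreal ((L2_norm \<Omega> (\<lambda>z. f n z - f m z))\<^sup>2))"
      using L2_nn_integral[OF A2_L2[OF A2_diff[OF f f]]] by simp
    also have "\<dots> \<le> limsup (\<lambda>m. ennreal ((L2_norm \<Omega> (\<lambda>z. f n z - f m z))\<^sup>2))"
      by (intro Liminf_le_Limsup) simp
    also have "\<dots> \<le> ennreal (e\<^sup>2)"
    proof (rule Limsup_bounded)
      show "\<forall>\<^sub>F m in sequentially. ennreal ((L2_norm \<Omega> (\<lambda>z. f n z - f m z))\<^sup>2) \<le> ennreal (e\<^sup>2)"
        unfolding eventually_sequentially
        using less_imp_le[OF N] by (intro exI[of _ N]) (auto intro!: ennreal_leI power_mono)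
    qed
    finally show ?thesis .
  qed
  have diffL: "(\<lambda>z. f n z - g z) \<in> L2 \<Omega> \<and> L2_norm \<Omega> (\<lambda>z. f n z - g z) \<le> e"
    if e: "e > 0" and N: "\<And>m. m \<ge> N \<Longrightarrow> L2_norm \<Omega> (\<lambda>z. f n z - f m z) < e" for e N n
  proof
    have m: "(\<lambda>z. f n z - g z) \<in> borel_measurable (lebesgue_on \<Omega>)"
      using fm gm by simp
    have F: "(\<integral>\<^sup>+z. ennreal ((cmod (f n z - g z))\<^sup>2) \<partial>lebesgue_on \<Omega>) \<le> ennreal (e\<^sup>2)"
      by (rule Fatou[OF e]) (rule N)
    have "integrable (lebesgue_on \<Omega>) (\<lambda>z. (cmod (f n z - g z))\<^sup>2)"
      using m le_less_trans[OF F ennreal_less_top] by (intro integrableI_nonneg) auto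
    with m show L: "(\<lambda>z. f n z - g z) \<in> L2 \<Omega>" by (simp add: L2_def)
    have "(L2_norm \<Omega> (\<lambda>z. f n z - g z))\<^sup>2 \<le> e\<^sup>2"
      using F unfolding L2_nn_integral[OF L] by (simp add: ennreal_le_iff)
    then show "L2_norm \<Omega> (\<lambda>z. f n z - g z) \<le> e"
      by (rule power2_le_imp_le) (use e in simp)
  qed
  obtain N where "\<And>m n. m \<ge> N \<Longrightarrow> n \<ge> N \<Longrightarrow> L2_norm \<Omega> (\<lambda>z. f m z - f n z) < 1"
    using cauchy[of 1] by auto
  then have "(\<lambda>z. f N z - g z) \<in> L2 \<Omega>"
    using diffL[of 1 N N] by simp
  from L2_diff[OF A2_L2[OF f[of N]] this] have gA: "g \<in> A2 \<Omega>"
    using hol by (simp add: A2_def)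
  have "(\<lambda>n. L2_norm \<Omega> (\<lambda>z. f n z - g z)) \<longlonglongrightarrow> 0"
  proof (rule LIMSEQ_I)
    fix e :: real assume e: "e > 0"
    then obtain N where "\<And>m n. m \<ge> N \<Longrightarrow> n \<ge> N \<Longrightarrow> L2_norm \<Omega> (\<lambda>z. f m z - f n z) < e / 2"
      using cauchy[of "e / 2"] by auto
    then have "L2_norm \<Omega> (\<lambda>z. f n z - g z) \<le> e / 2" if "n \<ge> N" for n
      using diffL[of "e / 2" N n] e that by simp
    then show "\<exists>N. \<forall>n\<ge>N. norm (L2_norm \<Omega> (\<lambda>z. f n z - g z) - 0) < e"
      using e by (intro exI[of _ N]) fastforce
  qed
  with gA show ?thesis by (rule that)
qed

text \<open>Closedness is stated as completeness for the seminorm, the form needed for minimising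
  sequences. Limits are unique only up to null functions, so the condition asks for some limit in
  \<open>M\<close>.\<close>

definition closed_subspace :: "(complex ^ 'n) set \<Rightarrow> (complex ^ 'n \<Rightarrow> complex) set \<Rightarrow> bool" where
  "closed_subspace \<Omega> M \<longleftrightarrow> M \<subseteq> L2 \<Omega> \<and> (\<lambda>z. 0) \<in> M \<and>
     (\<forall>f\<in>M. \<forall>g\<in>M. (\<lambda>z. f z - g z) \<in> M) \<and> (\<forall>f\<in>M. \<forall>c. (\<lambda>z. c * f z) \<in> M) \<and>
     (\<forall>f. range f \<subseteq> M \<longrightarrow> (\<forall>e>0. \<exists>N. \<forall>m\<ge>N. \<forall>n\<ge>N. L2_norm \<Omega> (\<lambda>z. f m z - f n z) < e) \<longrightarrow>
       (\<exists>g\<in>M. (\<lambda>n. L2_norm \<Omega> (\<lambda>z. f n z - g z)) \<longlonglongrightarrow> 0))"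

lemma closed_subspace_complete:
  assumes "closed_subspace \<Omega> M" "\<And>n. f n \<in> M"
    "\<And>e. e > 0 \<Longrightarrow> \<exists>N. \<forall>m\<ge>N. \<forall>n\<ge>N. L2_norm \<Omega> (\<lambda>z. f m z - f n z) < e"
  shows "\<exists>g\<in>M. (\<lambda>n. L2_norm \<Omega> (\<lambda>z. f n z - g z)) \<longlonglongrightarrow> 0"
proof -
  have "range f \<subseteq> M" using assms(2) by auto
  moreover have "\<forall>e>0. \<exists>N. \<forall>m\<ge>N. \<forall>n\<ge>N. L2_norm \<Omega> (\<lambda>z. f m z - f n z) < e"
    using assms(3) by simp
  ultimately show ?thesis
    using assms(1) unfolding closed_subspace_def by simp
qed

lemma closed_subspace_A2: "open \<Omega> \<Longrightarrow> closed_subspace \<Omega> (A2 \<Omega>)"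
  unfolding closed_subspace_def
proof (intro conjI ballI allI impI)
  fix f :: "nat \<Rightarrow> complex ^ 'a \<Rightarrow> complex"
  assume o: "open \<Omega>" and f: "range f \<subseteq> A2 \<Omega>"
    and c: "\<forall>e>0. \<exists>N. \<forall>m\<ge>N. \<forall>n\<ge>N. L2_norm \<Omega> (\<lambda>z. f m z - f n z) < e"
  have "f n \<in> A2 \<Omega>" for n
    using f by auto
  then show "\<exists>g\<in>A2 \<Omega>. (\<lambda>n. L2_norm \<Omega> (\<lambda>z. f n z - g z)) \<longlonglongrightarrow> 0"
    by (rule A2_complete[OF o]) (use c in auto)
qed (auto intro: A2_L2 A2_zero A2_diff A2_scale)

lemma parallelogram_midpoint:
  assumes "a \<in> L2 \<Omega>" "b \<in> L2 \<Omega>"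
  shows "(L2_norm \<Omega> (\<lambda>z. a z - b z))\<^sup>2 =
    2 * (L2_norm \<Omega> a)\<^sup>2 + 2 * (L2_norm \<Omega> b)\<^sup>2 - 4 * (L2_norm \<Omega> (\<lambda>z. (a z + b z) / 2))\<^sup>2"
proof -
  have "(L2_norm \<Omega> (\<lambda>z. a z + b z))\<^sup>2 = (L2_norm \<Omega> a)\<^sup>2 + 2 * Re (L2_inner \<Omega> a b) + (L2_norm \<Omega> b)\<^sup>2"
    using L2_norm_diff_power2[OF assms(1) L2_scale[OF assms(2)], of "- 1"]
    unfolding L2_inner_scale_right L2_norm_scale by simp
  moreover have h: "L2_norm \<Omega> (\<lambda>z. (a z + b z) / 2) = L2_norm \<Omega> (\<lambda>z. a z + b z) / 2"
    using L2_norm_scale[of \<Omega> "1 / 2" "\<lambda>z. a z + b z"] by (simp add: norm_divide)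
  ultimately show ?thesis
    using L2_norm_diff_power2[OF assms] unfolding h power_divide by (simp add: field_simps)
qed

text \<open>A minimising sequence for the distance to \<open>M\<close> is Cauchy by the
  parallelogram law and its limit attains the distance; varying the minimiser by
  \<open>c * k\<close> gives orthogonality.\<close>

theorem projection_exists:
  assumes M: "closed_subspace \<Omega> M" and f: "f \<in> L2 \<Omega>"
  obtains g where "g \<in> M" and "\<And>h. h \<in> M \<Longrightarrow> L2_inner \<Omega> (\<lambda>z. f z - g z) h = 0"
proof -
  have L2M: "h \<in> L2 \<Omega>" if "h \<in> M" for h using M that by (auto simp: closed_subspace_def)
  have Mdiff: "(\<lambda>z. g z - h z) \<in> M" if "g \<in> M" "h \<in> M" for g h
    using M that by (auto simp: closed_subspace_def)
  have Mscale: "(\<lambda>z. c * h z) \<in> M" if "h \<in> M" for c h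
    using M that by (auto simp: closed_subspace_def)
  have Madd: "(\<lambda>z. g z + h z) \<in> M" if "g \<in> M" "h \<in> M" for g h
    using Mdiff[OF that(1) Mscale[OF that(2), of "- 1"]] by simp
  define D where "D = (\<lambda>h. L2_norm \<Omega> (\<lambda>z. f z - h z)) ` M"
  have Dne: "D \<noteq> {}" and Dbd: "bdd_below D"
    using M unfolding D_def closed_subspace_def by (auto intro!: bdd_belowI[where m=0])
  define d where "d = Inf D"
  have dle: "d \<le> L2_norm \<Omega> (\<lambda>z. f z - h z)" if "h \<in> M" for h
    unfolding d_def using that Dbd by (intro cInf_lower) (auto simp: D_def)
  have d0: "d \<ge> 0"
    unfolding d_def using Dne by (intro cInf_greatest) (auto simp: D_def)
  \<comment> \<open>The slack sits on the squared distance, so that the parallelogram law yields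
    \<open>2 / Suc m + 2 / Suc n\<close> without cross terms.\<close>
  have "\<exists>h\<in>M. (L2_norm \<Omega> (\<lambda>z. f z - h z))\<^sup>2 < d\<^sup>2 + 1 / Suc n" for n
  proof -
    have "d < sqrt (d\<^sup>2 + 1 / Suc n)"
      using d0 by (intro real_less_rsqrt) simp
    then obtain h where "h \<in> M" "L2_norm \<Omega> (\<lambda>z. f z - h z) < sqrt (d\<^sup>2 + 1 / Suc n)"
      using cInf_lessD[OF Dne, of "sqrt (d\<^sup>2 + 1 / Suc n)"] by (auto simp: d_def D_def)
    then have "(L2_norm \<Omega> (\<lambda>z. f z - h z))\<^sup>2 < (sqrt (d\<^sup>2 + 1 / Suc n))\<^sup>2"
      by (intro power_strict_mono) auto
    with \<open>h \<in> M\<close> show ?thesis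
      by auto
  qed
  then obtain h where hM: "\<And>n. h n \<in> M" and h: "\<And>n. (L2_norm \<Omega> (\<lambda>z. f z - h n z))\<^sup>2 < d\<^sup>2 + 1 / Suc n"
    by metis
  have cl: "(L2_norm \<Omega> (\<lambda>z. h m z - h n z))\<^sup>2 \<le> 2 / Suc m + 2 / Suc n" for m n
  proof -
    have "(\<lambda>z. (h n z + h m z) / 2) \<in> M"
      using Mscale[OF Madd[OF hM[of n] hM[of m]], of "1 / 2"] by simp
    then have "d \<le> L2_norm \<Omega> (\<lambda>z. f z - (h n z + h m z) / 2)" by (rule dle)
    also have "(\<lambda>z. f z - (h n z + h m z) / 2) = (\<lambda>z. ((f z - h n z) + (f z - h m z)) / 2)"
      by (auto simp: field_simps)
    finally have "d\<^sup>2 \<le> (L2_norm \<Omega> (\<lambda>z. ((f z - h n z) + (f z - h m z)) / 2))\<^sup>2"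
      using d0 by (intro power_mono)
    moreover have "(L2_norm \<Omega> (\<lambda>z. (f z - h n z) - (f z - h m z)))\<^sup>2 = (L2_norm \<Omega> (\<lambda>z. h m z - h n z))\<^sup>2"
      by simp
    moreover have "2 / real (Suc m) = 2 * (1 / real (Suc m))" "2 / real (Suc n) = 2 * (1 / real (Suc n))"
      by simp_all
    ultimately show ?thesis
      using parallelogram_midpoint[OF L2_diff[OF f L2M[OF hM[of n]]] L2_diff[OF f L2M[OF hM[of m]]]] h[of m] h[of n]
      by linarith
  qed
  have "\<exists>N. \<forall>m\<ge>N. \<forall>n\<ge>N. L2_norm \<Omega> (\<lambda>z. h m z - h n z) < e" if e: "e > 0" for e
  proof -
    obtain N where N: "1 / Suc N < e\<^sup>2 / 4"
      using nat_approx_posE[of "e\<^sup>2 / 4"] e by auto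
    have "L2_norm \<Omega> (\<lambda>z. h m z - h n z) < e" if "m \<ge> N" "n \<ge> N" for m n
    proof -
      have "1 / real (Suc m) \<le> 1 / real (Suc N)" "1 / real (Suc n) \<le> 1 / real (Suc N)"
        using that by (auto intro!: divide_left_mono)
      moreover have "2 / real (Suc m) = 2 * (1 / real (Suc m))" "2 / real (Suc n) = 2 * (1 / real (Suc n))"
        by simp_all
      ultimately have "(L2_norm \<Omega> (\<lambda>z. h m z - h n z))\<^sup>2 < e\<^sup>2"
        using cl[of m n] N by linarith
      then show ?thesis by (rule power2_less_imp_less) (use e in simp)
    qed
    then show ?thesis by blast
  qed
  then have "\<exists>g\<in>M. (\<lambda>n. L2_norm \<Omega> (\<lambda>z. h n z - g z)) \<longlonglongrightarrow> 0"
    by (rule closed_subspace_complete[OF M hM])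
  then obtain g where gM: "g \<in> M" and lim: "(\<lambda>n. L2_norm \<Omega> (\<lambda>z. h n z - g z)) \<longlonglongrightarrow> 0"
    by blast
  have "L2_norm \<Omega> (\<lambda>z. f z - g z) \<le> d"
  proof (rule tendsto_lowerbound)
    have "(\<lambda>n. sqrt (d\<^sup>2 + 1 / Suc n) + L2_norm \<Omega> (\<lambda>z. h n z - g z)) \<longlonglongrightarrow> sqrt (d\<^sup>2 + 0) + 0"
      by (intro tendsto_intros lim LIMSEQ_Suc[OF lim_1_over_n])
    then show "(\<lambda>n. sqrt (d\<^sup>2 + 1 / Suc n) + L2_norm \<Omega> (\<lambda>z. h n z - g z)) \<longlonglongrightarrow> d"
      using d0 by simp
    have "L2_norm \<Omega> (\<lambda>z. f z - g z) \<le> sqrt (d\<^sup>2 + 1 / Suc n) + L2_norm \<Omega> (\<lambda>z. h n z - g z)" for n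
      using L2_dist_triangle[OF f L2M[OF hM[of n]] L2M[OF gM]] real_le_rsqrt[OF less_imp_le[OF h[of n]]] by linarith
    then show "\<forall>\<^sub>F n in sequentially. L2_norm \<Omega> (\<lambda>z. f z - g z) \<le> sqrt (d\<^sup>2 + 1 / Suc n) + L2_norm \<Omega> (\<lambda>z. h n z - g z)"
      by simp
  qed simp
  then have deq: "L2_norm \<Omega> (\<lambda>z. f z - g z) = d"
    using dle[OF gM] by simp
  have "L2_inner \<Omega> (\<lambda>z. f z - g z) k = 0" if k: "k \<in> M" for k
  proof -
    define u where "u = (\<lambda>z. f z - g z)"
    have u: "u \<in> L2 \<Omega>" unfolding u_def by (rule L2_diff[OF f L2M[OF gM]])
    have min: "L2_norm \<Omega> u \<le> L2_norm \<Omega> (\<lambda>z. u z - c * k z)" for c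
    proof -
      have "(\<lambda>z. u z - c * k z) = (\<lambda>z. f z - (g z + c * k z))"
        by (auto simp: u_def)
      then show ?thesis
        using dle[OF Madd[OF gM Mscale[OF k, of c]]] deq by (simp add: u_def)
    qed
    define p where "p = L2_inner \<Omega> u k"
    \<comment> \<open>The optimal step would divide by the squared norm of \<open>k\<close>, which
      may be zero; adding 1 keeps \<open>t\<close> positive and still leaves the quadratic term
      below the linear one.\<close>
    define t where "t = 1 / ((L2_norm \<Omega> k)\<^sup>2 + 1)"
    have "(L2_norm \<Omega> k)\<^sup>2 + 1 > 0"
      by (rule add_nonneg_pos) auto
    then have t: "t > 0" "t * (L2_norm \<Omega> k)\<^sup>2 < 1"
      unfolding t_def by (simp_all add: divide_less_eq)
    define c where "c = of_real t * p"
    have "(L2_norm \<Omega> u)\<^sup>2 \<le> (L2_norm \<Omega> (\<lambda>z. u z - c * k z))\<^sup>2"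
      using min by (intro power_mono) auto
    also have "\<dots> = (L2_norm \<Omega> u)\<^sup>2 - 2 * Re (cnj c * p) + (cmod c * L2_norm \<Omega> k)\<^sup>2"
      using L2_norm_diff_power2[OF u L2_scale[OF L2M[OF k]], of c]
      unfolding L2_inner_scale_right L2_norm_scale p_def .
    also have "cnj c * p = of_real (t * (cmod p)\<^sup>2)"
      using mult_cnj_eq_of_real[of p] by (simp add: c_def mult.commute)
    also have "Re (of_real (t * (cmod p)\<^sup>2)) = t * (cmod p)\<^sup>2" by (rule Re_complex_of_real)
    also have "(cmod c * L2_norm \<Omega> k)\<^sup>2 = t * (cmod p)\<^sup>2 * (t * (L2_norm \<Omega> k)\<^sup>2)"
      using t(1) by (simp add: c_def norm_mult power2_eq_square)
    finally have "2 * (t * (cmod p)\<^sup>2) \<le> t * (cmod p)\<^sup>2 * (t * (L2_norm \<Omega> k)\<^sup>2)"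
      by simp
    also have "\<dots> \<le> t * (cmod p)\<^sup>2 * 1"
      using t by (intro mult_left_mono) auto
    finally have "(cmod p)\<^sup>2 \<le> 0"
      using t(1) by (simp add: mult_le_0_iff)
    then show ?thesis by (simp add: p_def u_def)
  qed
  with gM show ?thesis by (rule that)
qed

section \<open>Hankel operators\<close>

lemma bergman_proj:
  assumes "open \<Omega>" "f \<in> L2 \<Omega>"
  shows bergman_proj_A2: "bergman_proj \<Omega> f \<in> A2 \<Omega>"
    and bergman_proj_orthogonal: "h \<in> A2 \<Omega> \<Longrightarrow> L2_inner \<Omega> (\<lambda>z. f z - bergman_proj \<Omega> f z) h = 0"
proof -
  obtain g where "g \<in> A2 \<Omega>" "\<And>h. h \<in> A2 \<Omega> \<Longrightarrow> L2_inner \<Omega> (\<lambda>z. f z - g z) h = 0"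
    using projection_exists[OF closed_subspace_A2[OF assms(1)] assms(2)] by blast
  then have "\<exists>g. g \<in> A2 \<Omega> \<and> (\<forall>h\<in>A2 \<Omega>. L2_inner \<Omega> (\<lambda>z. f z - g z) h = 0)"
    by blast
  from someI_ex[OF this] have "bergman_proj \<Omega> f \<in> A2 \<Omega> \<and>
    (\<forall>h\<in>A2 \<Omega>. L2_inner \<Omega> (\<lambda>z. f z - bergman_proj \<Omega> f z) h = 0)"
    unfolding bergman_proj_def .
  then show "bergman_proj \<Omega> f \<in> A2 \<Omega>"
    and "h \<in> A2 \<Omega> \<Longrightarrow> L2_inner \<Omega> (\<lambda>z. f z - bergman_proj \<Omega> f z) h = 0" by auto
qed

lemma bergman_proj_inner:
  assumes "open \<Omega>" "f \<in> L2 \<Omega>" "h \<in> A2 \<Omega>"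
  shows "L2_inner \<Omega> (bergman_proj \<Omega> f) h = L2_inner \<Omega> f h"
  using bergman_proj_orthogonal[OF assms]
    L2_inner_diff_left[OF assms(2) A2_L2[OF bergman_proj_A2[OF assms(1,2)]] A2_L2[OF assms(3)]] by simp

text \<open>Bases are given by maximality, so Parseval's identity has to be derived, here up to
  \<open>\<epsilon>\<close>. Project \<open>g\<close> onto the closure \<open>M\<close> of the span
  of \<open>E\<close>: the remainder is orthogonal to \<open>E\<close>, hence null by maximality,
  and a finite combination close to \<open>g\<close> bounds the defect in Bessel's
  inequality.\<close>

lemma orthonormal_span_approximation:
  assumes o: "open \<Omega>" and E: "orthonormal_basis_A2 \<Omega> E" and g: "g \<in> A2 \<Omega>" and "\<epsilon> > 0"
  shows "\<exists>F. finite F \<and> F \<subseteq> E \<and> (L2_norm \<Omega> g)\<^sup>2 - \<epsilon> \<le> (\<Sum>e\<in>F. (cmod (L2_inner \<Omega> g e))\<^sup>2)"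
proof -
  define near where "near = (\<lambda>h \<delta>. \<exists>F c. finite F \<and> F \<subseteq> E \<and> L2_norm \<Omega> (\<lambda>z. h z - (\<Sum>e\<in>F. c e * e z)) < \<delta>)"
  define M where "M = {h \<in> A2 \<Omega>. \<forall>\<delta>>0. near h \<delta>}"
  have EA: "e \<in> A2 \<Omega>" if "e \<in> E" for e
    using E that by (auto simp: orthonormal_basis_A2_def)
  have sumA: "(\<lambda>z. \<Sum>e\<in>F. c e * e z) \<in> A2 \<Omega>" if "F \<subseteq> E" for F c
    using that EA by (intro A2_sum) auto
  have near_diff: "near (\<lambda>z. h z - k z) \<delta>" if hk: "h \<in> M" "k \<in> M" and d: "\<delta> > 0" for h k \<delta>
  proof -
    from hk d have "near h (\<delta> / 2)" "near k (\<delta> / 2)" by (auto simp: M_def)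
    then obtain F G c b where F: "finite F" "F \<subseteq> E" "L2_norm \<Omega> (\<lambda>z. h z - (\<Sum>e\<in>F. c e * e z)) < \<delta> / 2"
      and G: "finite G" "G \<subseteq> E" "L2_norm \<Omega> (\<lambda>z. k z - (\<Sum>e\<in>G. b e * e z)) < \<delta> / 2"
      unfolding near_def by blast
    \<comment> \<open>Padding with zeros puts both combinations on the common index set
      \<open>F \<union> G\<close>.\<close>
    define c' where "c' = (\<lambda>e. if e \<in> F then c e else 0)"
    define b' where "b' = (\<lambda>e. if e \<in> G then b e else 0)"
    have c': "(\<Sum>e\<in>F \<union> G. c' e * e z) = (\<Sum>e\<in>F. c e * e z)" for z
      using F(1) G(1) by (intro sum.mono_neutral_cong_right) (auto simp: c'_def)
    have b': "(\<Sum>e\<in>F \<union> G. b' e * e z) = (\<Sum>e\<in>G. b e * e z)" for z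
      using F(1) G(1) by (intro sum.mono_neutral_cong_right) (auto simp: b'_def)
    have "(\<lambda>z. (h z - k z) - (\<Sum>e\<in>F \<union> G. (c' e - b' e) * e z)) =
      (\<lambda>z. (h z - (\<Sum>e\<in>F. c e * e z)) - (k z - (\<Sum>e\<in>G. b e * e z)))"
      by (simp add: left_diff_distrib sum_subtractf c' b' fun_eq_iff)
    then have "L2_norm \<Omega> (\<lambda>z. (h z - k z) - (\<Sum>e\<in>F \<union> G. (c' e - b' e) * e z)) \<le>
      L2_norm \<Omega> (\<lambda>z. h z - (\<Sum>e\<in>F. c e * e z)) + L2_norm \<Omega> (\<lambda>z. k z - (\<Sum>e\<in>G. b e * e z))"
      using L2_norm_triangle[OF L2_diff[OF A2_L2 A2_L2[OF sumA[OF F(2)]]] L2_diff[OF A2_L2 A2_L2[OF sumA[OF G(2)]]]] hk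
      by (simp add: M_def)
    then have "L2_norm \<Omega> (\<lambda>z. (h z - k z) - (\<Sum>e\<in>F \<union> G. (c' e - b' e) * e z)) < \<delta>"
      using F(3) G(3) by simp
    then show ?thesis
      unfolding near_def using F(1,2) G(1,2) by (intro exI[of _ "F \<union> G"] exI[of _ "\<lambda>e. c' e - b' e"]) auto
  qed
  have near_scale: "near (\<lambda>z. a * h z) \<delta>" if h: "h \<in> M" and d: "\<delta> > 0" for a h \<delta>
  proof -
    \<comment> \<open>The \<open>+ 1\<close> covers \<open>a = 0\<close>.\<close>
    from h d have "near h (\<delta> / (cmod a + 1))" by (simp add: M_def add_nonneg_pos)
    then obtain F c where F: "finite F" "F \<subseteq> E" "L2_norm \<Omega> (\<lambda>z. h z - (\<Sum>e\<in>F. c e * e z)) < \<delta> / (cmod a + 1)"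
      unfolding near_def by blast
    have "(\<lambda>z. a * h z - (\<Sum>e\<in>F. a * c e * e z)) = (\<lambda>z. a * (h z - (\<Sum>e\<in>F. c e * e z)))"
      by (simp add: right_diff_distrib sum_distrib_left mult.assoc)
    then have "L2_norm \<Omega> (\<lambda>z. a * h z - (\<Sum>e\<in>F. a * c e * e z)) = cmod a * L2_norm \<Omega> (\<lambda>z. h z - (\<Sum>e\<in>F. c e * e z))"
      by (simp only: L2_norm_scale)
    also have "\<dots> \<le> (cmod a + 1) * L2_norm \<Omega> (\<lambda>z. h z - (\<Sum>e\<in>F. c e * e z))"
      by (intro mult_right_mono) auto
    also have "\<dots> < (cmod a + 1) * (\<delta> / (cmod a + 1))"
      using F(3) by (intro mult_strict_left_mono) (auto simp: add_nonneg_pos)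
    also have "\<dots> = \<delta>"
      using norm_ge_zero[of a] by (simp add: add_nonneg_eq_0_iff)
    finally show ?thesis
      unfolding near_def using F(1,2) by (intro exI[of _ F] exI[of _ "\<lambda>e. a * c e"] conjI)
  qed
  have "closed_subspace \<Omega> M"
    unfolding closed_subspace_def
  proof (intro conjI ballI allI impI)
    show "M \<subseteq> L2 \<Omega>" using A2_L2 by (auto simp: M_def)
    have "near (\<lambda>z. 0) \<delta>" if "\<delta> > 0" for \<delta>
      unfolding near_def using that by (intro exI[of _ "{}"]) (auto simp: L2_norm_def)
    then show "(\<lambda>z. 0) \<in> M" by (simp add: M_def A2_zero)
    show "(\<lambda>z. h z - k z) \<in> M" if "h \<in> M" "k \<in> M" for h k
      using near_diff[OF that] that by (simp add: M_def A2_diff)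
    show "(\<lambda>z. c * h z) \<in> M" if "h \<in> M" for h c
      using near_scale[OF that] that by (simp add: M_def A2_scale)
    fix f :: "nat \<Rightarrow> complex ^ 'a \<Rightarrow> complex"
    assume fM: "range f \<subseteq> M" and c: "\<forall>e>0. \<exists>N. \<forall>m\<ge>N. \<forall>n\<ge>N. L2_norm \<Omega> (\<lambda>z. f m z - f n z) < e"
    have fA: "f n \<in> A2 \<Omega>" for n using fM by (auto simp: M_def)
    obtain k where k: "k \<in> A2 \<Omega>" "(\<lambda>n. L2_norm \<Omega> (\<lambda>z. f n z - k z)) \<longlonglongrightarrow> 0"
      by (rule A2_complete[OF o, of f]) (use fA c in auto)
    have "near k \<delta>" if d: "\<delta> > 0" for \<delta>
    proof -
      have "\<forall>\<^sub>F n in sequentially. L2_norm \<Omega> (\<lambda>z. f n z - k z) < \<delta> / 2"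
        using k(2) d by (intro order_tendstoD) auto
      then obtain n where n: "L2_norm \<Omega> (\<lambda>z. f n z - k z) < \<delta> / 2"
        by (auto simp: eventually_sequentially)
      have "f n \<in> M" using fM by auto
      then have "near (f n) (\<delta> / 2)" using d by (simp add: M_def)
      then obtain F c where F: "finite F" "F \<subseteq> E" "L2_norm \<Omega> (\<lambda>z. f n z - (\<Sum>e\<in>F. c e * e z)) < \<delta> / 2"
        unfolding near_def by blast
      have "L2_norm \<Omega> (\<lambda>z. k z - (\<Sum>e\<in>F. c e * e z)) < \<delta>"
        using L2_dist_triangle[OF A2_L2[OF k(1)] A2_L2[OF fA[of n]] A2_L2[OF sumA[OF F(2), of c]]] n F(3)
          L2_norm_minus_commute[of \<Omega> k "f n"] by linarith
      then show ?thesis unfolding near_def using F(1,2) by (intro exI[of _ F] exI[of _ c] conjI)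
    qed
    then have "k \<in> M" using k(1) by (simp add: M_def)
    then show "\<exists>g\<in>M. (\<lambda>n. L2_norm \<Omega> (\<lambda>z. f n z - g z)) \<longlonglongrightarrow> 0"
      using k(2) by blast
  qed
  then obtain p where p: "p \<in> M" "\<And>h. h \<in> M \<Longrightarrow> L2_inner \<Omega> (\<lambda>z. g z - p z) h = 0"
    using projection_exists[OF _ A2_L2[OF g]] by blast
  have pA: "p \<in> A2 \<Omega>" using p(1) by (simp add: M_def)
  have "L2_inner \<Omega> (\<lambda>z. g z - p z) e = 0" if e: "e \<in> E" for e
  proof (rule p(2))
    have "near e \<delta>" if "\<delta> > 0" for \<delta>
      unfolding near_def using that e
      by (intro exI[of _ "{e}"] exI[of _ "\<lambda>_. 1"]) (auto simp: L2_norm_def)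
    then show "e \<in> M" using EA[OF e] by (simp add: M_def)
  qed
  then have gp: "L2_norm \<Omega> (\<lambda>z. g z - p z) = 0"
    using E A2_diff[OF g pA] by (simp add: orthonormal_basis_A2_def)
  have "near p (sqrt \<epsilon>)" using p(1) \<open>\<epsilon> > 0\<close> by (simp add: M_def)
  then obtain F c where F: "finite F" "F \<subseteq> E" "L2_norm \<Omega> (\<lambda>z. p z - (\<Sum>e\<in>F. c e * e z)) < sqrt \<epsilon>"
    unfolding near_def by blast
  have "L2_norm \<Omega> (\<lambda>z. g z - (\<Sum>e\<in>F. c e * e z)) < sqrt \<epsilon>"
    using L2_dist_triangle[OF A2_L2[OF g] A2_L2[OF pA] A2_L2[OF sumA[OF F(2), of c]]] gp F(3) by linarith
  then have "(L2_norm \<Omega> (\<lambda>z. g z - (\<Sum>e\<in>F. c e * e z)))\<^sup>2 < (sqrt \<epsilon>)\<^sup>2"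
    by (intro power_strict_mono) auto
  moreover have "orthonormal_on \<Omega> F (\<lambda>e. e)"
    unfolding orthonormal_on_def
  proof (intro conjI ballI)
    fix a b assume "a \<in> F" "b \<in> F"
    then have "a \<in> E" "b \<in> E" using F(2) by auto
    then show "L2_inner \<Omega> a b = (if a = b then 1 else 0)"
      using E unfolding orthonormal_basis_A2_def by simp
  qed (use F(2) EA A2_L2 in auto)
  moreover have "(\<Sum>e\<in>F. (norm (c e - L2_inner \<Omega> g e))\<^sup>2) \<ge> 0"
    by (intro sum_nonneg) auto
  ultimately have "(L2_norm \<Omega> g)\<^sup>2 - \<epsilon> \<le> (\<Sum>e\<in>F. (cmod (L2_inner \<Omega> g e))\<^sup>2)"
    using orthonormal_distance_power2[of \<Omega> F "\<lambda>e. e" g c] F(1) A2_L2[OF g] \<open>\<epsilon> > 0\<close> by simp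
  with F(1,2) show ?thesis
    by (intro exI[of _ F] conjI)
qed

locale holomorphic_symbol =
  fixes \<Omega> :: "(complex ^ 'n) set" and \<phi> :: "complex ^ 'n \<Rightarrow> complex" and B :: real
  assumes open_domain: "open \<Omega>"
    and symbol_holomorphic: "holomorphic_Cn_on \<phi> \<Omega>"
    and symbol_bounded: "z \<in> \<Omega> \<Longrightarrow> cmod (\<phi> z) \<le> B"
begin

abbreviation H :: "(complex ^ 'n \<Rightarrow> complex) \<Rightarrow> complex ^ 'n \<Rightarrow> complex" where
  "H \<equiv> hankel \<Omega> (\<lambda>z. cnj (\<phi> z))"

lemma symbol_measurable: "\<phi> \<in> borel_measurable (lebesgue_on \<Omega>)"
  using open_domain
  by (intro continuous_imp_measurable_on_sets_lebesgue holomorphic_Cn_continuous_on[OF symbol_holomorphic]) auto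

lemma symbol_mult_L2: "f \<in> L2 \<Omega> \<Longrightarrow> (\<lambda>z. \<phi> z * f z) \<in> L2 \<Omega>"
  by (rule L2_mult_bounded[OF _ symbol_measurable symbol_bounded])

lemma symbol_mult_A2: "f \<in> A2 \<Omega> \<Longrightarrow> (\<lambda>z. \<phi> z * f z) \<in> A2 \<Omega>"
  by (simp add: A2_def symbol_mult_L2 holomorphic_Cn_mult symbol_holomorphic)

lemma cnj_symbol_mult_L2: "f \<in> L2 \<Omega> \<Longrightarrow> (\<lambda>z. cnj (\<phi> z) * f z) \<in> L2 \<Omega>"
  by (rule L2_mult_bounded[OF _ borel_measurable_cnj[OF symbol_measurable], of _ B])
    (simp_all add: symbol_bounded)

lemma inner_cnj_symbol: "L2_inner \<Omega> (\<lambda>z. cnj (\<phi> z) * f z) g = L2_inner \<Omega> f (\<lambda>z. \<phi> z * g z)"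
  by (simp add: L2_inner_def mult.assoc mult.left_commute)

lemma hankel_L2: "f \<in> A2 \<Omega> \<Longrightarrow> H f \<in> L2 \<Omega>"
  unfolding hankel_def
  by (intro L2_diff cnj_symbol_mult_L2 A2_L2 bergman_proj_A2 open_domain) auto

text \<open>Pythagoras for the Bergman projection of \<open>cnj (\<phi> z) * f z\<close>;
  conjugation leaves moduli unchanged. The projected function is the adjoint of multiplication by
  \<open>\<phi>\<close> applied to \<open>f\<close>, which is how the self-commutator
  arises.\<close>

lemma hankel_norm_power2:
  assumes "f \<in> A2 \<Omega>"
  shows "(L2_norm \<Omega> (H f))\<^sup>2 = (L2_norm \<Omega> (\<lambda>z. \<phi> z * f z))\<^sup>2 -
    (L2_norm \<Omega> (bergman_proj \<Omega> (\<lambda>z. cnj (\<phi> z) * f z)))\<^sup>2"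
proof -
  define u where "u = (\<lambda>z. cnj (\<phi> z) * f z)"
  have u: "u \<in> L2 \<Omega>" unfolding u_def by (rule cnj_symbol_mult_L2[OF A2_L2[OF assms]])
  have p: "bergman_proj \<Omega> u \<in> A2 \<Omega>" by (rule bergman_proj_A2[OF open_domain u])
  have "L2_norm \<Omega> u = L2_norm \<Omega> (\<lambda>z. \<phi> z * f z)"
    unfolding u_def by (rule L2_norm_cong) (simp add: norm_mult)
  moreover have "L2_inner \<Omega> u (bergman_proj \<Omega> u) = of_real ((L2_norm \<Omega> (bergman_proj \<Omega> u))\<^sup>2)"
    unfolding bergman_proj_inner[OF open_domain u p, symmetric] by (rule L2_inner_self)
  ultimately show ?thesis
    using L2_norm_diff_power2[OF u A2_L2[OF p]]
    by (simp add: hankel_def u_def)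
qed

text \<open>The adjoint is explicit: with \<open>P\<close> the Bergman projection it sends
  \<open>u\<close> to \<open>P (\<phi> (u - P u))\<close>. The range of the Hankel operator is
  orthogonal to \<open>A2 \<Omega>\<close>, so \<open>u\<close> may be replaced by
  \<open>u - P u\<close>, and \<open>cnj \<phi>\<close> moves to the other side as
  \<open>\<phi>\<close>.\<close>

lemma hankel_adjoint:
  assumes u: "u \<in> L2 \<Omega>"
  shows "\<exists>g\<in>A2 \<Omega>. \<forall>f\<in>A2 \<Omega>. L2_inner \<Omega> (H f) u = L2_inner \<Omega> f g"
proof -
  define p where "p = bergman_proj \<Omega> u"
  have p: "p \<in> A2 \<Omega>" unfolding p_def by (rule bergman_proj_A2[OF open_domain u])
  define v where "v = (\<lambda>z. u z - p z)"
  have v: "v \<in> L2 \<Omega>" unfolding v_def by (rule L2_diff[OF u A2_L2[OF p]])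
  have vh: "L2_inner \<Omega> h v = 0" if "h \<in> A2 \<Omega>" for h
  proof -
    have "L2_inner \<Omega> v h = 0"
      unfolding v_def p_def by (rule bergman_proj_orthogonal[OF open_domain u that])
    then show ?thesis by (subst L2_inner_commute) simp
  qed
  show ?thesis
  proof (intro bexI ballI)
    show "bergman_proj \<Omega> (\<lambda>z. \<phi> z * v z) \<in> A2 \<Omega>"
      by (rule bergman_proj_A2[OF open_domain symbol_mult_L2[OF v]])
    fix f assume f: "f \<in> A2 \<Omega>"
    define w where "w = (\<lambda>z. cnj (\<phi> z) * f z)"
    have w: "w \<in> L2 \<Omega>" unfolding w_def by (rule cnj_symbol_mult_L2[OF A2_L2[OF f]])
    have Hf: "H f = (\<lambda>z. w z - bergman_proj \<Omega> w z)" by (simp add: hankel_def w_def)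
    have pw: "bergman_proj \<Omega> w \<in> A2 \<Omega>" by (rule bergman_proj_A2[OF open_domain w])
    have "L2_inner \<Omega> (H f) u = L2_inner \<Omega> (H f) u - L2_inner \<Omega> (H f) p"
      unfolding Hf bergman_proj_orthogonal[OF open_domain w p] by simp
    also have "\<dots> = L2_inner \<Omega> (H f) v"
      unfolding v_def using L2_inner_diff_right[OF u A2_L2[OF p] hankel_L2[OF f]] by simp
    also have "\<dots> = L2_inner \<Omega> w v - L2_inner \<Omega> (bergman_proj \<Omega> w) v"
      unfolding Hf by (rule L2_inner_diff_left[OF w A2_L2[OF pw] v])
    also have "\<dots> = L2_inner \<Omega> f (\<lambda>z. \<phi> z * v z)"
      using vh[OF pw] by (simp add: w_def inner_cnj_symbol)
    also have "\<dots> = cnj (L2_inner \<Omega> (\<lambda>z. \<phi> z * v z) f)"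
      by (rule L2_inner_commute)
    also have "\<dots> = cnj (L2_inner \<Omega> (bergman_proj \<Omega> (\<lambda>z. \<phi> z * v z)) f)"
      by (simp add: bergman_proj_inner[OF open_domain symbol_mult_L2[OF v] f])
    also have "\<dots> = L2_inner \<Omega> f (bergman_proj \<Omega> (\<lambda>z. \<phi> z * v z))"
      by (rule L2_inner_commute[symmetric])
    finally show "L2_inner \<Omega> (H f) u = L2_inner \<Omega> f (bergman_proj \<Omega> (\<lambda>z. \<phi> z * v z))" .
  qed
qed

text \<open>Quantifying over all finite orthonormal families, rather than one basis, makes the bound
  applicable to the flag vectors constructed later, which form no basis.\<close>

definition trace_bound :: "real \<Rightarrow> bool" where
  "trace_bound S \<longleftrightarrow> (\<forall>K (e :: nat \<Rightarrow> complex ^ 'n \<Rightarrow> complex).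
     orthonormal_on \<Omega> {..<K} e \<longrightarrow> (\<forall>k<K. e k \<in> A2 \<Omega>) \<longrightarrow> (\<Sum>k<K. (L2_norm \<Omega> (H (e k)))\<^sup>2) \<le> S)"

lemma cmod_L2_inner_commute: "cmod (L2_inner \<Omega> f g) = cmod (L2_inner \<Omega> g f)"
  by (subst L2_inner_commute) simp

text \<open>Passing to the adjoint makes the Hilbert-Schmidt sum independent of the orthonormal family.\<close>

lemma hilbert_schmidt_trace_bound:
  assumes "hilbert_schmidt_A2 \<Omega> H"
  obtains S where "trace_bound S"
proof -
  from assms obtain E where E: "orthonormal_basis_A2 \<Omega> E" and sm: "(\<lambda>e. (L2_norm \<Omega> (H e))\<^sup>2) summable_on E"
    by (auto simp: hilbert_schmidt_A2_def)
  define S where "S = infsum (\<lambda>e. (L2_norm \<Omega> (H e))\<^sup>2) E"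
  have "(\<Sum>k<K. (L2_norm \<Omega> (H (e k)))\<^sup>2) \<le> S"
    if e: "orthonormal_on \<Omega> {..<K} e" and eA: "\<And>k. k < K \<Longrightarrow> e k \<in> A2 \<Omega>" for K and e :: "nat \<Rightarrow> complex ^ 'n \<Rightarrow> complex"
  proof (rule field_le_epsilon)
    fix \<epsilon> :: real assume \<epsilon>: "\<epsilon> > 0"
    \<comment> \<open>Finitely many \<open>u i\<close> capture the norms of all
      \<open>H (e k)\<close>, so the adjoint is needed only on these vectors.\<close>
    obtain N u where u: "orthonormal_on \<Omega> {..<N::nat} u"
      and un: "\<And>k. k < K \<Longrightarrow> (L2_norm \<Omega> (H (e k)))\<^sup>2 = (\<Sum>i<N. (norm (L2_inner \<Omega> (H (e k)) (u i)))\<^sup>2)"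
      using Gram_Schmidt[of K "\<lambda>k. H (e k)"] hankel_L2[OF eA] by blast
    have uL: "u i \<in> L2 \<Omega>" if "i < N" for i using u that by (auto simp: orthonormal_on_def)
    have "\<forall>i\<in>{..<N}. \<exists>g. g \<in> A2 \<Omega> \<and> (\<forall>f\<in>A2 \<Omega>. L2_inner \<Omega> (H f) (u i) = L2_inner \<Omega> f g)"
      using hankel_adjoint[OF uL] by (simp add: Bex_def)
    from bchoice[OF this] obtain g where
      gA: "\<forall>i\<in>{..<N}. g i \<in> A2 \<Omega> \<and> (\<forall>f\<in>A2 \<Omega>. L2_inner \<Omega> (H f) (u i) = L2_inner \<Omega> f (g i))" ..
    have g: "g i \<in> A2 \<Omega>" if "i < N" for i
      using gA that by simp
    have gi: "L2_inner \<Omega> (H f) (u i) = L2_inner \<Omega> f (g i)" if "i < N" "f \<in> A2 \<Omega>" for i f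
      using gA that by simp
    \<comment> \<open>Each of the \<open>N\<close> adjoint vectors costs an error
      \<open>\<delta>\<close>; the \<open>+ 1\<close> covers \<open>N = 0\<close>.\<close>
    define \<delta> where "\<delta> = \<epsilon> / (N + 1)"
    have \<delta>: "\<delta> > 0" "N * \<delta> \<le> \<epsilon>" using \<epsilon> by (auto simp: \<delta>_def field_simps)
    have "\<forall>i\<in>{..<N}. \<exists>F. finite F \<and> F \<subseteq> E \<and> (L2_norm \<Omega> (g i))\<^sup>2 - \<delta> \<le> (\<Sum>e\<in>F. (cmod (L2_inner \<Omega> (g i) e))\<^sup>2)"
      by (intro ballI orthonormal_span_approximation[OF open_domain E g \<delta>(1)]) simp
    from bchoice[OF this] obtain F where "\<forall>i\<in>{..<N}. finite (F i) \<and> F i \<subseteq> E \<and>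
        (L2_norm \<Omega> (g i))\<^sup>2 - \<delta> \<le> (\<Sum>e\<in>F i. (cmod (L2_inner \<Omega> (g i) e))\<^sup>2)" ..
    note F = this[rule_format, unfolded lessThan_iff]
    define G where "G = (\<Union>i<N. F i)"
    have G: "finite G" "G \<subseteq> E" unfolding G_def using F by auto
    have GA: "e \<in> A2 \<Omega>" if "e \<in> G" for e using G E that by (auto simp: orthonormal_basis_A2_def)
    have gG: "(L2_norm \<Omega> (g i))\<^sup>2 \<le> (\<Sum>e\<in>G. (cmod (L2_inner \<Omega> (H e) (u i)))\<^sup>2) + \<delta>" if i: "i < N" for i
    proof -
      have "(L2_norm \<Omega> (g i))\<^sup>2 - \<delta> \<le> (\<Sum>e\<in>F i. (cmod (L2_inner \<Omega> (g i) e))\<^sup>2)"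
        using F[OF i] by blast
      also have "\<dots> \<le> (\<Sum>e\<in>G. (cmod (L2_inner \<Omega> (g i) e))\<^sup>2)"
        using G(1) i by (intro sum_mono2) (auto simp: G_def)
      also have "\<dots> = (\<Sum>e\<in>G. (cmod (L2_inner \<Omega> (H e) (u i)))\<^sup>2)"
        using GA by (intro sum.cong refl) (simp add: gi[OF i] cmod_L2_inner_commute[of "g i"])
      finally show ?thesis by simp
    qed
    \<comment> \<open>After the swap, Bessel for \<open>e\<close> removes the given family, Parseval
      up to \<open>\<delta>\<close> brings in the basis \<open>E\<close>, and Bessel for
      \<open>u\<close> returns to norms of \<open>H e\<close> over a finite part of
      \<open>E\<close>.\<close>
    have "(\<Sum>k<K. (L2_norm \<Omega> (H (e k)))\<^sup>2) = (\<Sum>k<K. \<Sum>i<N. (cmod (L2_inner \<Omega> (g i) (e k)))\<^sup>2)"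
      by (intro sum.cong refl) (simp add: un gi eA cmod_L2_inner_commute[of "e _"])
    also have "\<dots> = (\<Sum>i<N. \<Sum>k<K. (cmod (L2_inner \<Omega> (g i) (e k)))\<^sup>2)"
      by (rule sum.swap)
    also have "\<dots> \<le> (\<Sum>i<N. (L2_norm \<Omega> (g i))\<^sup>2)"
      using g by (intro sum_mono Bessel_inequality[OF e] A2_L2) auto
    also have "\<dots> \<le> (\<Sum>i<N. (\<Sum>e\<in>G. (cmod (L2_inner \<Omega> (H e) (u i)))\<^sup>2) + \<delta>)"
      using gG by (intro sum_mono) auto
    also have "\<dots> = (\<Sum>e\<in>G. \<Sum>i<N. (cmod (L2_inner \<Omega> (H e) (u i)))\<^sup>2) + N * \<delta>"
      by (subst sum.swap) (simp add: sum.distrib)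
    also have "\<dots> \<le> (\<Sum>e\<in>G. (L2_norm \<Omega> (H e))\<^sup>2) + \<epsilon>"
      using GA \<delta>(2) by (intro add_mono sum_mono Bessel_inequality[OF u] hankel_L2) auto
    also have "(\<Sum>e\<in>G. (L2_norm \<Omega> (H e))\<^sup>2) \<le> S"
      unfolding S_def using sm G by (intro finite_sum_le_infsum) auto
    finally show "(\<Sum>k<K. (L2_norm \<Omega> (H (e k)))\<^sup>2) \<le> S + \<epsilon>" by simp
  qed
  then have "trace_bound S" unfolding trace_bound_def by blast
  then show ?thesis by (rule that)
qed

end

section \<open>A trace inequality for flags of functionals\<close>

lemma vanishing_subspace_closed:
  fixes l :: "nat \<Rightarrow> (complex ^ 'n \<Rightarrow> complex) \<Rightarrow> complex"
  assumes o: "open \<Omega>"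
    and l_diff: "\<And>k f g. f \<in> A2 \<Omega> \<Longrightarrow> g \<in> A2 \<Omega> \<Longrightarrow> l k (\<lambda>z. f z - g z) = l k f - l k g"
    and l_scale: "\<And>k c f. f \<in> A2 \<Omega> \<Longrightarrow> l k (\<lambda>z. c * f z) = c * l k f"
    and l_bounded: "\<And>k. \<exists>C. \<forall>f\<in>A2 \<Omega>. cmod (l k f) \<le> C * L2_norm \<Omega> f"
  shows "closed_subspace \<Omega> {f \<in> A2 \<Omega>. \<forall>j<K. l j f = 0}"
  unfolding closed_subspace_def
proof (intro conjI ballI allI impI)
  let ?J = "{f \<in> A2 \<Omega>. \<forall>j<K. l j f = 0}"
  show "?J \<subseteq> L2 \<Omega>" using A2_L2 by auto
  show "(\<lambda>z. 0) \<in> ?J" using l_scale[OF A2_zero, of _ 0] by (simp add: A2_zero)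
  show "(\<lambda>z. f z - g z) \<in> ?J" if "f \<in> ?J" "g \<in> ?J" for f g
    using that by (simp add: A2_diff l_diff)
  show "(\<lambda>z. c * f z) \<in> ?J" if "f \<in> ?J" for f c
    using that by (simp add: A2_scale l_scale)
  fix f :: "nat \<Rightarrow> complex ^ 'n \<Rightarrow> complex"
  assume fJ: "range f \<subseteq> ?J" and c: "\<forall>e>0. \<exists>N. \<forall>m\<ge>N. \<forall>n\<ge>N. L2_norm \<Omega> (\<lambda>z. f m z - f n z) < e"
  have fA: "f n \<in> A2 \<Omega>" and lf: "j < K \<Longrightarrow> l j (f n) = 0" for n j using fJ by auto
  obtain g where g: "g \<in> A2 \<Omega>" "(\<lambda>n. L2_norm \<Omega> (\<lambda>z. f n z - g z)) \<longlonglongrightarrow> 0"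
    by (rule A2_complete[OF o, of f]) (use fA c in auto)
  have "l j g = 0" if j: "j < K" for j
  proof -
    obtain C where C: "\<And>h. h \<in> A2 \<Omega> \<Longrightarrow> cmod (l j h) \<le> C * L2_norm \<Omega> h"
      using l_bounded[of j] by auto
    have "cmod (l j g) \<le> C * L2_norm \<Omega> (\<lambda>z. f n z - g z)" for n
      using C[OF A2_diff[OF fA[of n] g(1)]] by (simp add: l_diff[OF fA g(1)] lf[OF j])
    moreover have "(\<lambda>n. C * L2_norm \<Omega> (\<lambda>z. f n z - g z)) \<longlonglongrightarrow> C * 0"
      by (intro tendsto_intros g(2))
    ultimately have "cmod (l j g) \<le> C * 0"
      by (intro LIMSEQ_le_const) auto
    then show ?thesis by simp
  qed
  with g show "\<exists>g\<in>?J. (\<lambda>n. L2_norm \<Omega> (\<lambda>z. f n z - g z)) \<longlonglongrightarrow> 0"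
    by (intro bexI[of _ g]) auto
qed

text \<open>This isolates what the trace inequality needs of Taylor coefficients. The common kernels
  of the first \<open>k\<close> functionals form a decreasing flag, \<open>x k\<close> shows that
  each inclusion is strict, and multiplication by \<open>\<phi> - \<mu>\<close> descends
  \<open>m\<close> steps, acting on leading coefficients as the scalar
  \<open>\<alpha> k\<close>.\<close>

locale flag = holomorphic_symbol \<Omega> \<phi> B for \<Omega> :: "(complex ^ 'n) set" and \<phi> B +
  fixes l :: "nat \<Rightarrow> (complex ^ 'n \<Rightarrow> complex) \<Rightarrow> complex" and x :: "nat \<Rightarrow> complex ^ 'n \<Rightarrow> complex"
    and m :: nat and \<mu> :: complex and \<alpha> :: "nat \<Rightarrow> complex"
  assumes l_diff: "f \<in> A2 \<Omega> \<Longrightarrow> g \<in> A2 \<Omega> \<Longrightarrow> l k (\<lambda>z. f z - g z) = l k f - l k g"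
    and l_scale: "f \<in> A2 \<Omega> \<Longrightarrow> l k (\<lambda>z. c * f z) = c * l k f"
    and l_bounded: "\<exists>C. \<forall>f\<in>A2 \<Omega>. cmod (l k f) \<le> C * L2_norm \<Omega> f"
    and x_A2: "x k \<in> A2 \<Omega>"
    and l_x_less: "j < k \<Longrightarrow> l j (x k) = 0"
    and l_x_nonzero: "l k (x k) \<noteq> 0"
    and m_pos: "m > 0"
    and shift_zero: "f \<in> A2 \<Omega> \<Longrightarrow> (\<And>j. j < k \<Longrightarrow> l j f = 0) \<Longrightarrow> i < k + m \<Longrightarrow> l i (\<lambda>z. (\<phi> z - \<mu>) * f z) = 0"
    and shift_leading: "f \<in> A2 \<Omega> \<Longrightarrow> (\<And>j. j < k \<Longrightarrow> l j f = 0) \<Longrightarrow> l (k + m) (\<lambda>z. (\<phi> z - \<mu>) * f z) = \<alpha> k * l k f"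
begin

definition J :: "nat \<Rightarrow> (complex ^ 'n \<Rightarrow> complex) set" where
  "J K = {f \<in> A2 \<Omega>. \<forall>j<K. l j f = 0}"

lemma J_A2: "f \<in> J K \<Longrightarrow> f \<in> A2 \<Omega>"
  by (simp add: J_def)

lemma J_L2: "f \<in> J K \<Longrightarrow> f \<in> L2 \<Omega>"
  by (simp add: J_def A2_L2)

lemma J_mono: "f \<in> J K \<Longrightarrow> i \<le> K \<Longrightarrow> f \<in> J i"
  by (simp add: J_def)

lemma J_diff: "f \<in> J K \<Longrightarrow> g \<in> J K \<Longrightarrow> (\<lambda>z. f z - g z) \<in> J K"
  by (simp add: J_def A2_diff l_diff)

lemma J_scale: "f \<in> J K \<Longrightarrow> (\<lambda>z. c * f z) \<in> J K"
  by (simp add: J_def A2_scale l_scale)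

lemma shifted_symbol_A2: "f \<in> A2 \<Omega> \<Longrightarrow> (\<lambda>z. (\<phi> z - \<mu>) * f z) \<in> A2 \<Omega>"
  using A2_diff[OF symbol_mult_A2[of f] A2_scale[of f \<Omega> \<mu>]] by (simp add: left_diff_distrib)

lemma shifted_symbol_J: "f \<in> J K \<Longrightarrow> (\<lambda>z. (\<phi> z - \<mu>) * f z) \<in> J (K + m)"
  unfolding J_def using shifted_symbol_A2 shift_zero[of f K] by simp

lemma symbol_J:
  assumes "f \<in> J K"
  shows "(\<lambda>z. \<phi> z * f z) \<in> J K"
proof -
  have "(\<lambda>z. (\<phi> z - \<mu>) * f z - (- \<mu>) * f z) \<in> J K"
    using J_diff[OF J_mono[OF shifted_symbol_J[OF assms]] J_scale[OF assms, of "- \<mu>"]] by simp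
  then show ?thesis by (simp add: left_diff_distrib)
qed

text \<open>Take \<open>x k\<close> minus its projection to \<open>J (Suc k)\<close> and normalise.
  Subtracting does not change the value of \<open>l k\<close>, and boundedness of \<open>l k\<close>
  turns this nonzero value into a nonzero norm.\<close>

lemma flag_vector_exists: "\<exists>e. e \<in> J k \<and> (\<forall>h\<in>J (Suc k). L2_inner \<Omega> e h = 0) \<and> L2_inner \<Omega> e e = 1"
proof -
  have "closed_subspace \<Omega> (J (Suc k))"
    unfolding J_def by (rule vanishing_subspace_closed[OF open_domain l_diff l_scale l_bounded])
  then obtain p where p: "p \<in> J (Suc k)" "\<And>h. h \<in> J (Suc k) \<Longrightarrow> L2_inner \<Omega> (\<lambda>z. x k z - p z) h = 0"
    using projection_exists[OF _ A2_L2[OF x_A2]] by blast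
  define y where "y = (\<lambda>z. x k z - p z)"
  have "x k \<in> J k" by (simp add: J_def x_A2 l_x_less)
  then have y: "y \<in> J k" unfolding y_def using J_mono[OF p(1)] by (intro J_diff) auto
  have "l k y = l k (x k)"
    using p(1) by (simp add: y_def l_diff x_A2 J_A2[OF p(1)]) (simp add: J_def)
  then have "l k y \<noteq> 0" by (simp add: l_x_nonzero)
  obtain C where "\<And>f. f \<in> A2 \<Omega> \<Longrightarrow> cmod (l k f) \<le> C * L2_norm \<Omega> f"
    using l_bounded[of k] by auto
  then have "cmod (l k y) \<le> C * L2_norm \<Omega> y" using J_A2[OF y] by blast
  with \<open>l k y \<noteq> 0\<close> have "L2_norm \<Omega> y \<noteq> 0" by auto
  define e where "e = (\<lambda>z. of_real (1 / L2_norm \<Omega> y) * y z)"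
  have "L2_inner \<Omega> e e = 1"
    unfolding e_def L2_inner_scale_left L2_inner_scale_right L2_inner_self
    using \<open>L2_norm \<Omega> y \<noteq> 0\<close> by (simp add: power2_eq_square)
  moreover have "L2_inner \<Omega> e h = 0" if "h \<in> J (Suc k)" for h
    unfolding e_def L2_inner_scale_left using p(2)[OF that] by (simp add: y_def)
  moreover have "e \<in> J k" unfolding e_def by (rule J_scale[OF y])
  ultimately show ?thesis by (intro exI[of _ e] conjI ballI)
qed

definition e :: "nat \<Rightarrow> complex ^ 'n \<Rightarrow> complex" where
  "e k = (SOME e. e \<in> J k \<and> (\<forall>h\<in>J (Suc k). L2_inner \<Omega> e h = 0) \<and> L2_inner \<Omega> e e = 1)"

lemma e_J: "e k \<in> J k"
  and e_orthogonal: "h \<in> J (Suc k) \<Longrightarrow> L2_inner \<Omega> (e k) h = 0"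
  and e_self: "L2_inner \<Omega> (e k) (e k) = 1"
proof -
  have *: "e k \<in> J k \<and> (\<forall>h\<in>J (Suc k). L2_inner \<Omega> (e k) h = 0) \<and> L2_inner \<Omega> (e k) (e k) = 1"
    unfolding e_def by (rule someI_ex[OF flag_vector_exists])
  show "e k \<in> J k" "h \<in> J (Suc k) \<Longrightarrow> L2_inner \<Omega> (e k) h = 0" "L2_inner \<Omega> (e k) (e k) = 1"
    using * by blast+
qed

lemma e_A2: "e k \<in> A2 \<Omega>"
  by (rule J_A2[OF e_J])

lemma e_L2: "e k \<in> L2 \<Omega>"
  by (rule A2_L2[OF e_A2])

lemma e_orthogonal_J: "h \<in> J K \<Longrightarrow> k < K \<Longrightarrow> L2_inner \<Omega> (e k) h = 0"
  by (rule e_orthogonal[OF J_mono]) auto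

lemma J_orthogonal_e: "h \<in> J K \<Longrightarrow> k < K \<Longrightarrow> L2_inner \<Omega> h (e k) = 0"
  by (subst L2_inner_commute) (simp add: e_orthogonal_J)

lemma e_inner: "L2_inner \<Omega> (e i) (e j) = (if i = j then 1 else 0)"
proof (cases i j rule: linorder_cases)
  case less
  then show ?thesis using e_orthogonal_J[OF e_J less] by simp
next
  case greater
  then show ?thesis using J_orthogonal_e[OF e_J greater] by simp
qed (simp add: e_self)

lemma orthonormal_e: "orthonormal_on \<Omega> A e"
  by (simp add: orthonormal_on_def e_L2 e_inner)

lemma norm_e: "L2_norm \<Omega> (e k) = 1"
proof -
  have "complex_of_real ((L2_norm \<Omega> (e k))\<^sup>2) = 1"
    using e_self[of k] by (simp only: L2_inner_self)
  then have "(L2_norm \<Omega> (e k))\<^sup>2 = 1"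
    by (simp only: of_real_eq_1_iff)
  then show ?thesis
    using L2_norm_nonneg[of \<Omega> "e k"] by (simp add: power2_eq_1_iff)
qed

lemma l_e_nonzero: "l k (e k) \<noteq> 0"
proof
  assume "l k (e k) = 0"
  then have "e k \<in> J (Suc k)" using e_J[of k] by (auto simp: J_def less_Suc_eq)
  from e_orthogonal[OF this] e_self show False by simp
qed

text \<open>\<open>J (Suc k)\<close> has codimension one in \<open>J k\<close> and is orthogonal to
  \<open>e k\<close>, so the coefficient along \<open>e k\<close> is found by comparing values of
  \<open>l k\<close>.\<close>

lemma inner_e:
  assumes f: "f \<in> J k"
  shows "L2_inner \<Omega> f (e k) = l k f / l k (e k)"
proof -
  define c where "c = l k f / l k (e k)"
  have ce: "(\<lambda>z. c * e k z) \<in> J k" by (rule J_scale[OF e_J])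
  have "l k (\<lambda>z. f z - c * e k z) = l k f - c * l k (e k)"
    by (simp add: l_diff J_A2[OF f] J_A2[OF ce] l_scale e_A2)
  then have "l k (\<lambda>z. f z - c * e k z) = 0"
    using l_e_nonzero by (simp add: c_def)
  then have "(\<lambda>z. f z - c * e k z) \<in> J (Suc k)"
    using J_diff[OF f ce] by (auto simp: J_def less_Suc_eq)
  from J_orthogonal_e[OF this] have "L2_inner \<Omega> (\<lambda>z. f z - c * e k z) (e k) = 0" by simp
  then show ?thesis
    unfolding L2_inner_diff_left[OF J_L2[OF f] J_L2[OF ce] e_L2] L2_inner_scale_left e_self
    by (simp add: c_def)
qed

text \<open>\<open>J K\<close> has codimension \<open>K\<close>, so removing \<open>K\<close>
  components is enough to reach it, although the \<open>e j\<close> are not complete. In the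
  induction the coefficient of \<open>h\<close> along \<open>e K\<close> equals that of the current
  residual, to which \<open>inner_e\<close> applies.\<close>

lemma residual_J:
  assumes h: "h \<in> A2 \<Omega>"
  shows "(\<lambda>z. h z - (\<Sum>j<K. L2_inner \<Omega> h (e j) * e j z)) \<in> J K"
proof (induction K)
  case 0
  then show ?case using h by (simp add: J_def)
next
  case (Suc K)
  define r where "r = (\<lambda>z. h z - (\<Sum>j<K. L2_inner \<Omega> h (e j) * e j z))"
  have r: "r \<in> J K" using Suc by (simp add: r_def)
  have "L2_inner \<Omega> r (e K) = L2_inner \<Omega> h (e K) - (\<Sum>j<K. L2_inner \<Omega> h (e j) * L2_inner \<Omega> (e j) (e K))"
    unfolding r_def by (rule L2_inner_diff_sum_left[OF A2_L2[OF h] e_L2 e_L2])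
  also have "(\<Sum>j<K. L2_inner \<Omega> h (e j) * L2_inner \<Omega> (e j) (e K)) = 0"
    by (intro sum.neutral) (simp add: e_inner)
  finally have rh: "L2_inner \<Omega> h (e K) = l K r / l K (e K)"
    by (simp add: inner_e[OF r])
  define c where "c = L2_inner \<Omega> h (e K)"
  have ce: "(\<lambda>z. c * e K z) \<in> J K" by (rule J_scale[OF e_J])
  have "l K (\<lambda>z. r z - c * e K z) = l K r - c * l K (e K)"
    by (simp add: l_diff J_A2[OF r] J_A2[OF ce] l_scale e_A2)
  then have "l K (\<lambda>z. r z - c * e K z) = 0"
    using l_e_nonzero by (simp add: c_def rh)
  then have "(\<lambda>z. r z - c * e K z) \<in> J (Suc K)"
    using J_diff[OF r ce] by (auto simp: J_def less_Suc_eq)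
  then show ?case by (simp add: r_def c_def diff_diff_eq)
qed

text \<open>Multiplication by \<open>\<phi>\<close> maps \<open>J K\<close> into itself, so for
  \<open>k < K\<close> the adjoint image \<open>g\<close> of \<open>e k\<close> is orthogonal to
  \<open>J K\<close>. The residual of \<open>g\<close> lies in \<open>J K\<close>, hence is
  orthogonal to \<open>g\<close> and to the removed components and has norm zero: Parseval holds
  exactly with \<open>K\<close> terms.\<close>

lemma norm_adjoint_e:
  assumes k: "k < K"
  shows "(L2_norm \<Omega> (bergman_proj \<Omega> (\<lambda>z. cnj (\<phi> z) * e k z)))\<^sup>2 = (\<Sum>j<K. (cmod (L2_inner \<Omega> (\<lambda>z. \<phi> z * e j z) (e k)))\<^sup>2)"
proof -
  define u where "u = (\<lambda>z. cnj (\<phi> z) * e k z)"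
  have u: "u \<in> L2 \<Omega>" unfolding u_def by (rule cnj_symbol_mult_L2[OF e_L2])
  define g where "g = bergman_proj \<Omega> u"
  have g: "g \<in> A2 \<Omega>" unfolding g_def by (rule bergman_proj_A2[OF open_domain u])
  have gh: "L2_inner \<Omega> g h = L2_inner \<Omega> (e k) (\<lambda>z. \<phi> z * h z)" if "h \<in> A2 \<Omega>" for h
  proof -
    have "L2_inner \<Omega> g h = L2_inner \<Omega> u h"
      unfolding g_def by (rule bergman_proj_inner[OF open_domain u that])
    then show ?thesis by (simp add: u_def inner_cnj_symbol)
  qed
  define r where "r = (\<lambda>z. g z - (\<Sum>j<K. L2_inner \<Omega> g (e j) * e j z))"
  have r: "r \<in> J K" unfolding r_def by (rule residual_J[OF g])
  have "L2_inner \<Omega> r r = L2_inner \<Omega> g r - (\<Sum>j<K. L2_inner \<Omega> g (e j) * L2_inner \<Omega> (e j) r)"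
    by (subst r_def) (rule L2_inner_diff_sum_left[OF A2_L2[OF g] e_L2 J_L2[OF r]])
  also have "(\<Sum>j<K. L2_inner \<Omega> g (e j) * L2_inner \<Omega> (e j) r) = 0"
    using e_orthogonal_J[OF r] by (intro sum.neutral) simp
  also have "L2_inner \<Omega> g r = 0"
    unfolding gh[OF J_A2[OF r]] by (rule e_orthogonal_J[OF symbol_J[OF r] k])
  finally have "(L2_norm \<Omega> r)\<^sup>2 = 0"
    by (simp add: L2_inner_self)
  then have "(L2_norm \<Omega> g)\<^sup>2 = (\<Sum>j<K. (cmod (L2_inner \<Omega> g (e j)))\<^sup>2)"
    using orthonormal_distance_power2[OF orthonormal_e finite_lessThan A2_L2[OF g], of "\<lambda>j. L2_inner \<Omega> g (e j)" K]
    by (simp add: r_def)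
  also have "\<dots> = (\<Sum>j<K. (cmod (L2_inner \<Omega> (\<lambda>z. \<phi> z * e j z) (e k)))\<^sup>2)"
    by (intro sum.cong refl) (simp add: gh[OF e_A2] cmod_L2_inner_commute[of "e k"])
  finally show ?thesis by (simp add: g_def u_def)
qed

text \<open>Split \<open>\<phi>\<close> into \<open>\<phi> - \<mu>\<close> and \<open>\<mu>\<close>.
  The constant contributes nothing because \<open>m > 0\<close> makes the two vectors orthogonal;
  the rest lies in \<open>J (k + m)\<close>, where coefficients are quotients of values of
  \<open>l (k + m)\<close>.\<close>

lemma inner_symbol_shift: "L2_inner \<Omega> (\<lambda>z. \<phi> z * e k z) (e (k + m)) = \<alpha> k * l k (e k) / l (k + m) (e (k + m))"
proof -
  define w where "w = (\<lambda>z. (\<phi> z - \<mu>) * e k z)"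
  have w: "w \<in> J (k + m)" unfolding w_def by (rule shifted_symbol_J[OF e_J])
  have "(\<lambda>z. \<phi> z * e k z) = (\<lambda>z. w z - (- \<mu>) * e k z)"
    by (simp add: w_def left_diff_distrib)
  then have "L2_inner \<Omega> (\<lambda>z. \<phi> z * e k z) (e (k + m)) =
      L2_inner \<Omega> w (e (k + m)) - (- \<mu>) * L2_inner \<Omega> (e k) (e (k + m))"
    by (simp only: L2_inner_diff_left[OF J_L2[OF w] L2_scale[OF e_L2] e_L2] L2_inner_scale_left)
  also have "\<dots> = l (k + m) w / l (k + m) (e (k + m))"
    using m_pos by (simp add: e_inner inner_e[OF w])
  also have "l (k + m) w = \<alpha> k * l k (e k)"
    unfolding w_def using e_J[of k] by (intro shift_leading) (auto simp: J_def)
  finally show ?thesis .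
qed

text \<open>On the span of \<open>e 0, \<dots>, e (K - 1)\<close>, which is invariant under the adjoint of multiplication
  by \<open>\<phi>\<close>, all terms of the trace of the self-commutator cancel except those leaving the span.\<close>

theorem trace_lower_bound:
  assumes S: "trace_bound S" and K: "m \<le> K"
  shows "(\<Sum>k=K-m..<K. (cmod (\<alpha> k) * cmod (l k (e k)) / cmod (l (k + m) (e (k + m))))\<^sup>2) \<le> S"
proof -
  define a where "a = (\<lambda>k j. (cmod (L2_inner \<Omega> (\<lambda>z. \<phi> z * e k z) (e j)))\<^sup>2)"
  have "(\<Sum>k=K-m..<K. (cmod (\<alpha> k) * cmod (l k (e k)) / cmod (l (k + m) (e (k + m))))\<^sup>2) = (\<Sum>k=K-m..<K. a k (k + m))"
    unfolding a_def inner_symbol_shift by (simp add: norm_mult norm_divide)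
  \<comment> \<open>For the last \<open>m\<close> indices \<open>k\<close> below \<open>K\<close>
    the index \<open>k + m\<close> lies in \<open>{K..<K+m}\<close>, so one entry per row is
    kept.\<close>
  also have "\<dots> \<le> (\<Sum>k=K-m..<K. \<Sum>j=K..<K+m. a k j)"
    by (intro sum_mono member_le_sum) (auto simp: a_def)
  also have "\<dots> \<le> (\<Sum>k<K. \<Sum>j=K..<K+m. a k j)"
    by (intro sum_mono2) (auto simp: a_def intro!: sum_nonneg)
  also have "\<dots> = (\<Sum>k<K. (\<Sum>j<K+m. a k j) - (\<Sum>j<K. a k j))"
  proof (rule sum.cong)
    have "{..<K + m} = {..<K} \<union> {K..<K+m}" by auto
    then show "(\<Sum>j=K..<K+m. a k j) = (\<Sum>j<K+m. a k j) - (\<Sum>j<K. a k j)" for k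
      by (simp add: sum.union_disjoint ivl_disj_int)
  qed simp
  \<comment> \<open>Transposing the square block of indices below \<open>K\<close> turns subtracted
    row sums into column sums without changing the total.\<close>
  also have "\<dots> = (\<Sum>k<K. \<Sum>j<K+m. a k j) - (\<Sum>k<K. \<Sum>j<K. a j k)"
    unfolding sum_subtractf by (subst (3) sum.swap) simp
  also have "\<dots> = (\<Sum>k<K. (\<Sum>j<K+m. a k j) - (\<Sum>j<K. a j k))"
    by (simp add: sum_subtractf)
  \<comment> \<open>The subtracted column sums must not fall below the adjoint norms; here the exact
    finite Parseval identity enters. For the row sums Bessel suffices.\<close>
  also have "\<dots> \<le> (\<Sum>k<K. (L2_norm \<Omega> (H (e k)))\<^sup>2)"
  proof (rule sum_mono)
    fix k assume "k \<in> {..<K}"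
    then have "(\<Sum>j<K. a j k) = (L2_norm \<Omega> (bergman_proj \<Omega> (\<lambda>z. cnj (\<phi> z) * e k z)))\<^sup>2"
      by (simp add: a_def norm_adjoint_e)
    moreover have "(\<Sum>j<K+m. a k j) \<le> (L2_norm \<Omega> (\<lambda>z. \<phi> z * e k z))\<^sup>2"
      unfolding a_def by (rule Bessel_inequality[OF orthonormal_e finite_lessThan symbol_mult_L2[OF e_L2]])
    ultimately show "(\<Sum>j<K+m. a k j) - (\<Sum>j<K. a j k) \<le> (L2_norm \<Omega> (H (e k)))\<^sup>2"
      using hankel_norm_power2[OF e_A2[of k]] by linarith
  qed
  also have "\<dots> \<le> S"
    using S unfolding trace_bound_def by (simp add: orthonormal_e e_A2)
  finally show ?thesis .
qed

lemma l_e_le: "(\<And>f. f \<in> A2 \<Omega> \<Longrightarrow> cmod (l k f) \<le> C * L2_norm \<Omega> f) \<Longrightarrow> cmod (l k (e k)) \<le> C"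
  using e_A2[of k] norm_e[of k] by fastforce

end

text \<open>Summing \<open>y \<ge> 1 + ln y\<close> over \<open>y = (c r b / c (r + 1) b)\<^sup>2 / \<rho>\<^sup>2\<close> telescopes in \<open>r\<close>.\<close>

lemma ratio_sum_lower_bound:
  fixes c :: "nat \<Rightarrow> nat \<Rightarrow> real"
  assumes pos: "\<And>r b. b < m \<Longrightarrow> c r b > 0" and \<rho>: "\<rho> > 0" and C: "C > 0"
    and le: "\<And>r b. b < m \<Longrightarrow> c r b \<le> C / \<rho> ^ r"
    and S: "\<And>r. (\<Sum>b<m. (c r b / c (Suc r) b)\<^sup>2) \<le> S"
  shows "real m * \<rho>\<^sup>2 \<le> S"
proof (rule ccontr)
  assume "\<not> real m * \<rho>\<^sup>2 \<le> S"
  then have "S / \<rho>\<^sup>2 < m" using \<rho> by (simp add: divide_less_eq)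
  \<comment> \<open>\<open>D\<close> bounds the negative of the telescoped logarithms for every
    \<open>R\<close>, because \<open>c R b * \<rho> ^ R \<le> C\<close>. As
    \<open>m - S / \<rho>\<^sup>2\<close> is positive by assumption, a large \<open>R\<close> is
    contradictory.\<close>
  define D where "D = (\<Sum>b<m. 2 * (ln C - ln (c 0 b)))"
  have bound: "real R * (m - S / \<rho>\<^sup>2) \<le> D" for R
  proof -
    have step: "real m + (\<Sum>b<m. 2 * ln (c r b * \<rho> ^ r) - 2 * ln (c (Suc r) b * \<rho> ^ Suc r)) \<le> S / \<rho>\<^sup>2" for r
    proof -
      have "1 + (2 * ln (c r b * \<rho> ^ r) - 2 * ln (c (Suc r) b * \<rho> ^ Suc r)) \<le> (c r b / c (Suc r) b)\<^sup>2 / \<rho>\<^sup>2"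
        if b: "b < m" for b
      proof -
        define y where "y = (c r b / c (Suc r) b)\<^sup>2 / \<rho>\<^sup>2"
        define p where "p = c r b * \<rho> ^ r"
        define q where "q = c (Suc r) b * \<rho> ^ Suc r"
        have pq: "p > 0" "q > 0" using pos[OF b] \<rho> by (simp_all add: p_def q_def)
        have "y = (p / q)\<^sup>2"
          using \<rho> by (simp add: y_def p_def q_def power_divide power_mult_distrib)
        then have "ln y = 2 * (ln p - ln q)"
          using pq by (simp add: ln_realpow ln_div)
        moreover have "ln y \<le> y - 1"
          using pos[OF b, of r] pos[OF b, of "Suc r"] \<rho> by (intro ln_le_minus_one) (simp add: y_def)
        ultimately show ?thesis by (simp add: y_def p_def q_def)
      qed
      then have "(\<Sum>b<m. 1 + (2 * ln (c r b * \<rho> ^ r) - 2 * ln (c (Suc r) b * \<rho> ^ Suc r))) \<le> (\<Sum>b<m. (c r b / c (Suc r) b)\<^sup>2 / \<rho>\<^sup>2)"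
        by (intro sum_mono) auto
      also have "\<dots> \<le> S / \<rho>\<^sup>2"
        unfolding sum_divide_distrib[symmetric] using S \<rho> by (intro divide_right_mono) auto
      finally show ?thesis by (simp add: sum.distrib)
    qed
    have "(\<Sum>r<R. real m + (\<Sum>b<m. 2 * ln (c r b * \<rho> ^ r) - 2 * ln (c (Suc r) b * \<rho> ^ Suc r))) \<le> (\<Sum>r<R. S / \<rho>\<^sup>2)"
      by (intro sum_mono step)
    moreover have "(\<Sum>r<R. \<Sum>b<m. 2 * ln (c r b * \<rho> ^ r) - 2 * ln (c (Suc r) b * \<rho> ^ Suc r)) =
      (\<Sum>b<m. 2 * ln (c 0 b) - 2 * ln (c R b * \<rho> ^ R))"
    proof -
      have "(\<Sum>r<R. 2 * ln (c r b * \<rho> ^ r) - 2 * ln (c (Suc r) b * \<rho> ^ Suc r)) = 2 * ln (c 0 b) - 2 * ln (c R b * \<rho> ^ R)" for b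
        using sum_lessThan_telescope'[of "\<lambda>r. 2 * ln (c r b * \<rho> ^ r)" R] by simp
      then show ?thesis
        by (subst sum.swap) (simp only:)
    qed
    moreover have "- D \<le> (\<Sum>b<m. 2 * ln (c 0 b) - 2 * ln (c R b * \<rho> ^ R))"
      unfolding D_def sum_negf[symmetric]
    proof (rule sum_mono)
      fix b assume "b \<in> {..<m}"
      then have b: "b < m" by simp
      have "c R b * \<rho> ^ R \<le> C" using le[OF b, of R] \<rho> by (simp add: field_simps)
      then have "ln (c R b * \<rho> ^ R) \<le> ln C"
        using pos[OF b, of R] \<rho> C by simp
      then show "- (2 * (ln C - ln (c 0 b))) \<le> 2 * ln (c 0 b) - 2 * ln (c R b * \<rho> ^ R)" by simp
    qed
    ultimately show ?thesis
      by (simp add: sum.distrib algebra_simps)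
  qed
  obtain R :: nat where "D / (m - S / \<rho>\<^sup>2) < R"
    using reals_Archimedean2 by blast
  with \<open>S / \<rho>\<^sup>2 < m\<close> have "D < R * (m - S / \<rho>\<^sup>2)"
    by (subst (asm) pos_divide_less_eq) auto
  with bound[of R] show False by simp
qed

section \<open>Taylor coefficients at points of a level set\<close>

text \<open>Derivatives are taken in direction \<open>i\<close>, while the
  \<open>j\<close>-coordinates separate the points. The radius \<open>2 * \<rho>\<close> gives the
  circle of radius \<open>\<rho>\<close> about \<open>q b\<close> a further margin
  \<open>\<rho>\<close> for the pointwise bound.\<close>

locale level_points = holomorphic_symbol \<Omega> \<phi> B for \<Omega> :: "(complex ^ 'n) set" and \<phi> B +
  fixes q :: "nat \<Rightarrow> complex ^ 'n" and m :: nat and i j :: 'n and \<rho> :: real and \<mu> :: complex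
    and d :: "nat \<Rightarrow> complex"
  assumes bounded_domain: "bounded \<Omega>"
    and m_positive: "m > 0"
    and ij: "i \<noteq> j"
    and \<rho>: "\<rho> > 0"
    and ball_q: "b < m \<Longrightarrow> ball (q b) (2 * \<rho>) \<subseteq> \<Omega>"
    and level: "b < m \<Longrightarrow> \<phi> (q b) = \<mu>"
    and separated: "b < m \<Longrightarrow> c < m \<Longrightarrow> b \<noteq> c \<Longrightarrow> q b $ j \<noteq> q c $ j"
    and deriv_symbol: "b < m \<Longrightarrow> ((\<lambda>s. \<phi> (q b + s *s axis i 1)) has_field_derivative d b) (at 0)"
    and d_nonzero: "b < m \<Longrightarrow> d b \<noteq> 0"
begin

definition slice :: "nat \<Rightarrow> (complex ^ 'n \<Rightarrow> complex) \<Rightarrow> complex \<Rightarrow> complex" where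
  "slice b f = (\<lambda>s. f (q b + s *s axis i 1))"

definition taylor :: "nat \<Rightarrow> (complex ^ 'n \<Rightarrow> complex) \<Rightarrow> nat \<Rightarrow> complex" where
  "taylor b f n = fps_nth (fps_expansion (slice b f) 0) n"

definition l :: "nat \<Rightarrow> (complex ^ 'n \<Rightarrow> complex) \<Rightarrow> complex" where
  "l k f = taylor (k mod m) f (k div m)"

text \<open>Along its slice the power vanishes to order exactly \<open>k div m\<close> at each
  point. The product is constant on slices, as \<open>z $ j\<close> does not vary in direction
  \<open>i\<close>, and is zero on those through the other points; so \<open>x k\<close> sees only
  the point with index \<open>k mod m\<close>.\<close>

definition x :: "nat \<Rightarrow> complex ^ 'n \<Rightarrow> complex" where
  "x k z = (\<phi> z - \<mu>) ^ (k div m) * (\<Prod>b\<in>{..<m} - {k mod m}. z $ j - q b $ j)"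

lemma mod_less [simp]: "k mod m < m"
  using m_positive by simp

lemma dist_slice: "dist (q b) (q b + s *s axis i 1) = cmod s"
  by (simp add: dist_norm norm_vector_scalar_mult)

lemma slice_holomorphic:
  assumes "holomorphic_Cn_on f \<Omega>" "b < m"
  shows "slice b f holomorphic_on ball 0 (2 * \<rho>)"
  unfolding slice_def
proof (rule holomorphic_Cn_slice[OF assms(1)])
  fix s assume "s \<in> ball (0 :: complex) (2 * \<rho>)"
  then have "q b + s *s axis i 1 \<in> ball (q b) (2 * \<rho>)"
    by (simp add: dist_slice)
  then show "q b + s *s axis i 1 \<in> \<Omega>" using ball_q[OF assms(2)] by blast
qed

lemma slice_fps:
  assumes "holomorphic_Cn_on f \<Omega>" "b < m"
  shows "slice b f has_fps_expansion fps_expansion (slice b f) 0"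
  by (rule has_fps_expansion_fps_expansion[OF _ _ slice_holomorphic[OF assms]]) (use \<rho> in auto)

lemma taylor_eqI: "slice b f has_fps_expansion F \<Longrightarrow> taylor b f n = fps_nth F n"
  by (simp add: taylor_def fps_expansion_eqI)

lemma taylor_diff:
  assumes "holomorphic_Cn_on f \<Omega>" "holomorphic_Cn_on g \<Omega>" "b < m"
  shows "taylor b (\<lambda>z. f z - g z) n = taylor b f n - taylor b g n"
proof -
  have "slice b (\<lambda>z. f z - g z) has_fps_expansion fps_expansion (slice b f) 0 - fps_expansion (slice b g) 0"
    using has_fps_expansion_diff[OF slice_fps[OF assms(1,3)] slice_fps[OF assms(2,3)]]
    by (simp add: slice_def)
  from taylor_eqI[OF this] show ?thesis by (simp add: taylor_def)
qed

lemma taylor_mult: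
  assumes "holomorphic_Cn_on f \<Omega>" "holomorphic_Cn_on g \<Omega>" "b < m"
  shows "taylor b (\<lambda>z. f z * g z) n = (\<Sum>c=0..n. taylor b f c * taylor b g (n - c))"
proof -
  have "slice b (\<lambda>z. f z * g z) has_fps_expansion fps_expansion (slice b f) 0 * fps_expansion (slice b g) 0"
    using has_fps_expansion_mult[OF slice_fps[OF assms(1,3)] slice_fps[OF assms(2,3)]]
    by (simp add: slice_def)
  from taylor_eqI[OF this] show ?thesis by (simp add: taylor_def fps_mult_nth)
qed

lemma taylor_scale:
  assumes "holomorphic_Cn_on f \<Omega>" "b < m"
  shows "taylor b (\<lambda>z. c * f z) n = c * taylor b f n"
proof -
  have "slice b (\<lambda>z. c * f z) has_fps_expansion fps_const c * fps_expansion (slice b f) 0"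
    using has_fps_expansion_cmult_left[OF slice_fps[OF assms]] by (simp add: slice_def)
  from taylor_eqI[OF this] show ?thesis by (simp add: taylor_def)
qed

text \<open>Cauchy's estimate on the circle of radius \<open>\<rho>\<close>. One \<open>C\<close>
  serves all points and orders, as the telescoping argument needs: the order enters only through the
  power of \<open>\<rho>\<close>.\<close>

lemma taylor_bound:
  "\<exists>C>0. \<forall>f\<in>A2 \<Omega>. \<forall>b<m. \<forall>n. cmod (taylor b f n) \<le> C / \<rho> ^ n * L2_norm \<Omega> f"
proof -
  obtain C where C: "C > 0" and
    bd: "\<And>\<Omega> f z. open \<Omega> \<Longrightarrow> f \<in> A2 (\<Omega> :: (complex ^ 'n) set) \<Longrightarrow> ball z \<rho> \<subseteq> \<Omega> \<Longrightarrow> cmod (f z) \<le> C * L2_norm \<Omega> f"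
    using A2_pointwise_bound[OF \<rho>] by blast
  have "cmod (taylor b f n) \<le> C / \<rho> ^ n * L2_norm \<Omega> f" if f: "f \<in> A2 \<Omega>" and b: "b < m" for f b n
  proof -
    have hol: "slice b f holomorphic_on ball 0 (2 * \<rho>)"
      by (rule slice_holomorphic[OF A2_holomorphic[OF f] b])
    have "cmod ((deriv ^^ n) (slice b f) 0) \<le> fact n * (C * L2_norm \<Omega> f) / \<rho> ^ n"
    proof (rule Cauchy_inequality)
      show "slice b f holomorphic_on ball 0 \<rho>"
        using \<rho> by (intro holomorphic_on_subset[OF hol]) auto
      show "continuous_on (cball 0 \<rho>) (slice b f)"
        using \<rho> by (intro continuous_on_subset[OF holomorphic_on_imp_continuous_on[OF hol]]) auto
      show "\<rho> > 0" by (rule \<rho>)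
      fix s assume s: "cmod (0 - s) = \<rho>"
      have "ball (q b + s *s axis i 1) \<rho> \<subseteq> ball (q b) (2 * \<rho>)"
      proof
        fix y assume "y \<in> ball (q b + s *s axis i 1) \<rho>"
        then show "y \<in> ball (q b) (2 * \<rho>)"
          using dist_slice[of b s] s dist_triangle[of "q b" y "q b + s *s axis i 1"] by simp
      qed
      then show "cmod (slice b f s) \<le> C * L2_norm \<Omega> f"
        unfolding slice_def using bd[OF open_domain f] ball_q[OF b] by blast
    qed
    then have "cmod ((deriv ^^ n) (slice b f) 0) / fact n \<le> C * L2_norm \<Omega> f / \<rho> ^ n"
      by (simp add: divide_le_eq mult.commute)
    then show ?thesis
      by (simp add: taylor_def fps_expansion_def norm_divide)
  qed
  with C show ?thesis
    by (intro exI[of _ C] conjI ballI allI impI)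
qed

lemma shifted_holomorphic: "holomorphic_Cn_on (\<lambda>z. \<phi> z - \<mu>) \<Omega>"
  by (intro holomorphic_Cn_diff symbol_holomorphic holomorphic_Cn_const)

lemma taylor_symbol_0: "b < m \<Longrightarrow> taylor b (\<lambda>z. \<phi> z - \<mu>) 0 = 0"
  by (simp add: taylor_def fps_expansion_def slice_def level)

lemma taylor_symbol_1:
  assumes "b < m"
  shows "taylor b (\<lambda>z. \<phi> z - \<mu>) (Suc 0) = d b"
proof -
  have "(slice b (\<lambda>z. \<phi> z - \<mu>) has_field_derivative d b - 0) (at 0)"
    unfolding slice_def by (intro derivative_intros deriv_symbol assms)
  then show ?thesis
    by (simp add: taylor_def fps_expansion_def DERIV_imp_deriv)
qed

lemma x_A2: "x k \<in> A2 \<Omega>"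
proof -
  obtain M where M: "\<And>z. z \<in> \<Omega> \<Longrightarrow> norm z \<le> M"
    using bounded_domain by (auto simp: bounded_iff)
  have qM: "norm (q b) \<le> M" if "b < m" for b
    using ball_q[OF that] \<rho> by (intro M) auto
  show ?thesis
  proof (rule A2_bounded_holomorphic[OF open_domain bounded_domain])
    show "holomorphic_Cn_on (x k) \<Omega>"
      unfolding x_def
      by (intro holomorphic_Cn_mult holomorphic_Cn_power shifted_holomorphic holomorphic_Cn_prod
          holomorphic_Cn_diff holomorphic_Cn_const holomorphic_Cn_component)
    fix z assume z: "z \<in> \<Omega>"
    show "cmod (x k z) \<le> (B + cmod \<mu>) ^ (k div m) * (\<Prod>b\<in>{..<m} - {k mod m}. 2 * M)"
      unfolding x_def norm_mult norm_power prod_norm[symmetric]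
    proof (intro mult_mono power_mono prod_mono conjI)
      show "cmod (\<phi> z - \<mu>) \<le> B + cmod \<mu>"
        using norm_triangle_ineq4[of "\<phi> z" \<mu>] symbol_bounded[OF z] by linarith
      show "cmod (z $ j - q b $ j) \<le> 2 * M" if "b \<in> {..<m} - {k mod m}" for b
      proof -
        have "cmod (z $ j - q b $ j) \<le> cmod (z $ j) + cmod (q b $ j)"
          by (rule norm_triangle_ineq4)
        also have "\<dots> \<le> norm z + norm (q b)"
          by (intro add_mono Finite_Cartesian_Product.norm_nth_le)
        also have "\<dots> \<le> 2 * M" using M[OF z] qM[of b] that by simp
        finally show ?thesis .
      qed
      show "0 \<le> (B + cmod \<mu>) ^ (k div m)"
        using symbol_bounded[OF z] norm_ge_zero[of "\<phi> z"] norm_ge_zero[of \<mu>]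
        by (intro zero_le_power) linarith
    qed (auto intro!: prod_nonneg)
  qed
qed

text \<open>Since \<open>i \<noteq> j\<close>, the product in \<open>x k\<close> is constant along
  the slice, which leaves a multiple of a power of one series.\<close>

lemma taylor_x:
  assumes "b < m"
  shows "taylor b (x k) n = fps_nth (fps_expansion (slice b (\<lambda>z. \<phi> z - \<mu>)) 0 ^ (k div m)) n *
    (\<Prod>c\<in>{..<m} - {k mod m}. q b $ j - q c $ j)"
proof -
  have eq: "slice b (x k) = (\<lambda>s. slice b (\<lambda>z. \<phi> z - \<mu>) s ^ (k div m) * (\<Prod>c\<in>{..<m} - {k mod m}. q b $ j - q c $ j))"
    using ij by (simp add: slice_def x_def axis_def fun_eq_iff)
  have "slice b (x k) has_fps_expansion
      fps_expansion (slice b (\<lambda>z. \<phi> z - \<mu>)) 0 ^ (k div m) * fps_const (\<Prod>c\<in>{..<m} - {k mod m}. q b $ j - q c $ j)"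
    unfolding eq
    by (intro has_fps_expansion_cmult_right has_fps_expansion_power slice_fps shifted_holomorphic assms)
  then show ?thesis by (simp add: taylor_eqI)
qed

sublocale flag \<Omega> \<phi> B l x m \<mu> "\<lambda>k. d (k mod m)"
proof
  show "l k (\<lambda>z. f z - g z) = l k f - l k g" if "f \<in> A2 \<Omega>" "g \<in> A2 \<Omega>" for f g k
    using that by (simp add: l_def taylor_diff A2_holomorphic)
  show "l k (\<lambda>z. c * f z) = c * l k f" if "f \<in> A2 \<Omega>" for f k c
    using that by (simp add: l_def taylor_scale A2_holomorphic)
  show "\<exists>C. \<forall>f\<in>A2 \<Omega>. cmod (l k f) \<le> C * L2_norm \<Omega> f" for k
  proof -
    from taylor_bound obtain C where "\<forall>f\<in>A2 \<Omega>. \<forall>b<m. \<forall>n. cmod (taylor b f n) \<le> C / \<rho> ^ n * L2_norm \<Omega> f"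
      by (elim exE conjE)
    then show ?thesis by (intro exI[of _ "C / \<rho> ^ (k div m)"]) (simp add: l_def)
  qed
  show "x k \<in> A2 \<Omega>" for k by (rule x_A2)
  have \<Psi>0: "fps_nth (fps_expansion (slice b (\<lambda>z. \<phi> z - \<mu>)) 0) 0 = 0" if "b < m" for b
    using taylor_symbol_0[OF that] by (simp add: taylor_def)
  have \<Psi>1: "fps_nth (fps_expansion (slice b (\<lambda>z. \<phi> z - \<mu>)) 0) 1 = d b" if "b < m" for b
    using taylor_symbol_1[OF that] by (simp add: taylor_def)
  \<comment> \<open>At the same point \<open>r < k\<close> means a lower order, where the power
    vanishes; at another point the product has a zero factor.\<close>
  show "l r (x k) = 0" if "r < k" for r k
  proof (cases "r mod m = k mod m")
    case True
    have "r div m < k div m"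
    proof (rule ccontr)
      assume "\<not> r div m < k div m"
      moreover have "r div m \<le> k div m"
        using \<open>r < k\<close> by (intro div_le_mono) simp
      ultimately have eq: "r div m = k div m" by simp
      have "r = r div m * m + r mod m"
        by (rule div_mult_mod_eq[symmetric])
      also have "\<dots> = k"
        unfolding eq True by (rule div_mult_mod_eq)
      finally have "r = k" .
      with \<open>r < k\<close> show False by simp
    qed
    then have "fps_nth (fps_expansion (slice (r mod m) (\<lambda>z. \<phi> z - \<mu>)) 0 ^ (k div m)) (r div m) = 0"
      by (rule startsby_zero_power_prefix[OF \<Psi>0[OF mod_less], rule_format])
    then show ?thesis by (simp add: l_def taylor_x)
  next
    case False
    then have "(\<Prod>c\<in>{..<m} - {k mod m}. q (r mod m) $ j - q c $ j) = 0"
      by (intro prod_zero bexI[of _ "r mod m"]) auto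
    then show ?thesis by (simp add: l_def taylor_x)
  qed
  show "l k (x k) \<noteq> 0" for k
  proof -
    have "fps_nth (fps_expansion (slice (k mod m) (\<lambda>z. \<phi> z - \<mu>)) 0 ^ (k div m)) (k div m) = d (k mod m) ^ (k div m)"
      using startsby_zero_power_nth_same[OF \<Psi>0[OF mod_less]] \<Psi>1[OF mod_less] by simp
    moreover have "(\<Prod>c\<in>{..<m} - {k mod m}. q (k mod m) $ j - q c $ j) \<noteq> 0"
      using separated[of "k mod m"] by (auto simp: prod_zero_iff)
    ultimately show ?thesis by (simp add: l_def taylor_x d_nonzero)
  qed
  show "m > 0" by (rule m_positive)
  fix f k
  assume f: "f \<in> A2 \<Omega>" and zero: "\<And>r. r < k \<Longrightarrow> l r f = 0"
  have tz: "taylor b f c = 0" if "b < m" "c * m + b < k" for b c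
    using zero[OF that(2)] that(1) by (simp add: l_def)
  have expand: "l r (\<lambda>z. (\<phi> z - \<mu>) * f z) =
      (\<Sum>c=0..r div m. taylor (r mod m) (\<lambda>z. \<phi> z - \<mu>) c * taylor (r mod m) f (r div m - c))" for r
    unfolding l_def by (intro taylor_mult shifted_holomorphic A2_holomorphic f mod_less)
  \<comment> \<open>The coefficient of order \<open>r div m - c\<close> at the point
    \<open>r mod m\<close> has flag index \<open>r - c * m\<close>. For \<open>c \<ge> 1\<close> and
    \<open>r < k + m\<close> this is below \<open>k\<close>, so \<open>f\<close> contributes zero;
    for \<open>c = 0\<close> the factor \<open>\<phi> - \<mu>\<close> does.\<close>
  have index: "(r div m - c) * m + r mod m + c * m = r" if "c \<le> r div m" for r c
  proof -
    have "(r div m - c) * m + c * m = r div m * m"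
      using that by (simp add: add_mult_distrib[symmetric])
    then show ?thesis
      using div_mult_mod_eq[of r m] by linarith
  qed
  show "l r (\<lambda>z. (\<phi> z - \<mu>) * f z) = 0" if r: "r < k + m" for r
    unfolding expand
  proof (intro sum.neutral ballI)
    fix c assume c: "c \<in> {0..r div m}"
    show "taylor (r mod m) (\<lambda>z. \<phi> z - \<mu>) c * taylor (r mod m) f (r div m - c) = 0"
    proof (cases c)
      case 0
      then show ?thesis by (simp add: taylor_symbol_0)
    next
      case (Suc c')
      then have "(r div m - c) * m + r mod m < k"
        using index[of c r] c r by simp
      then show ?thesis by (simp add: tz)
    qed
  qed
  show "l (k + m) (\<lambda>z. (\<phi> z - \<mu>) * f z) = d (k mod m) * l k f"
  proof -
    \<comment> \<open>For index \<open>k + m\<close> the term \<open>c = 1\<close> has flag index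
      exactly \<open>k\<close> and survives; larger \<open>c\<close> fall below
      \<open>k\<close>.\<close>
    have "taylor (k mod m) (\<lambda>z. \<phi> z - \<mu>) c * taylor (k mod m) f (Suc (k div m) - c) = 0"
      if c: "c \<in> {0..Suc (k div m)} - {Suc 0}" for c
    proof (cases c)
      case 0
      then show ?thesis by (simp add: taylor_symbol_0)
    next
      case (Suc c')
      with c obtain c'' where c'': "c' = Suc c''" by (cases c') auto
      have "(Suc (k div m) - c) * m + k mod m < k"
        using index[of c "k + m"] c m_positive by (simp add: Suc c'')
      then show ?thesis by (simp add: tz)
    qed
    then have "(\<Sum>c\<in>{0..Suc (k div m)} - {Suc 0}. taylor (k mod m) (\<lambda>z. \<phi> z - \<mu>) c * taylor (k mod m) f (Suc (k div m) - c)) = 0"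
      by (rule sum.neutral[OF ballI])
    then have "(\<Sum>c=0..Suc (k div m). taylor (k mod m) (\<lambda>z. \<phi> z - \<mu>) c * taylor (k mod m) f (Suc (k div m) - c)) =
      taylor (k mod m) (\<lambda>z. \<phi> z - \<mu>) (Suc 0) * taylor (k mod m) f (k div m)"
      by (subst sum.remove[of _ "Suc 0"]) auto
    then show ?thesis
      using m_positive by (simp add: expand taylor_symbol_1 l_def)
  qed
qed

text \<open>Taking \<open>K = m + r * m\<close> in the trace inequality selects precisely the
  coefficients of order \<open>r\<close> at all \<open>m\<close> points, so its left side is the sum
  of squared ratios to which the logarithmic estimate applies.\<close>

theorem trace_bound_lower:
  assumes S: "trace_bound S" and \<alpha>: "\<alpha> > 0" and d: "\<And>b. b < m \<Longrightarrow> \<alpha> \<le> cmod (d b)"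
  shows "real m * \<rho>\<^sup>2 \<le> S / \<alpha>\<^sup>2"
proof -
  from taylor_bound obtain C where C: "C > 0" and tb: "\<forall>f\<in>A2 \<Omega>. \<forall>b<m. \<forall>n. cmod (taylor b f n) \<le> C / \<rho> ^ n * L2_norm \<Omega> f"
    by (elim exE conjE)
  define c where "c = (\<lambda>r b. cmod (l (r * m + b) (e (r * m + b))))"
  show ?thesis
  proof (rule ratio_sum_lower_bound)
    show "c r b > 0" for r b by (simp add: c_def l_e_nonzero)
    show "\<rho> > 0" "C > 0" by (rule \<rho> C)+
    show "c r b \<le> C / \<rho> ^ r" if b: "b < m" for r b
      unfolding c_def using tb b by (intro l_e_le) (simp add: l_def)
    fix r
    have "(\<Sum>b<m. (c r b / c (Suc r) b)\<^sup>2) * \<alpha>\<^sup>2 = (\<Sum>b<m. (\<alpha> * (c r b / c (Suc r) b))\<^sup>2)"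
      unfolding power_mult_distrib sum_distrib_right by (simp add: mult.commute)
    also have "\<dots> \<le> (\<Sum>b<m. (cmod (d b) * (c r b / c (Suc r) b))\<^sup>2)"
      using d \<alpha> by (intro sum_mono power_mono mult_right_mono) (auto simp: c_def)
    also have "\<dots> = (\<Sum>b=0..<m. (cmod (d ((b + r * m) mod m)) * cmod (l (b + r * m) (e (b + r * m))) /
        cmod (l (b + r * m + m) (e (b + r * m + m))))\<^sup>2)"
      unfolding lessThan_atLeast0 by (intro sum.cong refl) (simp add: c_def add.commute add.left_commute)
    also have "\<dots> = (\<Sum>k=0+r*m..<m+r*m. (cmod (d (k mod m)) * cmod (l k (e k)) / cmod (l (k + m) (e (k + m))))\<^sup>2)"
      by (rule sum.shift_bounds_nat_ivl[symmetric])
    also have "\<dots> \<le> S"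
      using trace_lower_bound[OF S, of "m + r * m"] by simp
    finally show "(\<Sum>b<m. (c r b / c (Suc r) b)\<^sup>2) \<le> S / \<alpha>\<^sup>2"
      using \<alpha> by (simp add: le_divide_eq)
  qed
qed

end

section \<open>The main theorem\<close>

text \<open>An argument of Hurwitz type: without a zero, \<open>1 / G\<close> would be holomorphic,
  of modulus above \<open>2 / \<mu>\<close> at the centre, where \<open>G\<close> is close to
  \<open>F 0 = 0\<close>, and at most \<open>2 / \<mu>\<close> on the circle, against the maximum
  principle.\<close>

lemma zero_near_perturbed:
  fixes F G :: "complex \<Rightarrow> complex"
  assumes "\<delta> > 0" and F: "continuous_on (cball 0 \<delta>) F" "F 0 = 0" "\<And>s. cmod s = \<delta> \<Longrightarrow> \<mu> \<le> cmod (F s)"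
    and G: "G holomorphic_on cball 0 \<delta>" and "\<mu> > 0"
    and close: "\<And>s. cmod s \<le> \<delta> \<Longrightarrow> cmod (G s - F s) < \<mu> / 2"
  shows "\<exists>s. cmod s \<le> \<delta> \<and> G s = 0"
proof (rule ccontr)
  assume "\<not> (\<exists>s. cmod s \<le> \<delta> \<and> G s = 0)"
  then have nz: "\<And>s. cmod s \<le> \<delta> \<Longrightarrow> G s \<noteq> 0" by blast
  have hol: "(\<lambda>s. inverse (G s)) holomorphic_on cball 0 \<delta>"
    using G nz by (intro holomorphic_intros) auto
  have "cmod (inverse (G 0)) \<le> 2 / \<mu>"
  proof (rule maximum_modulus_frontier[where S="cball 0 \<delta>" and f="\<lambda>s. inverse (G s)"])
    show "(\<lambda>s. inverse (G s)) holomorphic_on interior (cball 0 \<delta>)"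
      by (rule holomorphic_on_subset[OF hol interior_subset])
    show "continuous_on (closure (cball 0 \<delta>)) (\<lambda>s. inverse (G s))"
      using holomorphic_on_imp_continuous_on[OF hol] by simp
    fix s :: complex assume "s \<in> frontier (cball 0 \<delta>)"
    then have s: "cmod s = \<delta>" using \<open>\<delta> > 0\<close> by simp
    have "\<mu> \<le> cmod (F s)" by (rule F(3)[OF s])
    also have "\<dots> \<le> cmod (G s) + cmod (G s - F s)"
      using norm_triangle_ineq4[of "G s" "G s - F s"] by simp
    finally have "\<mu> / 2 \<le> cmod (G s)" using close[of s] s by simp
    then have "inverse (cmod (G s)) \<le> inverse (\<mu> / 2)"
      using \<open>\<mu> > 0\<close> by (intro le_imp_inverse_le) auto
    then show "cmod (inverse (G s)) \<le> 2 / \<mu>" by (simp add: norm_inverse)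
  qed (use \<open>\<delta> > 0\<close> in auto)
  moreover have "cmod (G 0) < \<mu> / 2" "cmod (G 0) > 0"
    using close[of 0] nz[of 0] \<open>\<delta> > 0\<close> F(2) by auto
  then have "inverse (\<mu> / 2) < inverse (cmod (G 0))"
    using \<open>\<mu> > 0\<close> by (intro less_imp_inverse_less) auto
  then have "2 / \<mu> < cmod (inverse (G 0))" by (simp add: norm_inverse)
  ultimately show False by simp
qed

text \<open>This takes the place of the implicit function theorem. The nonzero derivative makes
  \<open>s = 0\<close> an isolated zero of \<open>\<phi> - \<phi> p\<close> in direction
  \<open>i\<close>, and a zero persists when the line is moved by a small \<open>t\<close> in
  direction \<open>j\<close>. One \<open>s\<close> for each \<open>t\<close> is enough: later
  \<open>i \<noteq> j\<close> makes distinct \<open>t\<close> give distinct points.\<close>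

lemma level_set_transversal:
  fixes p :: "complex ^ 'n"
  assumes hol: "holomorphic_Cn_on \<phi> \<Omega>" and R: "R > 0" "cball p R \<subseteq> \<Omega>"
    and der: "((\<lambda>s. \<phi> (p + s *s axis i 1)) has_field_derivative a) (at 0)" and "a \<noteq> 0"
  obtains \<tau> where "\<tau> > 0"
    "\<And>t. 0 \<le> t \<Longrightarrow> t < \<tau> \<Longrightarrow> \<exists>s. dist p (p + of_real t *s axis j 1 + s *s axis i 1) \<le> R \<and>
      \<phi> (p + of_real t *s axis j 1 + s *s axis i 1) = \<phi> p"
proof -
  define F where "F = (\<lambda>t s. \<phi> (p + of_real t *s axis j 1 + s *s axis i 1) - \<phi> p)" for t :: real and s :: complex
  have norm_le: "norm (of_real t *s axis j 1 + s *s axis i 1 :: complex ^ 'n) \<le> \<bar>t\<bar> + cmod s" for t :: real and s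
    using norm_triangle_ineq[of "of_real t *s axis j 1 :: complex ^ 'n" "s *s axis i 1"]
    by (simp add: norm_vector_scalar_mult)
  have "((\<lambda>s. (\<phi> (p + s *s axis i 1) - \<phi> p) / s) \<longlongrightarrow> a) (at 0)"
    using der by (simp add: DERIV_def)
  then have "\<forall>\<^sub>F s in at 0. (\<phi> (p + s *s axis i 1) - \<phi> p) / s \<noteq> 0"
    using \<open>a \<noteq> 0\<close> by (rule tendsto_imp_eventually_ne)
  then obtain \<delta>0 where \<delta>0: "\<delta>0 > 0" "\<And>s. s \<noteq> 0 \<Longrightarrow> cmod s < \<delta>0 \<Longrightarrow> (\<phi> (p + s *s axis i 1) - \<phi> p) / s \<noteq> 0"
    unfolding eventually_at by (auto simp: dist_norm)
  \<comment> \<open>Below \<open>\<delta>0\<close> the circle carries no zero of \<open>F 0\<close>;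
    at most \<open>R / 2\<close> leaves room in \<open>cball p R\<close> for a shift
    \<open>t\<close> of the same size.\<close>
  define \<delta> where "\<delta> = min (\<delta>0 / 2) (R / 2)"
  have \<delta>: "\<delta> > 0" "\<delta> < \<delta>0" "\<delta> \<le> R / 2" using \<delta>0(1) R(1) by (auto simp: \<delta>_def)
  have inR: "p + of_real t *s axis j 1 + s *s axis i 1 \<in> cball p R" if "\<bar>t\<bar> \<le> R / 2" "cmod s \<le> \<delta>" for t :: real and s
  proof -
    have eq: "dist p (p + w) = norm w" for w :: "complex ^ 'n"
      by (simp add: dist_norm)
    show ?thesis
      unfolding mem_cball add.assoc eq using norm_le[of t s] that \<delta>(3) by linarith
  qed
  have Fhol: "F t holomorphic_on cball 0 \<delta>" if "\<bar>t\<bar> \<le> R / 2" for t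
  proof -
    have "(\<lambda>s. \<phi> ((p + of_real t *s axis j 1) + s *s axis i 1)) holomorphic_on cball 0 \<delta>"
      by (rule holomorphic_Cn_slice[OF hol]) (use inR[OF that] R(2) in auto)
    then show ?thesis unfolding F_def by (intro holomorphic_intros)
  qed
  have F0: "continuous_on (cball 0 \<delta>) (F 0)"
    using Fhol[of 0] R(1) by (intro holomorphic_on_imp_continuous_on) auto
  have "continuous_on (sphere 0 \<delta>) (\<lambda>s. cmod (F 0 s))"
    by (intro continuous_intros continuous_on_subset[OF F0]) auto
  moreover have "sphere (0 :: complex) \<delta> \<noteq> {}"
    using \<delta>(1) by simp
  ultimately obtain s0 where s0: "s0 \<in> sphere 0 \<delta>" "\<And>s. s \<in> sphere 0 \<delta> \<Longrightarrow> cmod (F 0 s0) \<le> cmod (F 0 s)"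
    using continuous_attains_inf[OF compact_sphere] by blast
  define \<mu> where "\<mu> = cmod (F 0 s0)"
  have "F 0 s0 \<noteq> 0"
  proof -
    have "s0 \<noteq> 0" "cmod s0 < \<delta>0" using s0(1) \<delta> by auto
    from \<delta>0(2)[OF this] show ?thesis by (auto simp: F_def)
  qed
  then have \<mu>: "\<mu> > 0" by (simp add: \<mu>_def)
  have "uniformly_continuous_on (cball p R) \<phi>"
    by (intro compact_uniformly_continuous continuous_on_subset[OF holomorphic_Cn_continuous_on[OF hol] R(2)]) simp
  then obtain \<eta> where \<eta>: "\<eta> > 0" "\<And>z w. z \<in> cball p R \<Longrightarrow> w \<in> cball p R \<Longrightarrow> dist w z < \<eta> \<Longrightarrow> dist (\<phi> w) (\<phi> z) < \<mu> / 2"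
    unfolding uniformly_continuous_on_def using \<mu> by (metis half_gt_zero)
  show ?thesis
  proof
    show "min \<eta> (R / 2) > 0" using \<eta> R by simp
    fix t :: real assume t: "0 \<le> t" "t < min \<eta> (R / 2)"
    have tR: "\<bar>t\<bar> \<le> R / 2" using t by simp
    have "\<exists>s. cmod s \<le> \<delta> \<and> F t s = 0"
    proof (rule zero_near_perturbed[OF \<delta>(1) F0 _ _ Fhol[OF tR] \<mu>])
      show "F 0 0 = 0" by (simp add: F_def)
      show "\<mu> \<le> cmod (F 0 s)" if "cmod s = \<delta>" for s
        unfolding \<mu>_def using that by (intro s0(2)) simp
      fix s assume s: "cmod s \<le> \<delta>"
      have "dist (p + of_real t *s axis j 1 + s *s axis i 1) (p + of_real 0 *s axis j 1 + s *s axis i 1) = t"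
        using t by (simp add: dist_norm norm_vector_scalar_mult)
      then have "dist (\<phi> (p + of_real t *s axis j 1 + s *s axis i 1)) (\<phi> (p + of_real 0 *s axis j 1 + s *s axis i 1)) < \<mu> / 2"
        using t R(1) by (intro \<eta>(2) inR s) auto
      then show "cmod (F t s - F 0 s) < \<mu> / 2"
        by (simp add: F_def dist_norm)
    qed
    then obtain s where "cmod s \<le> \<delta>" "F t s = 0" by blast
    then show "\<exists>s. dist p (p + of_real t *s axis j 1 + s *s axis i 1) \<le> R \<and>
      \<phi> (p + of_real t *s axis j 1 + s *s axis i 1) = \<phi> p"
      using inR[OF tR, of s] by (intro exI[of _ s]) (simp add: F_def)
  qed
qed

text \<open>\<open>\<rho>\<close> and \<open>\<alpha>\<close> depend only on a neighbourhood of
  \<open>p\<close>, while \<open>m\<close> is arbitrary, so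
  \<open>m * \<rho>\<^sup>2 \<le> S / \<alpha>\<^sup>2\<close> must fail for large
  \<open>m\<close>.\<close>

lemma nonconstant_not_trace_bound:
  fixes \<Omega> :: "(complex ^ 'n) set"
  assumes symbol: "holomorphic_symbol \<Omega> \<phi> B" and bounded: "bounded \<Omega>"
    and ij: "i \<noteq> j" and p: "p \<in> \<Omega>" and D: "isCont D p" "D p \<noteq> 0"
    and der: "\<And>z. z \<in> \<Omega> \<Longrightarrow> ((\<lambda>s. \<phi> (z + s *s axis i 1)) has_field_derivative D z) (at 0)"
  shows "\<not> holomorphic_symbol.trace_bound \<Omega> \<phi> S"
proof
  assume S: "holomorphic_symbol.trace_bound \<Omega> \<phi> S"
  interpret holomorphic_symbol \<Omega> \<phi> B by (rule symbol)
  obtain R0 where R0: "R0 > 0" "ball p R0 \<subseteq> \<Omega>"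
    using open_domain p by (meson openE)
  define \<alpha> where "\<alpha> = cmod (D p) / 2"
  have \<alpha>: "\<alpha> > 0" using D(2) by (simp add: \<alpha>_def)
  have "\<forall>\<^sub>F z in nhds p. \<alpha> < cmod (D z)"
    using D(1) \<alpha> unfolding isCont_def tendsto_at_iff_tendsto_nhds
    by (intro order_tendstoD(1)[OF tendsto_norm]) (auto simp: \<alpha>_def)
  then obtain R1 where R1: "R1 > 0" "\<And>z. dist z p < R1 \<Longrightarrow> \<alpha> < cmod (D z)"
    unfolding eventually_nhds_metric by blast
  \<comment> \<open>The points will lie within \<open>\<rho>\<close> of \<open>p\<close> and their
    balls of radius \<open>2 * \<rho>\<close> within \<open>3 * \<rho>\<close>; a quarter of the
    smaller radius serves both the domain and the derivative bound.\<close>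
  define \<rho> where "\<rho> = min R0 R1 / 4"
  have \<rho>: "\<rho> > 0" "4 * \<rho> \<le> R0" "4 * \<rho> \<le> R1" using R0 R1 by (auto simp: \<rho>_def)
  have "cball p \<rho> \<subseteq> \<Omega>" using R0(2) \<rho> by (auto simp: subset_iff)
  then obtain \<tau> where \<tau>: "\<tau> > 0"
    "\<And>t. 0 \<le> t \<Longrightarrow> t < \<tau> \<Longrightarrow> \<exists>s. dist p (p + of_real t *s axis j 1 + s *s axis i 1) \<le> \<rho> \<and>
      \<phi> (p + of_real t *s axis j 1 + s *s axis i 1) = \<phi> p"
    using level_set_transversal[OF symbol_holomorphic \<rho>(1) _ der[OF p] D(2)] by metis
  \<comment> \<open>Distinct parameters below \<open>\<tau>\<close>; with \<open>b + 1\<close> in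
    the denominator the first would equal \<open>\<tau>\<close>.\<close>
  define t where "t = (\<lambda>b::nat. \<tau> / (real b + 2))"
  have t: "0 \<le> t b" "t b < \<tau>" for b
    using \<tau>(1) by (auto simp: t_def field_simps add_pos_nonneg)
  define s where "s = (\<lambda>b. SOME s. dist p (p + of_real (t b) *s axis j 1 + s *s axis i 1) \<le> \<rho> \<and>
      \<phi> (p + of_real (t b) *s axis j 1 + s *s axis i 1) = \<phi> p)"
  define q where "q = (\<lambda>b. p + of_real (t b) *s axis j 1 + s b *s axis i 1)"
  have q: "dist p (q b) \<le> \<rho> \<and> \<phi> (q b) = \<phi> p" for b
    unfolding q_def s_def by (rule someI_ex[OF \<tau>(2)[OF t]])
  have qball: "ball (q b) (2 * \<rho>) \<subseteq> \<Omega>" for b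
  proof
    fix y assume "y \<in> ball (q b) (2 * \<rho>)"
    then have "dist p y < R0"
      using q[of b] dist_triangle[of p y "q b"] \<rho> by simp
    then show "y \<in> \<Omega>" using R0(2) by auto
  qed
  have q\<Omega>: "q b \<in> \<Omega>" for b
    using qball[of b] \<rho>(1) by auto
  have Dq: "\<alpha> \<le> cmod (D (q b))" for b
    using R1(2)[of "q b"] q[of b] \<rho> by (simp add: dist_commute)
  have sep: "q b $ j \<noteq> q c $ j" if "b \<noteq> c" for b c
  proof -
    have "q b $ j = p $ j + of_real (t b)" for b
      using ij by (simp add: q_def axis_def)
    moreover have "t b \<noteq> t c" using that \<tau>(1) by (simp add: t_def field_simps)
    ultimately show ?thesis by simp
  qed
  have bound: "real m * \<rho>\<^sup>2 \<le> S / \<alpha>\<^sup>2" if "m > 0" for m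
  proof -
    interpret level_points \<Omega> \<phi> B q m i j \<rho> "\<phi> p" "\<lambda>b. D (q b)"
    proof
      show "D (q b) \<noteq> 0" for b using Dq[of b] \<alpha> by auto
    qed (use bounded that ij \<rho>(1) qball q sep der[OF q\<Omega>] in auto)
    show ?thesis by (rule trace_bound_lower[OF S \<alpha> Dq])
  qed
  obtain m :: nat where "S / \<alpha>\<^sup>2 / \<rho>\<^sup>2 < m"
    using reals_Archimedean2 by blast
  then have "S / \<alpha>\<^sup>2 < real m * \<rho>\<^sup>2"
    using \<rho>(1) by (subst (asm) pos_divide_less_eq) simp_all
  also have "\<dots> \<le> real (Suc m) * \<rho>\<^sup>2"
    by (intro mult_right_mono) auto
  finally have "S / \<alpha>\<^sup>2 < real (Suc m) * \<rho>\<^sup>2" .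
  with bound[of "Suc m"] show False by simp
qed

section \<open>Constant symbols\<close>

text \<open>The Hilbert-Schmidt condition asks for some basis, so even a zero operator requires one.
  Zorn's lemma gives a maximal orthonormal set; a function orthogonal to it with nonzero norm could
  be normalised and adjoined.\<close>

lemma orthonormal_basis_exists:
  obtains E where "orthonormal_basis_A2 \<Omega> E"
proof -
  define \<A> where "\<A> = {E. E \<subseteq> A2 \<Omega> \<and> (\<forall>e\<in>E. \<forall>e'\<in>E. L2_inner \<Omega> e e' = (if e = e' then 1 else 0))}"
  have "\<exists>M\<in>\<A>. \<forall>X\<in>\<A>. M \<subseteq> X \<longrightarrow> X = M"
  proof (rule subset_Zorn')
    fix C assume C: "subset.chain \<A> C"
    have "L2_inner \<Omega> e e' = (if e = e' then 1 else 0)" if e: "e \<in> \<Union>C" "e' \<in> \<Union>C" for e e'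
    proof -
      from e obtain X Y where XY: "X \<in> C" "Y \<in> C" "e \<in> X" "e' \<in> Y" by blast
      then have "X \<subseteq> Y \<or> Y \<subseteq> X" using C by (auto simp: subset_chain_def)
      then obtain Z where "Z \<in> C" "e \<in> Z" "e' \<in> Z" using XY by blast
      moreover have "Z \<in> \<A>" using C \<open>Z \<in> C\<close> by (auto simp: subset_chain_def)
      ultimately show ?thesis by (simp add: \<A>_def)
    qed
    moreover have "\<Union>C \<subseteq> A2 \<Omega>" using C by (auto simp: subset_chain_def \<A>_def)
    ultimately show "\<Union>C \<in> \<A>" unfolding \<A>_def by blast
  qed
  then obtain E where E: "E \<in> \<A>" and max: "\<And>X. X \<in> \<A> \<Longrightarrow> E \<subseteq> X \<Longrightarrow> X = E" by blast
  have EA: "E \<subseteq> A2 \<Omega>" and Eo: "\<And>e e'. e \<in> E \<Longrightarrow> e' \<in> E \<Longrightarrow> L2_inner \<Omega> e e' = (if e = e' then 1 else 0)"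
    using E by (auto simp: \<A>_def)
  have "L2_norm \<Omega> f = 0" if f: "f \<in> A2 \<Omega>" and orth: "\<And>e. e \<in> E \<Longrightarrow> L2_inner \<Omega> f e = 0" for f
  proof (rule ccontr)
    assume n: "L2_norm \<Omega> f \<noteq> 0"
    define g where "g = (\<lambda>z. of_real (1 / L2_norm \<Omega> f) * f z)"
    have g1: "L2_inner \<Omega> g g = 1"
      unfolding g_def L2_inner_scale_left L2_inner_scale_right L2_inner_self
      using n by (simp add: power2_eq_square)
    have ge: "L2_inner \<Omega> g e = 0" if "e \<in> E" for e
      unfolding g_def L2_inner_scale_left orth[OF that] by simp
    have eg: "L2_inner \<Omega> e g = 0" if "e \<in> E" for e
      by (subst L2_inner_commute) (simp add: ge[OF that])
    have gE: "g \<notin> E" using ge g1 by fastforce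
    have gA: "g \<in> A2 \<Omega>" unfolding g_def by (rule A2_scale[OF f])
    have "L2_inner \<Omega> a b = (if a = b then 1 else 0)" if "a \<in> insert g E" "b \<in> insert g E" for a b
    proof (cases "a = g"; cases "b = g")
      assume "a \<noteq> g" "b \<noteq> g"
      then show ?thesis using that Eo by blast
    qed (use that gE g1 ge eg in auto)
    then have "insert g E \<in> \<A>" using gA EA by (simp add: \<A>_def)
    from max[OF this] gE show False by blast
  qed
  then have "orthonormal_basis_A2 \<Omega> E"
    using EA Eo unfolding orthonormal_basis_A2_def by simp
  then show ?thesis by (rule that)
qed

text \<open>On \<open>\<Omega>\<close> the function \<open>H f\<close> agrees with some
  \<open>h\<close> in \<open>A2 \<Omega>\<close>, and it is orthogonal to
  \<open>A2 \<Omega>\<close>; being orthogonal to itself, it has norm zero. The detour through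
  \<open>h\<close> is due to \<open>\<phi>\<close> being constant only on
  \<open>\<Omega>\<close>.\<close>

lemma (in holomorphic_symbol) constant_hilbert_schmidt:
  assumes c: "\<And>z. z \<in> \<Omega> \<Longrightarrow> \<phi> z = c"
  shows "hilbert_schmidt_A2 \<Omega> H"
proof -
  have zero: "L2_norm \<Omega> (H f) = 0" if f: "f \<in> A2 \<Omega>" for f
  proof -
    define w where "w = (\<lambda>z. cnj (\<phi> z) * f z)"
    have w: "w \<in> L2 \<Omega>" unfolding w_def by (rule cnj_symbol_mult_L2[OF A2_L2[OF f]])
    define h where "h = (\<lambda>z. cnj c * f z - bergman_proj \<Omega> w z)"
    have h: "h \<in> A2 \<Omega>"
      unfolding h_def by (intro A2_diff A2_scale f bergman_proj_A2 open_domain w)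
    have eq: "H f z = h z" if "z \<in> \<Omega>" for z
      using c[OF that] by (simp add: hankel_def h_def w_def)
    have "L2_inner \<Omega> (H f) h = 0"
      using bergman_proj_orthogonal[OF open_domain w h] by (simp add: hankel_def w_def)
    moreover have "L2_inner \<Omega> (H f) h = L2_inner \<Omega> h h"
      unfolding L2_inner_def by (intro Bochner_Integration.integral_cong) (auto simp: space_restrict_space eq)
    ultimately have "L2_norm \<Omega> h = 0" by (simp add: L2_inner_self)
    moreover have "L2_norm \<Omega> (H f) = L2_norm \<Omega> h"
      unfolding L2_norm_def by (intro arg_cong[where f=sqrt] Bochner_Integration.integral_cong) (auto simp: space_restrict_space eq)
    ultimately show ?thesis by simp
  qed
  have AE0: "AE z in lebesgue_on \<Omega>. H f z = 0" if "f \<in> A2 \<Omega>" for f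
    by (rule L2_norm_eq_0_AE[OF hankel_L2[OF that] zero[OF that]])
  have "bounded_operator_A2_L2 \<Omega> H"
    unfolding bounded_operator_A2_L2_def
  proof (intro conjI ballI allI)
    show "H f \<in> L2 \<Omega>" if "f \<in> A2 \<Omega>" for f by (rule hankel_L2[OF that])
    show "\<exists>C. \<forall>f\<in>A2 \<Omega>. L2_norm \<Omega> (H f) \<le> C * L2_norm \<Omega> f"
      by (intro exI[of _ 0]) (simp add: zero)
    fix f g a b assume f: "f \<in> A2 \<Omega>" and g: "g \<in> A2 \<Omega>"
    have "AE z in lebesgue_on \<Omega>. H (\<lambda>w. a * f w + b * g w) z = 0"
      by (intro AE0 A2_add A2_scale f g)
    with AE0[OF f] AE0[OF g]
    show "AE z in lebesgue_on \<Omega>. H (\<lambda>w. a * f w + b * g w) z = a * H f z + b * H g z"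
      by eventually_elim simp
  qed
  moreover obtain E where E: "orthonormal_basis_A2 \<Omega> E"
    using orthonormal_basis_exists by blast
  moreover have "(\<lambda>e. (L2_norm \<Omega> (H e))\<^sup>2) summable_on E"
  proof (rule summable_on_0)
    fix e assume "e \<in> E"
    then have "e \<in> A2 \<Omega>" using E by (auto simp: orthonormal_basis_A2_def)
    then show "(L2_norm \<Omega> (H e))\<^sup>2 = 0" by (simp add: zero)
  qed
  ultimately show ?thesis unfolding hilbert_schmidt_A2_def by blast
qed

theorem corollary1:
  fixes \<Omega> :: "(complex ^ 'n) set" and \<phi> :: "complex ^ 'n \<Rightarrow> complex"
  assumes "CARD('n) \<ge> 2"
    and "open \<Omega>" and "connected \<Omega>" and "\<Omega> \<noteq> {}" and "bounded \<Omega>"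
    and "C2_boundary \<Omega>"
    and "pseudoconvex \<Omega>"
    and "holomorphic_Cn_on \<phi> \<Omega>"
    and "C2_on_closure \<Omega> \<phi>"
  shows "hilbert_schmidt_A2 \<Omega> (hankel \<Omega> (\<lambda>z. cnj (\<phi> z))) \<longleftrightarrow> \<phi> constant_on \<Omega>"
proof -
  \<comment> \<open>The extension beyond the boundary yields boundedness of \<open>\<phi>\<close>,
    by compactness of the closure, and continuity of the gradient, from the second
    derivative.\<close>
  obtain U g where U: "open U" "closure \<Omega> \<subseteq> U" "C2_on U g" "\<And>z. z \<in> closure \<Omega> \<Longrightarrow> g z = \<phi> z"
    using assms(9) unfolding C2_on_closure_def by auto
  obtain g' :: "complex ^ 'n \<Rightarrow> (complex ^ 'n) \<Rightarrow>\<^sub>L complex" and g'' where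
    g': "\<forall>x\<in>U. (g has_derivative blinfun_apply (g' x)) (at x)"
    and g'': "\<forall>x\<in>U. (g' has_derivative blinfun_apply (g'' x)) (at x)"
    using U(3) unfolding C2_on_def by (elim exE conjE)
  have sub: "z \<in> U" if "z \<in> \<Omega>" for z using U(2) closure_subset that by blast
  have "continuous_on (closure \<Omega>) g"
    using g' U(2) by (intro continuous_at_imp_continuous_on) (auto intro: has_derivative_continuous)
  then have "bounded (g ` closure \<Omega>)"
    using assms(5) by (intro compact_imp_bounded compact_continuous_image) simp_all
  then obtain B where B: "\<And>z. z \<in> closure \<Omega> \<Longrightarrow> cmod (g z) \<le> B"
    by (auto simp: bounded_iff)
  have symbol: "holomorphic_symbol \<Omega> \<phi> B"
  proof
    show "cmod (\<phi> z) \<le> B" if "z \<in> \<Omega>" for z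
      using B[of z] U(4)[of z] closure_subset that by auto
  qed (use assms in auto)
  interpret holomorphic_symbol \<Omega> \<phi> B by (rule symbol)
  have grad: "(\<phi> has_derivative blinfun_apply (g' z)) (at z)" if z: "z \<in> \<Omega>" for z
    by (rule has_derivative_transform_within_open[OF g'[rule_format, OF sub[OF z]] assms(2) z])
      (use U(4) closure_subset in blast)
  \<comment> \<open>The real derivative of the extension and the complex linear one of
    \<open>\<phi>\<close> coincide on \<open>\<Omega>\<close>, so the complex partial derivatives
    are the values of \<open>g' z\<close> on the axes and inherit continuity from
    \<open>g'\<close>.\<close>
  have linear: "blinfun_apply (g' z) v = (\<Sum>i\<in>UNIV. blinfun_apply (g' z) (axis i 1) * v $ i)" if z: "z \<in> \<Omega>" for z v
  proof -
    obtain a where "(\<phi> has_derivative (\<lambda>v. \<Sum>i\<in>UNIV. a $ i * v $ i)) (at z)"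
      using assms(8) z unfolding holomorphic_Cn_on_def by blast
    from has_derivative_unique[OF grad[OF z] this]
    have eq: "blinfun_apply (g' z) v = (\<Sum>i\<in>UNIV. a $ i * v $ i)" for v
      by (rule fun_cong)
    have "blinfun_apply (g' z) (axis i 1) = a $ i" for i
      by (simp add: eq axis_def if_distrib[of "(*) _"] cong: if_cong)
    then show ?thesis by (simp add: eq)
  qed
  have D: "((\<lambda>s. \<phi> (z + s *s axis i 1)) has_field_derivative blinfun_apply (g' z) (axis i 1)) (at 0)"
    if z: "z \<in> \<Omega>" for z i
  proof -
    have eq: "(\<lambda>v. \<Sum>k\<in>UNIV. (\<chi> k. blinfun_apply (g' z) (axis k 1)) $ k * v $ k) = blinfun_apply (g' z)"
      unfolding vec_lambda_beta by (rule ext) (rule linear[OF z, symmetric])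
    have "(\<phi> has_derivative (\<lambda>v. \<Sum>k\<in>UNIV. (\<chi> k. blinfun_apply (g' z) (axis k 1)) $ k * v $ k)) (at (z + 0 *s axis i 1))"
      unfolding eq vector_smult_lzero add_0_right by (rule grad[OF z])
    from holomorphic_Cn_slice_derivative[OF this] show ?thesis
      unfolding fun_cong[OF eq] .
  qed
  show ?thesis
  proof
    assume "\<phi> constant_on \<Omega>"
    then obtain c where "\<And>z. z \<in> \<Omega> \<Longrightarrow> \<phi> z = c" unfolding constant_on_def by blast
    then show "hilbert_schmidt_A2 \<Omega> H" by (rule constant_hilbert_schmidt)
  next
    assume "hilbert_schmidt_A2 \<Omega> H"
    then obtain S where S: "trace_bound S" by (rule hilbert_schmidt_trace_bound)
    have zero: "blinfun_apply (g' p) (axis i 1) = 0" if p: "p \<in> \<Omega>" for p i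
    proof (rule ccontr)
      assume nz: "blinfun_apply (g' p) (axis i 1) \<noteq> 0"
      \<comment> \<open>The dimension enters here: the level set needs a direction \<open>j\<close>
        besides \<open>i\<close>.\<close>
      have "\<exists>j :: 'n. i \<noteq> j"
      proof (rule ccontr)
        assume "\<nexists>j. i \<noteq> j"
        then have "(UNIV :: 'n set) = {i}" by auto
        then have "CARD('n) = card {i}" by (rule arg_cong)
        then show False using assms(1) by simp
      qed
      then obtain j where ij: "i \<noteq> j" by blast
      have "isCont g' p"
        using g'' sub[OF p] has_derivative_continuous by blast
      then have "isCont (\<lambda>z. blinfun_apply (g' z) (axis i 1)) p"
        by (intro continuous_intros)
      from nonconstant_not_trace_bound[OF symbol assms(5) ij p this nz D] S show False by blast
    qed
    have "(\<phi> has_derivative (\<lambda>v. 0)) (at z)" if z: "z \<in> \<Omega>" for z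
    proof -
      have "blinfun_apply (g' z) = (\<lambda>v. 0)"
        by (rule ext) (subst linear[OF z], simp add: zero[OF z])
      with grad[OF z] show ?thesis by simp
    qed
    then have "\<phi> z = \<phi> w" if "z \<in> \<Omega>" "w \<in> \<Omega>" for z w
      using has_derivative_zero_unique_connected[OF assms(2,3) _ that] by blast
    then show "\<phi> constant_on \<Omega>" unfolding constant_on_def using assms(4) by blast
  qed
qed

end
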